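(* Let $T\in L(H)^n$ be a pure $m$-hypercontraction, and let $\mathcal D,j,\mathcal D_T,\mathcal M,\Delta_1(z),\Delta_0$ be as in the context. Define $\theta_T:\mathbb B\to L(\mathcal D_T\oplus\mathcal M,\mathcal D)$ by \[ \theta_T(z)=-\Delta_1(z)(T\oplus1_{\mathcal M})+\Delta_0D_{T^*}(1_H-ZT^* )^{-m}Z(D_T,0). \] Then $\theta_T$ induces a partially isometric multiplier $M_{\theta_T}:H_1(\mathbb B,\mathcal D_T\oplus\mathcal M)\to H_m(\mathbb B,\mathcal D)$, $f\mapsto\theta_Tf$, such that \[ M_{\theta_T}M_{\theta_T}^*+jj^*=1_{H_m(\mathbb B,\mathcal D)}. \]
   Context: $\mathbb B=\{z\in\mathbb C^n:\|z\|<1\}$; for $\ell\ge1$, $\rho_\ell(\alpha)=\frac{(\ell+|\alpha|-1)!}{\alpha!(\ell-1)!}$, and $H_\ell(\mathbb B,\mathcal E)$ is the Hilbert space of analytic $f=\sum f_\alpha z^\alpha:\mathbb B\to\mathcal E$ with $\|f\|^2=\sum\|f_\alpha\|^2/\rho_\ell(\alpha)<\infty$ (kernel $(1-\langle z,w\rangle)^{-\ell}1_{\mathcal E}$); $H_0(\mathbb B,\mathcal E)=\mathcal E$ (constant functions). For commuting $T\in L(H)^n$: $\sigma_T(X)=\sum T_iXT_i^*$, $\Delta_T^{(k)}=(1-\sigma_T)^k(1_H)$; $m$-hypercontraction ($m\ge1$): $\Delta_T^{(1)}\ge0,\Delta_T^{(m)}\ge0$; pure: $\sigma_T^k(1_H)\to0$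 strongly. $T$ denotes also the row operator $H^n\to H$, $(h_i)\mapsto\sum T_ih_i$, $T^*$ the column $h\mapsto(T_i^*h)_i$, $Z:H^n\to H$, $(h_i)\mapsto\sum z_ih_i$, $T^{*\alpha}=(\prod T_i^{\alpha_i})^*$. $D_T=(1_{H^n}-T^*T)^{1/2}$, $D_{T^*}=(1_H-TT^* )^{1/2}$, $\mathcal D_T=\overline{D_TH^n}$, $\mathcal D_{T^*}=\overline{D_{T^*}H}$; note $T\mathcal D_T\subset\mathcal D_{T^*}$. $C=(\Delta_T^{(m)})^{1/2}$, $\mathcal D=\overline{CH}$, $j:H\to H_m(\mathbb B,\mathcal D)$, $jx=\sum_\alpha\rho_m(\alpha)(CT^{*\alpha}x)z^\alpha$. Let $\pi:H\to H_{m-1}(\mathbb B,\mathcal D)$ be $\pi x=\sum_\alpha\rho_{m-1}(\alpha)(CT^{*\alpha}x)z^\alpha$ if $m\ge2$ and $\pi=C:H\to\mathcal D$ if $m=1$. Then $\|\pi x\|=\|D_{T^*}x\|$ for $x\in H$, so there is a unique unitary $U:\mathcal D_{T^*}\to\overline{\operatorname{Im}\pi}$ with $UD_{T^*}x=\pi x$. Let $\mathcal M=H_{m-1}(\mathbb B,\mathcal D)\ominus\overline{\operatorname{Im}\pi}$, let $V=(U,i_{\mathcal M}):\mathcal D_{T^*}\oplus\mathcal M\to H_{m-1}(\mathbb B,\mathcal D)$ (with $i_{\mathcal M}$ the inclusion; $V$ is unitary), let $\epsilon_z:H_{m-1}(\mathbb B,\mathcal D)\to\mathcal D$, $f\mapsto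 f(z)$, and set $\Delta_1(z)=\epsilon_z\circ V:\mathcal D_{T^*}\oplus\mathcal M\to\mathcal D$, $\Delta_0=\epsilon_0\circ U:\mathcal D_{T^*}\to\mathcal D$. Here $T\oplus1_{\mathcal M}:\mathcal D_T\oplus\mathcal M\to\mathcal D_{T^*}\oplus\mathcal M$ and $(D_T,0):\mathcal D_T\oplus\mathcal M\to H^n$, $(x,f)\mapsto D_Tx$. A multiplier $M_{\theta}$ is defined by $(M_\theta f)(z)=\theta(z)f(z)$. *)

theory Defs
  imports "HOL-Analysis.Analysis" "HOL-Library.Function_Algebras"
begin

section \<open>Complex vector spaces and complex Hilbert spaces (not in the distribution)\<close>

class cvec = ab_group_add +
  fixes cscale :: "complex \<Rightarrow> 'a \<Rightarrow> 'a"
  assumes cscale_add_right: "cscale c (x + y) = cscale c x + cscale c y"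
    and cscale_add_left: "cscale (a + b) x = cscale a x + cscale b x"
    and cscale_cscale: "cscale a (cscale b x) = cscale (a * b) x"
    and cscale_one: "cscale 1 x = x"

instantiation "fun" :: (type, cvec) cvec
begin
definition cscale_fun :: "complex \<Rightarrow> ('a \<Rightarrow> 'b) \<Rightarrow> 'a \<Rightarrow> 'b"
  where "cscale_fun c f = (\<lambda>x. cscale c (f x))"
instance
  by standard (auto simp: cscale_fun_def cscale_add_right cscale_add_left cscale_cscale cscale_one)
end

instantiation prod :: (cvec, cvec) cvec
begin
definition cscale_prod :: "complex \<Rightarrow> 'a \<times> 'b \<Rightarrow> 'a \<times> 'b"
  where "cscale_prod c p = (cscale c (fst p), cscale c (snd p))"
instance
  by standard (auto simp: cscale_prod_def cscale_add_right cscale_add_left cscale_cscale cscale_one)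
end

text \<open>A complex Hilbert space: a Banach space whose norm comes from a complex inner
  product (linear in the first argument), with the complex scalar multiplication
  extending the real one.\<close>

class chilbert = banach + cvec +
  fixes cinner :: "'a \<Rightarrow> 'a \<Rightarrow> complex"
  assumes scaleR_cscale: "scaleR r x = cscale (complex_of_real r) x"
    and cinner_add_left: "cinner (x + y) z = cinner x z + cinner y z"
    and cinner_cscale_left: "cinner (cscale c x) y = c * cinner x y"
    and cinner_commute: "cinner y x = cnj (cinner x y)"
    and cinner_nonneg: "0 \<le> Re (cinner x x)"
    and cinner_eq_zero: "cinner x x = 0 \<Longrightarrow> x = 0"
    and norm_cinner: "norm x = sqrt (Re (cinner x x))"

section \<open>Generic notions relative to an inner product ip on a subset S\<close>

definition nrm :: "('a \<Rightarrow> 'a \<Rightarrow> complex) \<Rightarrow> 'a \<Rightarrow> real" where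
  "nrm ip x = sqrt (Re (ip x x))"

definition linear_on :: "'a::cvec set \<Rightarrow> 'b::cvec set \<Rightarrow> ('a \<Rightarrow> 'b) \<Rightarrow> bool" where
  "linear_on S W A \<longleftrightarrow> A ` S \<subseteq> W \<and> (\<forall>x\<in>S. \<forall>y\<in>S. A (x + y) = A x + A y)
     \<and> (\<forall>c. \<forall>x\<in>S. A (cscale c x) = cscale c (A x))"

definition bnd_on :: "('a \<Rightarrow> 'a \<Rightarrow> complex) \<Rightarrow> 'a set \<Rightarrow> ('b \<Rightarrow> 'b \<Rightarrow> complex) \<Rightarrow> ('a \<Rightarrow> 'b) \<Rightarrow> bool" where
  "bnd_on ip1 S ip2 A \<longleftrightarrow> (\<exists>K. \<forall>x\<in>S. nrm ip2 (A x) \<le> K * nrm ip1 x)"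

definition is_adj :: "('a \<Rightarrow> 'a \<Rightarrow> complex) \<Rightarrow> 'a set \<Rightarrow> ('b \<Rightarrow> 'b \<Rightarrow> complex) \<Rightarrow> 'b set
    \<Rightarrow> ('a \<Rightarrow> 'b) \<Rightarrow> ('b \<Rightarrow> 'a) \<Rightarrow> bool" where
  "is_adj ip1 S ip2 W A B \<longleftrightarrow> B ` W \<subseteq> S \<and> (\<forall>x\<in>S. \<forall>y\<in>W. ip2 (A x) y = ip1 x (B y))"

text \<open>The adjoint of A : S \<rightarrow> W (only its values on W matter).\<close>
definition adj :: "('a \<Rightarrow> 'a \<Rightarrow> complex) \<Rightarrow> 'a set \<Rightarrow> ('b \<Rightarrow> 'b \<Rightarrow> complex) \<Rightarrow> 'b set
    \<Rightarrow> ('a \<Rightarrow> 'b) \<Rightarrow> ('b \<Rightarrow> 'a)" where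
  "adj ip1 S ip2 W A = (SOME B. is_adj ip1 S ip2 W A B)"

definition posop :: "('a \<Rightarrow> 'a \<Rightarrow> complex) \<Rightarrow> 'a set \<Rightarrow> ('a \<Rightarrow> 'a) \<Rightarrow> bool" where
  "posop ip S A \<longleftrightarrow> (\<forall>x\<in>S. Im (ip (A x) x) = 0 \<and> 0 \<le> Re (ip (A x) x))"

text \<open>The positive square root of a positive operator on S.\<close>
definition psqrt :: "('a::cvec \<Rightarrow> 'a \<Rightarrow> complex) \<Rightarrow> 'a set \<Rightarrow> ('a \<Rightarrow> 'a) \<Rightarrow> ('a \<Rightarrow> 'a)" where
  "psqrt ip S A = (SOME R. linear_on S S R \<and> bnd_on ip S ip R \<and> posop ip S R
                            \<and> (\<forall>x\<in>S. R (R x) = A x))"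

text \<open>Closure (in the norm of ip) of A inside S, and orthogonal complement of A in S.\<close>
definition ncl :: "('a::cvec \<Rightarrow> 'a \<Rightarrow> complex) \<Rightarrow> 'a set \<Rightarrow> 'a set \<Rightarrow> 'a set" where
  "ncl ip S A = {x\<in>S. \<forall>e>0. \<exists>y\<in>A. nrm ip (x - y) < e}"

definition orth :: "('a \<Rightarrow> 'a \<Rightarrow> complex) \<Rightarrow> 'a set \<Rightarrow> 'a set \<Rightarrow> 'a set" where
  "orth ip S A = {x\<in>S. \<forall>y\<in>A. ip x y = 0}"

text \<open>Partial isometry S \<rightarrow> W: bounded linear, isometric on the orthocomplement of its kernel.\<close>
definition pisom :: "('a::cvec \<Rightarrow> 'a \<Rightarrow> complex) \<Rightarrow> 'a set \<Rightarrow> ('b::cvec \<Rightarrow> 'b \<Rightarrow> complex) \<Rightarrow> 'b set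
    \<Rightarrow> ('a \<Rightarrow> 'b) \<Rightarrow> bool" where
  "pisom ip1 S ip2 W A \<longleftrightarrow> linear_on S W A \<and> bnd_on ip1 S ip2 A \<and>
     (\<forall>x\<in>S. (\<forall>y\<in>S. A y = 0 \<longrightarrow> ip1 x y = 0) \<longrightarrow> nrm ip2 (A x) = nrm ip1 x)"

definition opinv :: "('a \<Rightarrow> 'a) \<Rightarrow> ('a \<Rightarrow> 'a)" where
  "opinv A = (SOME B. \<forall>x. A (B x) = x \<and> B (A x) = x)"

section \<open>The unit ball of C^n and the spaces H_l(B,E)\<close>

definition Bn :: "('n::finite \<Rightarrow> complex) set" where
  "Bn = {z. (\<Sum>i\<in>UNIV. (cmod (z i))\<^sup>2) < 1}"

definition zpow :: "('n::finite \<Rightarrow> complex) \<Rightarrow> ('n \<Rightarrow> nat) \<Rightarrow> complex" where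
  "zpow z \<alpha> = (\<Prod>i\<in>UNIV. z i ^ \<alpha> i)"

text \<open>rho_l(alpha) = (l+|alpha|-1)! / (alpha! (l-1)!), for l \<ge> 1.\<close>
definition rho :: "nat \<Rightarrow> ('n::finite \<Rightarrow> nat) \<Rightarrow> real" where
  "rho l \<alpha> = fact (l + sum \<alpha> UNIV - 1) / ((\<Prod>i\<in>UNIV. fact (\<alpha> i)) * fact (l - 1))"

definition is_coef :: "nat \<Rightarrow> ('e \<Rightarrow> 'e \<Rightarrow> complex) \<Rightarrow> 'e set
    \<Rightarrow> (('n::finite \<Rightarrow> nat) \<Rightarrow> 'e::{cvec,topological_space}) \<Rightarrow> (('n \<Rightarrow> complex) \<Rightarrow> 'e) \<Rightarrow> bool" where
  "is_coef l ipE E c f \<longleftrightarrow> (\<forall>\<alpha>. c \<alpha> \<in> E) \<and>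
     (\<lambda>\<alpha>. Re (ipE (c \<alpha>) (c \<alpha>)) / rho l \<alpha>) summable_on UNIV \<and>
     (\<forall>z\<in>Bn. ((\<lambda>\<alpha>. cscale (zpow z \<alpha>) (c \<alpha>)) has_sum f z) UNIV)"

text \<open>H_l(B,E) for a subspace E (with inner product ipE): analytic functions on the ball,
  represented as functions vanishing outside the ball.  H_0(B,E) = constants in E.\<close>
definition hsp :: "nat \<Rightarrow> ('e \<Rightarrow> 'e \<Rightarrow> complex) \<Rightarrow> 'e::{cvec,topological_space} set
    \<Rightarrow> (('n::finite \<Rightarrow> complex) \<Rightarrow> 'e) set" where
  "hsp l ipE E = (if l = 0 then {f. \<exists>e\<in>E. f = (\<lambda>z. if z \<in> Bn then e else 0)}
     else {f. (\<exists>c. is_coef l ipE E c f) \<and> (\<forall>z. z \<notin> Bn \<longrightarrow> f z = 0)})"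

definition hcoef :: "nat \<Rightarrow> ('e \<Rightarrow> 'e \<Rightarrow> complex) \<Rightarrow> 'e::{cvec,topological_space} set
    \<Rightarrow> (('n::finite \<Rightarrow> complex) \<Rightarrow> 'e) \<Rightarrow> ('n \<Rightarrow> nat) \<Rightarrow> 'e" where
  "hcoef l ipE E f = (SOME c. is_coef l ipE E c f)"

definition hip :: "nat \<Rightarrow> ('e \<Rightarrow> 'e \<Rightarrow> complex) \<Rightarrow> 'e::{cvec,topological_space} set
    \<Rightarrow> (('n::finite \<Rightarrow> complex) \<Rightarrow> 'e) \<Rightarrow> (('n \<Rightarrow> complex) \<Rightarrow> 'e) \<Rightarrow> complex" where
  "hip l ipE E f g = (if l = 0 then ipE (f 0) (g 0)
     else infsum (\<lambda>\<alpha>. ipE (hcoef l ipE E f \<alpha>) (hcoef l ipE E g \<alpha>) / complex_of_real (rho l \<alpha>)) UNIV)"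

section \<open>The tuple T and the associated objects\<close>

text \<open>Inner product on H^n.\<close>
definition ipn :: "('n::finite \<Rightarrow> 'h::chilbert) \<Rightarrow> ('n \<Rightarrow> 'h) \<Rightarrow> complex" where
  "ipn x y = (\<Sum>i\<in>UNIV. cinner (x i) (y i))"

definition cblin :: "('h::chilbert \<Rightarrow> 'h) \<Rightarrow> bool" where
  "cblin A \<longleftrightarrow> bounded_linear A \<and> (\<forall>c x. A (cscale c x) = cscale c (A x))"

definition Tst :: "('n \<Rightarrow> 'h::chilbert \<Rightarrow> 'h) \<Rightarrow> 'n \<Rightarrow> 'h \<Rightarrow> 'h" where
  "Tst T i = adj cinner UNIV cinner UNIV (T i)"

definition sigmaT :: "('n::finite \<Rightarrow> 'h::chilbert \<Rightarrow> 'h) \<Rightarrow> ('h \<Rightarrow> 'h) \<Rightarrow> 'h \<Rightarrow> 'h" where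
  "sigmaT T X = (\<lambda>x. \<Sum>i\<in>UNIV. T i (X (Tst T i x)))"

definition DeltaT :: "('n::finite \<Rightarrow> 'h::chilbert \<Rightarrow> 'h) \<Rightarrow> nat \<Rightarrow> 'h \<Rightarrow> 'h" where
  "DeltaT T k = ((\<lambda>X x. X x - sigmaT T X x) ^^ k) id"

definition hypercontraction :: "('n::finite \<Rightarrow> 'h::chilbert \<Rightarrow> 'h) \<Rightarrow> nat \<Rightarrow> bool" where
  "hypercontraction T m \<longleftrightarrow> m \<ge> 1 \<and> posop cinner UNIV (DeltaT T 1) \<and> posop cinner UNIV (DeltaT T m)"

definition pure :: "('n::finite \<Rightarrow> 'h::chilbert \<Rightarrow> 'h) \<Rightarrow> bool" where
  "pure T \<longleftrightarrow> (\<forall>x. (\<lambda>k. ((sigmaT T ^^ k) id) x) \<longlonglongrightarrow> 0)"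

definition enum_n :: "'n::finite list" where
  "enum_n = (SOME xs. distinct xs \<and> set xs = UNIV)"

text \<open>prod_i T_i^{alpha_i} (order irrelevant for commuting T) and T^{*alpha} = (that)^*.\<close>
definition opprod :: "('n::finite \<Rightarrow> 'h \<Rightarrow> 'h) \<Rightarrow> ('n \<Rightarrow> nat) \<Rightarrow> 'h \<Rightarrow> 'h" where
  "opprod T \<alpha> = fold (\<lambda>i F. (T i ^^ \<alpha> i) \<circ> F) enum_n id"

definition Tsa :: "('n::finite \<Rightarrow> 'h::chilbert \<Rightarrow> 'h) \<Rightarrow> ('n \<Rightarrow> nat) \<Rightarrow> 'h \<Rightarrow> 'h" where
  "Tsa T \<alpha> = adj cinner UNIV cinner UNIV (opprod T \<alpha>)"

text \<open>C = (Delta_T^{(m)})^{1/2}, D = closure of range C.\<close>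
definition Cop :: "('n::finite \<Rightarrow> 'h::chilbert \<Rightarrow> 'h) \<Rightarrow> nat \<Rightarrow> 'h \<Rightarrow> 'h" where
  "Cop T m = psqrt cinner UNIV (DeltaT T m)"

definition Dsp :: "('n::finite \<Rightarrow> 'h::chilbert \<Rightarrow> 'h) \<Rightarrow> nat \<Rightarrow> 'h set" where
  "Dsp T m = closure (range (Cop T m))"

definition jmap :: "('n::finite \<Rightarrow> 'h::chilbert \<Rightarrow> 'h) \<Rightarrow> nat \<Rightarrow> 'h \<Rightarrow> ('n \<Rightarrow> complex) \<Rightarrow> 'h" where
  "jmap T m x = (\<lambda>z. if z \<in> Bn then
      infsum (\<lambda>\<alpha>. cscale (complex_of_real (rho m \<alpha>) * zpow z \<alpha>) (Cop T m (Tsa T \<alpha> x))) UNIV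
    else 0)"

definition pimap :: "('n::finite \<Rightarrow> 'h::chilbert \<Rightarrow> 'h) \<Rightarrow> nat \<Rightarrow> 'h \<Rightarrow> ('n \<Rightarrow> complex) \<Rightarrow> 'h" where
  "pimap T m x = (if m = 1 then (\<lambda>z. if z \<in> Bn then Cop T m x else 0)
    else (\<lambda>z. if z \<in> Bn then
      infsum (\<lambda>\<alpha>. cscale (complex_of_real (rho (m - 1) \<alpha>) * zpow z \<alpha>) (Cop T m (Tsa T \<alpha> x))) UNIV
    else 0))"

text \<open>D_{T*} = (1 - T T^*)^{1/2} on H and D_T = (1 - T^* T)^{1/2} on H^n.\<close>
definition DTs :: "('n::finite \<Rightarrow> 'h::chilbert \<Rightarrow> 'h) \<Rightarrow> 'h \<Rightarrow> 'h" where
  "DTs T = psqrt cinner UNIV (\<lambda>x. x - (\<Sum>i\<in>UNIV. T i (Tst T i x)))"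

definition DT :: "('n::finite \<Rightarrow> 'h::chilbert \<Rightarrow> 'h) \<Rightarrow> ('n \<Rightarrow> 'h) \<Rightarrow> 'n \<Rightarrow> 'h" where
  "DT T = psqrt ipn UNIV (\<lambda>x. x - (\<lambda>i. Tst T i (\<Sum>j\<in>UNIV. T j (x j))))"

definition DTs_sp :: "('n::finite \<Rightarrow> 'h::chilbert \<Rightarrow> 'h) \<Rightarrow> 'h set" where
  "DTs_sp T = closure (range (DTs T))"

definition DT_sp :: "('n::finite \<Rightarrow> 'h::chilbert \<Rightarrow> 'h) \<Rightarrow> ('n \<Rightarrow> 'h) set" where
  "DT_sp T = closure (range (DT T))"

text \<open>H_{m-1}(B,D), its inner product, closure of Im pi, and M.\<close>
definition Hm1 :: "('n::finite \<Rightarrow> 'h::chilbert \<Rightarrow> 'h) \<Rightarrow> nat \<Rightarrow> (('n \<Rightarrow> complex) \<Rightarrow> 'h) set" where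
  "Hm1 T m = hsp (m - 1) cinner (Dsp T m)"

definition hipm1 :: "('n::finite \<Rightarrow> 'h::chilbert \<Rightarrow> 'h) \<Rightarrow> nat
    \<Rightarrow> (('n \<Rightarrow> complex) \<Rightarrow> 'h) \<Rightarrow> (('n \<Rightarrow> complex) \<Rightarrow> 'h) \<Rightarrow> complex" where
  "hipm1 T m = hip (m - 1) cinner (Dsp T m)"

definition Impi_cl :: "('n::finite \<Rightarrow> 'h::chilbert \<Rightarrow> 'h) \<Rightarrow> nat \<Rightarrow> (('n \<Rightarrow> complex) \<Rightarrow> 'h) set" where
  "Impi_cl T m = ncl (hipm1 T m) (Hm1 T m) (range (pimap T m))"

definition Msp :: "('n::finite \<Rightarrow> 'h::chilbert \<Rightarrow> 'h) \<Rightarrow> nat \<Rightarrow> (('n \<Rightarrow> complex) \<Rightarrow> 'h) set" where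
  "Msp T m = orth (hipm1 T m) (Hm1 T m) (Impi_cl T m)"

text \<open>U : D_{T*} \<rightarrow> closure(Im pi) unitary with U (D_{T*} x) = pi x.\<close>
definition is_U :: "('n::finite \<Rightarrow> 'h::chilbert \<Rightarrow> 'h) \<Rightarrow> nat \<Rightarrow> ('h \<Rightarrow> ('n \<Rightarrow> complex) \<Rightarrow> 'h) \<Rightarrow> bool" where
  "is_U T m U \<longleftrightarrow> linear_on (DTs_sp T) (Impi_cl T m) U
     \<and> U ` DTs_sp T = Impi_cl T m
     \<and> (\<forall>y\<in>DTs_sp T. hipm1 T m (U y) (U y) = cinner y y)
     \<and> (\<forall>x. U (DTs T x) = pimap T m x)"

text \<open>The space D_T \<oplus> M and its inner product.\<close>
definition Ksp :: "('n::finite \<Rightarrow> 'h::chilbert \<Rightarrow> 'h) \<Rightarrow> nat \<Rightarrow> (('n \<Rightarrow> 'h) \<times> (('n \<Rightarrow> complex) \<Rightarrow> 'h)) set" where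
  "Ksp T m = DT_sp T \<times> Msp T m"

definition ipK :: "('n::finite \<Rightarrow> 'h::chilbert \<Rightarrow> 'h) \<Rightarrow> nat
    \<Rightarrow> ('n \<Rightarrow> 'h) \<times> (('n \<Rightarrow> complex) \<Rightarrow> 'h) \<Rightarrow> ('n \<Rightarrow> 'h) \<times> (('n \<Rightarrow> complex) \<Rightarrow> 'h) \<Rightarrow> complex" where
  "ipK T m p q = ipn (fst p) (fst q) + hipm1 T m (snd p) (snd q)"

text \<open>Z(z) : H^n \<rightarrow> H and Z(z) T^* : H \<rightarrow> H.\<close>
definition Zop :: "('n::finite \<Rightarrow> complex) \<Rightarrow> ('n \<Rightarrow> 'h::chilbert) \<Rightarrow> 'h" where
  "Zop z h = (\<Sum>i\<in>UNIV. cscale (z i) (h i))"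

definition ZTs :: "('n::finite \<Rightarrow> 'h::chilbert \<Rightarrow> 'h) \<Rightarrow> ('n \<Rightarrow> complex) \<Rightarrow> 'h \<Rightarrow> 'h" where
  "ZTs T z x = (\<Sum>i\<in>UNIV. cscale (z i) (Tst T i x))"

text \<open>theta_T(z)(x,g) = -Delta_1(z)(T x, g) + Delta_0 D_{T*} (1 - Z T^*)^{-m} Z (D_T x),
  where Delta_1(z)(y,g) = (V(y,g))(z) = (U y)(z) + g(z) and Delta_0 y = (U y)(0).\<close>
definition theta :: "('n::finite \<Rightarrow> 'h::chilbert \<Rightarrow> 'h) \<Rightarrow> nat \<Rightarrow> ('h \<Rightarrow> ('n \<Rightarrow> complex) \<Rightarrow> 'h)
    \<Rightarrow> ('n \<Rightarrow> complex) \<Rightarrow> ('n \<Rightarrow> 'h) \<times> (('n \<Rightarrow> complex) \<Rightarrow> 'h) \<Rightarrow> 'h" where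
  "theta T m U z p =
     - (U (\<Sum>i\<in>UNIV. T i (fst p i)) z + snd p z)
     + U (DTs T (opinv ((\<lambda>y. y - ZTs T z y) ^^ m) (Zop z (DT T (fst p))))) 0"

definition Mtheta :: "('n::finite \<Rightarrow> 'h::chilbert \<Rightarrow> 'h) \<Rightarrow> nat \<Rightarrow> ('h \<Rightarrow> ('n \<Rightarrow> complex) \<Rightarrow> 'h)
    \<Rightarrow> (('n \<Rightarrow> complex) \<Rightarrow> ('n \<Rightarrow> 'h) \<times> (('n \<Rightarrow> complex) \<Rightarrow> 'h)) \<Rightarrow> ('n \<Rightarrow> complex) \<Rightarrow> 'h" where
  "Mtheta T m U f = (\<lambda>z. if z \<in> Bn then theta T m U z (f z) else 0)"

end

theory Submission
  imports Defs
begin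

text \<open>
  Normalise the coefficients of \<open>f \<in> H\<^sub>m\<close> to \<open>s\<^sub>\<alpha> = f\<^sub>\<alpha> / \<rho>\<^sub>m(\<alpha>)\<close>. Then
  \<open>\<parallel>f\<parallel>\<^sup>2 = \<Sum> \<rho>\<^sub>m(\<alpha>) \<parallel>s\<^sub>\<alpha>\<parallel>\<^sup>2\<close>, the adjoint of multiplication by \<open>z\<^sub>i\<close> shifts \<open>s\<close>, and the
  recursion \<open>\<rho>\<^sub>m(\<alpha>) = \<rho>\<^sub>m\<^sub>-\<^sub>1(\<alpha>) + \<Sum>\<^sub>i \<rho>\<^sub>m(\<alpha> - e\<^sub>i)\<close> says
  \<open>\<parallel>f\<parallel>\<^sup>2 = \<parallel>Lf\<parallel>\<^sup>2 + \<Sum>\<^sub>i \<parallel>M\<^sub>i\<^sup>* f\<parallel>\<^sup>2\<close>, where \<open>Lf \<in> H\<^sub>m\<^sub>-\<^sub>1\<close> has the normalised coefficients of \<open>f\<close>.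
  Let \<open>\<Theta>\<^sup>*\<close> be the adjoint of \<open>x \<mapsto> \<theta>\<^sub>T(\<cdot>) x\<close> and \<open>G(f) = \<parallel>f\<parallel>\<^sup>2 - \<parallel>j\<^sup>* f\<parallel>\<^sup>2\<close>. Since
  \<open>T D\<^sub>T = D\<^sub>T\<^sub>* T\<close>, the matrix with rows \<open>(-T\<^sup>*, D\<^sub>T)\<close> and \<open>(D\<^sub>T\<^sub>*, T)\<close> is unitary, which turns the
  definition of \<open>\<theta>\<^sub>T\<close> into \<open>\<parallel>\<Theta>\<^sup>* f\<parallel>\<^sup>2 = G(f) - \<Sum>\<^sub>i G(M\<^sub>i\<^sup>* f)\<close>. Applied to all shifts of \<open>f\<close> this
  telescopes to \<open>\<parallel>M\<^sub>\<theta>\<^sup>* f\<parallel>\<^sup>2 = G(f)\<close>, that is, \<open>M\<^sub>\<theta> M\<^sub>\<theta>\<^sup>* + j j\<^sup>* = 1\<close>. By the same recursion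
  \<open>\<parallel>x\<parallel>\<^sup>2 - \<parallel>jx\<parallel>\<^sup>2\<close> is invariant under \<open>x \<mapsto> (T\<^sub>i\<^sup>* x)\<^sub>i\<close>, so purity makes \<open>j\<close> an isometry;
  hence \<open>M\<^sub>\<theta> M\<^sub>\<theta>\<^sup>*\<close> is a projection and \<open>M\<^sub>\<theta>\<close> a partial isometry.
\<close>

section \<open>Inner product spaces\<close>

text \<open>Two obstacles shape the argument. The inner products \<open>hip\<close> and
  \<open>ipK\<close> are meaningful only on a carrier set of functions, so the geometry is set up
  relative to a carrier. Riesz representation is used in \<open>H\<close> and in its closed
  subspaces, which yields \<open>j^*\<close> and \<open>U^*\<close>; the adjoint of M_\<theta> takes
  values in a function space and is written down through its coefficients. Moreover it is not known
  beforehand that \<theta>_T f lies in H_m. The order is therefore reversed: the candidate for the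
  adjoint comes first, telescoping computes its norm, and square summability of the coefficients of
  \<theta>_T f follows by pairing them with their own finite truncations. The weight of H_1 is
  forced by the telescoping: among the words in the n adjoint shifts, exactly
  \<open>rho 1 \<beta>\<close> have content \<beta>.\<close>

locale ipspace =
  fixes ip :: "'a::cvec \<Rightarrow> 'a \<Rightarrow> complex" and S :: "'a set"
  assumes add_closed: "x \<in> S \<Longrightarrow> y \<in> S \<Longrightarrow> x + y \<in> S"
    and scale_closed: "x \<in> S \<Longrightarrow> cscale c x \<in> S"
    and zero_closed: "0 \<in> S"
    and ip_add_left: "x \<in> S \<Longrightarrow> y \<in> S \<Longrightarrow> z \<in> S \<Longrightarrow> ip (x + y) z = ip x z + ip y z"
    and ip_scale_left: "x \<in> S \<Longrightarrow> y \<in> S \<Longrightarrow> ip (cscale c x) y = c * ip x y"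
    and ip_commute: "x \<in> S \<Longrightarrow> y \<in> S \<Longrightarrow> ip y x = cnj (ip x y)"
    and ip_nonneg: "x \<in> S \<Longrightarrow> 0 \<le> Re (ip x x)"
    and ip_definite: "x \<in> S \<Longrightarrow> ip x x = 0 \<Longrightarrow> x = 0"

lemma cscale_zero_left [simp]: "cscale 0 x = (0::'a::cvec)"
  using cscale_add_left[of 0 0 x] by simp

lemma cscale_zero_right [simp]: "cscale c 0 = (0::'a::cvec)"
  using cscale_add_right[of c 0 0] by simp

lemma cscale_minus_left: "cscale (- c) x = - cscale c (x::'a::cvec)"
  using cscale_add_left[of c "- c" x] by (simp add: eq_neg_iff_add_eq_0 add.commute)

lemma cscale_minus_right: "cscale c (- x) = - cscale c (x::'a::cvec)"
  using cscale_add_right[of c x "- x"] by (simp add: eq_neg_iff_add_eq_0 add.commute)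

lemma cscale_neg_one: "cscale (- 1) x = - (x::'a::cvec)"
  by (simp add: cscale_minus_left cscale_one)

lemma cscale_diff_right: "cscale c (x - y) = cscale c x - cscale c (y::'a::cvec)"
  using cscale_add_right[of c x "- y"] by (simp add: cscale_minus_right)

lemma cscale_sum_right: "cscale c (sum f A) = (\<Sum>i\<in>A. cscale c (f i :: 'a::cvec))"
  by (induction A rule: infinite_finite_induct) (simp_all add: cscale_add_right)

context ipspace
begin

abbreviation nm where "nm \<equiv> nrm ip"

lemma uminus_closed: "x \<in> S \<Longrightarrow> - x \<in> S"
  using scale_closed[of x "-1"] by (simp add: cscale_neg_one)

lemma diff_closed: "x \<in> S \<Longrightarrow> y \<in> S \<Longrightarrow> x - y \<in> S"
  using add_closed[of x "- y"] uminus_closed[of y] by simp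

lemma sum_closed: "(\<And>i. i \<in> A \<Longrightarrow> f i \<in> S) \<Longrightarrow> sum f A \<in> S"
  by (induction A rule: infinite_finite_induct) (auto simp: zero_closed add_closed)

lemma ip_add_right: "x \<in> S \<Longrightarrow> y \<in> S \<Longrightarrow> z \<in> S \<Longrightarrow> ip x (y + z) = ip x y + ip x z"
  by (metis add_closed complex_cnj_add ip_add_left ip_commute)

lemma ip_scale_right: "x \<in> S \<Longrightarrow> y \<in> S \<Longrightarrow> ip x (cscale c y) = cnj c * ip x y"
  by (metis scale_closed complex_cnj_mult ip_scale_left ip_commute)

lemma ip_minus_left: "x \<in> S \<Longrightarrow> y \<in> S \<Longrightarrow> ip (- x) y = - ip x y"
  using ip_scale_left[of x y "-1"] by (simp add: cscale_neg_one)

lemma ip_minus_right: "x \<in> S \<Longrightarrow> y \<in> S \<Longrightarrow> ip x (- y) = - ip x y"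
  using ip_scale_right[of x y "-1"] by (simp add: cscale_neg_one)

lemma ip_diff_left: "x \<in> S \<Longrightarrow> y \<in> S \<Longrightarrow> z \<in> S \<Longrightarrow> ip (x - y) z = ip x z - ip y z"
  using ip_add_left[of x "- y" z] by (simp add: ip_minus_left uminus_closed)

lemma ip_diff_right: "x \<in> S \<Longrightarrow> y \<in> S \<Longrightarrow> z \<in> S \<Longrightarrow> ip x (y - z) = ip x y - ip x z"
  using ip_add_right[of x y "- z"] by (simp add: ip_minus_right uminus_closed)

lemma ip_zero_left [simp]: "x \<in> S \<Longrightarrow> ip 0 x = 0"
  using ip_scale_left[of x x 0] by simp

lemma ip_zero_right [simp]: "x \<in> S \<Longrightarrow> ip x 0 = 0"
  using ip_scale_right[of x x 0] by simp

lemma ip_sum_left: "(\<And>i. i \<in> A \<Longrightarrow> f i \<in> S) \<Longrightarrow> y \<in> S \<Longrightarrow> ip (sum f A) y = (\<Sum>i\<in>A. ip (f i) y)"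
  by (induction A rule: infinite_finite_induct) (auto simp: ip_add_left sum_closed)

lemma ip_sum_right: "(\<And>i. i \<in> A \<Longrightarrow> f i \<in> S) \<Longrightarrow> y \<in> S \<Longrightarrow> ip y (sum f A) = (\<Sum>i\<in>A. ip y (f i))"
  by (induction A rule: infinite_finite_induct) (auto simp: ip_add_right sum_closed)

lemma ip_self_real: "x \<in> S \<Longrightarrow> Im (ip x x) = 0"
  using ip_commute[of x x] by (simp add: complex_eq_iff)

lemma nm_nonneg [simp]: "x \<in> S \<Longrightarrow> 0 \<le> nm x"
  by (simp add: nrm_def ip_nonneg)

lemma nm_sq: "x \<in> S \<Longrightarrow> (nm x)\<^sup>2 = Re (ip x x)"
  by (simp add: nrm_def ip_nonneg)

lemma ip_self: "x \<in> S \<Longrightarrow> ip x x = complex_of_real ((nm x)\<^sup>2)"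
  by (simp add: nm_sq complex_eq_iff ip_self_real)

lemma nm_eq_0: "x \<in> S \<Longrightarrow> nm x = 0 \<Longrightarrow> x = 0"
  using ip_self[of x] ip_definite by simp

lemma nm_zero [simp]: "nm 0 = 0"
  using zero_closed by (simp add: nrm_def)

lemma nm_scale: "x \<in> S \<Longrightarrow> nm (cscale c x) = cmod c * nm x"
proof -
  assume x: "x \<in> S"
  have "ip (cscale c x) (cscale c x) = (c * cnj c) * ip x x"
    using x by (simp add: scale_closed ip_scale_left ip_scale_right)
  also have "\<dots> = of_real ((cmod c)\<^sup>2 * (nm x)\<^sup>2)"
    using x by (simp only: ip_self complex_norm_square[symmetric] of_real_mult)
  finally have "(nm (cscale c x))\<^sup>2 = (cmod c * nm x)\<^sup>2"
    using x by (simp add: nm_sq[OF scale_closed] power_mult_distrib)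
  then show ?thesis using x by (simp add: scale_closed power2_eq_iff_nonneg)
qed

lemma nm_minus: "x \<in> S \<Longrightarrow> nm (- x) = nm x"
  using nm_scale[of x "-1"] by (simp add: cscale_neg_one)

lemma nm_add_sq: "x \<in> S \<Longrightarrow> y \<in> S \<Longrightarrow> (nm (x + y))\<^sup>2 = (nm x)\<^sup>2 + (nm y)\<^sup>2 + 2 * Re (ip x y)"
  using ip_commute[of x y]
  by (simp add: nm_sq add_closed ip_add_left ip_add_right)

lemma nm_diff_sq: "x \<in> S \<Longrightarrow> y \<in> S \<Longrightarrow> (nm (x - y))\<^sup>2 = (nm x)\<^sup>2 + (nm y)\<^sup>2 - 2 * Re (ip x y)"
  using nm_add_sq[of x "- y"] by (simp add: uminus_closed ip_minus_right nm_minus)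

lemma Cauchy_Schwarz:
  assumes "x \<in> S" "y \<in> S"
  shows "cmod (ip x y) \<le> nm x * nm y"
proof (cases "nm y = 0")
  case True
  then show ?thesis using assms nm_eq_0 by fastforce
next
  case False
  define N where "N = (nm y)\<^sup>2"
  define c where "c = ip x y / of_real N"
  have N: "N > 0" using False by (simp add: N_def)
  have cy: "cscale c y \<in> S" using assms scale_closed by auto
  have r: "cnj c * ip x y = of_real ((cmod (ip x y))\<^sup>2 / N)"
    by (simp only: c_def complex_norm_square of_real_divide complex_cnj_divide
        complex_cnj_complex_of_real times_divide_eq_left) (simp add: mult.commute)
  have "0 \<le> (nm (x - cscale c y))\<^sup>2" by simp
  also have "\<dots> = (nm x)\<^sup>2 + (cmod c * nm y)\<^sup>2 - 2 * ((cmod (ip x y))\<^sup>2 / N)"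
    unfolding nm_diff_sq[OF assms(1) cy] nm_scale[OF assms(2)] ip_scale_right[OF assms] r by simp
  also have "(cmod c * nm y)\<^sup>2 = (cmod (ip x y))\<^sup>2 / N"
    using N by (simp add: c_def norm_divide power_mult_distrib power_divide flip: N_def)
       (simp add: power2_eq_square)
  finally have "(cmod (ip x y))\<^sup>2 / N \<le> (nm x)\<^sup>2" by simp
  then have "(cmod (ip x y))\<^sup>2 \<le> (nm x * nm y)\<^sup>2"
    using N by (simp add: field_simps N_def power_mult_distrib)
  then show ?thesis using assms by (simp add: power2_le_iff_abs_le)
qed

lemma ip_ext:
  assumes "x \<in> S" "y \<in> S" "\<And>z. z \<in> S \<Longrightarrow> ip z x = ip z y"
  shows "x = y"
proof -
  have "ip (x - y) (x - y) = 0"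
    using assms by (simp add: ip_diff_right diff_closed)
  then show ?thesis using ip_definite[of "x - y"] diff_closed assms by auto
qed

lemma ipspace_subspace:
  assumes "W \<subseteq> S" "0 \<in> W" "\<And>x y. x \<in> W \<Longrightarrow> y \<in> W \<Longrightarrow> x + y \<in> W" "\<And>c x. x \<in> W \<Longrightarrow> cscale c x \<in> W"
  shows "ipspace ip W"
  using assms by unfold_locales
    (blast intro: ip_add_left ip_scale_left ip_nonneg ip_definite ip_commute)+

text \<open>\<open>adj\<close> is a choice among all adjoints. Definiteness of \<open>ip\<close>
  leaves only one possible value at each point of \<open>W\<close>, so exhibiting a single adjoint
  evaluates \<open>adj\<close>.\<close>

lemma adj_eq:
  assumes B: "is_adj ip S ip2 W A B" and y: "y \<in> W"
  shows "adj ip S ip2 W A y = B y"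
proof -
  have "is_adj ip S ip2 W A (adj ip S ip2 W A)"
    unfolding adj_def using B by (rule someI[of "is_adj ip S ip2 W A"])
  with B y show ?thesis
    by (intro ip_ext) (auto simp: is_adj_def)
qed

end

section \<open>Complex Hilbert spaces\<close>

global_interpretation H: ipspace "cinner :: 'h::chilbert \<Rightarrow> 'h \<Rightarrow> complex" UNIV
  by standard
    (simp_all add: cinner_add_left cinner_cscale_left cinner_nonneg cinner_eq_zero cinner_commute[symmetric])

lemma nrm_cinner [simp]: "nrm cinner x = norm (x::'h::chilbert)"
  by (simp add: nrm_def norm_cinner)

lemmas cinner_simps = H.ip_add_left[OF UNIV_I UNIV_I UNIV_I] H.ip_add_right[OF UNIV_I UNIV_I UNIV_I]
  H.ip_diff_left[OF UNIV_I UNIV_I UNIV_I] H.ip_diff_right[OF UNIV_I UNIV_I UNIV_I]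
  H.ip_minus_left[OF UNIV_I UNIV_I] H.ip_minus_right[OF UNIV_I UNIV_I]
  H.ip_scale_left[OF UNIV_I UNIV_I] H.ip_scale_right[OF UNIV_I UNIV_I]
  H.ip_zero_left[OF UNIV_I] H.ip_zero_right[OF UNIV_I]

lemmas cinner_sum_left = H.ip_sum_left[OF UNIV_I UNIV_I]
lemmas cinner_sum_right = H.ip_sum_right[OF UNIV_I UNIV_I]
lemmas cinner_self = H.ip_self[OF UNIV_I, simplified]
lemmas cmod_cinner_le = H.Cauchy_Schwarz[OF UNIV_I UNIV_I, simplified]

lemma cinner_ext: "(\<And>z. cinner z x = cinner z y) \<Longrightarrow> x = (y::'h::chilbert)"
  by (rule H.ip_ext) auto

lemma norm_cscale [simp]: "norm (cscale c x) = cmod c * norm (x::'h::chilbert)"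
  using H.nm_scale[of x c] by simp

lemma bounded_linear_cscale_right: "bounded_linear (\<lambda>x. cscale c (x::'h::chilbert))"
  by (rule bounded_linear_intro[of _ "cmod c"])
     (auto simp: cscale_add_right scaleR_cscale cscale_cscale mult.commute)

lemma bounded_linear_cinner_left: "bounded_linear (\<lambda>x. cinner x (y::'h::chilbert))"
  by (rule bounded_linear_intro[of _ "norm y"])
     (auto simp: cinner_simps scaleR_cscale scaleR_conv_of_real cmod_cinner_le)

lemma scaleR_cscale_commute: "cscale c (scaleR r x) = scaleR r (cscale c (x::'h::chilbert))"
  by (simp add: scaleR_cscale cscale_cscale mult.commute)

lemma cblin_add: "cblin A \<Longrightarrow> A (x + y) = A x + A y"
  by (simp add: cblin_def linear_simps)

lemma cblin_cscale: "cblin A \<Longrightarrow> A (cscale c x) = cscale c (A x)"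
  by (simp add: cblin_def)

lemma cblin_bounded: "cblin A \<Longrightarrow> bounded_linear A"
  by (simp add: cblin_def)

lemma bounded_linear_cscaleI:
  fixes A :: "'a::chilbert \<Rightarrow> 'b::chilbert"
  assumes "\<And>x y. A (x + y) = A x + A y" "\<And>c x. A (cscale c x) = cscale c (A x)"
    "\<And>x. norm (A x) \<le> K * norm x"
  shows "bounded_linear A"
  by (rule bounded_linear_intro[of _ K]) (use assms in \<open>auto simp: scaleR_cscale mult.commute\<close>)

text \<open>The representing vector minimises \<open>\<parallel>x\<parallel>\<^sup>2 - 2 Re (\<phi> x)\<close> on the subspace.\<close>

lemma Riesz_closed_subspace:
  fixes S :: "'h::chilbert set" and \<phi> :: "'h \<Rightarrow> complex"
  assumes cl: "closed S" and z: "0 \<in> S" and add: "\<And>x y. x \<in> S \<Longrightarrow> y \<in> S \<Longrightarrow> x + y \<in> S"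
    and sc: "\<And>c x. x \<in> S \<Longrightarrow> cscale c x \<in> S"
    and \<phi>add: "\<And>x y. x \<in> S \<Longrightarrow> y \<in> S \<Longrightarrow> \<phi> (x + y) = \<phi> x + \<phi> y"
    and \<phi>sc: "\<And>c x. x \<in> S \<Longrightarrow> \<phi> (cscale c x) = c * \<phi> x"
    and bd: "\<And>x. x \<in> S \<Longrightarrow> cmod (\<phi> x) \<le> K * norm x"
  shows "\<exists>y\<in>S. \<forall>x\<in>S. \<phi> x = cinner x y"
proof -
  define F where "F x = (norm x)\<^sup>2 - 2 * Re (\<phi> x)" for x
  have scR: "scaleR r x \<in> S" if "x \<in> S" for r x by (simp only: scaleR_cscale sc that)
  have diff: "x - y \<in> S" if "x \<in> S" "y \<in> S" for x y
    using add[OF that(1) scR[OF that(2), of "-1"]] by simp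
  have \<phi>R: "\<phi> (scaleR r x) = of_real r * \<phi> x" if "x \<in> S" for r x
    using \<phi>sc that by (simp add: scaleR_cscale)
  have \<phi>diff: "\<phi> (x - y) = \<phi> x - \<phi> y" if "x \<in> S" "y \<in> S" for x y
    using \<phi>add[OF that(1) scR[OF that(2), of "-1"]] \<phi>R[OF that(2), of "-1"] by simp
  have Fge: "F x \<ge> - K\<^sup>2" if "x \<in> S" for x
  proof -
    have "Re (\<phi> x) \<le> K * norm x" using bd[OF that] complex_Re_le_cmod order_trans by blast
    moreover have "0 \<le> (norm x - K)\<^sup>2" by simp
    ultimately show ?thesis by (simp add: F_def power2_diff mult.commute)
  qed
  define d where "d = Inf (F ` S)"
  have bdd: "bdd_below (F ` S)" using Fge by (auto intro!: bdd_belowI2)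
  have dle: "d \<le> F x" if "x \<in> S" for x unfolding d_def using bdd that by (simp add: cInf_lower)
  have "\<exists>x\<in>S. F x < d + 1 / Suc n" for n
  proof -
    have "Inf (F ` S) < d + 1 / Suc n" by (simp add: d_def)
    then show ?thesis using cInf_lessD[of "F ` S"] z by blast
  qed
  then obtain X where X: "\<And>n. X n \<in> S" "\<And>n. F (X n) < d + 1 / Suc n" by metis
  \<comment> \<open>The parallelogram law for \<open>F\<close>: the additive part
    \<open>\<phi>\<close> cancels. Since \<open>F\<close> is at least \<open>d\<close> at the
    midpoint, minimising sequences are Cauchy.\<close>
  have par: "(norm (x - y))\<^sup>2 = 2 * F x + 2 * F y - 4 * F (scaleR (1/2) (x + y))" if "x \<in> S" "y \<in> S" for x y
  proof -
    have "(norm (scaleR (1/2) (x + y)))\<^sup>2 = (norm (x + y))\<^sup>2 / 4"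
      by (simp add: power_divide)
    moreover have "Re (\<phi> (scaleR (1/2) (x + y))) = (Re (\<phi> x) + Re (\<phi> y)) / 2"
      using that \<phi>R add \<phi>add by simp
    ultimately show ?thesis
      using H.nm_add_sq[of x y] H.nm_diff_sq[of x y] by (simp add: F_def)
  qed
  have XX: "(norm (X n - X k))\<^sup>2 < 2 / Suc n + 2 / Suc k" for n k
    using par[OF X(1)[of n] X(1)[of k]] X(2)[of n] X(2)[of k]
      dle[OF scR[OF add[OF X(1)[of n] X(1)[of k]]], of "1/2"] by simp
  have "Cauchy X"
  proof (rule metric_CauchyI)
    fix e :: real assume e: "e > 0"
    obtain N where N: "4 / e\<^sup>2 < real N" using reals_Archimedean2 by blast
    have "dist (X a) (X b) < e" if "a \<ge> N" "b \<ge> N" for a b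
    proof -
      have N0: "real N > 0" using N e by (smt (verit) divide_pos_pos zero_less_power)
      have "2 / Suc a \<le> 2 / real N" "2 / Suc b \<le> 2 / real N" using that N0 by (auto simp: frac_le)
      moreover have "4 / real N < e\<^sup>2" using N N0 e by (simp add: field_simps)
      ultimately have "(norm (X a - X b))\<^sup>2 < e\<^sup>2" using XX[of a b] by simp
      then show ?thesis using e by (simp add: dist_norm power2_less_imp_less)
    qed
    then show "\<exists>M. \<forall>m\<ge>M. \<forall>n\<ge>M. dist (X m) (X n) < e" by blast
  qed
  then obtain y where y: "X \<longlonglongrightarrow> y" using Cauchy_convergent convergent_def by blast
  have yS: "y \<in> S" using cl X(1) y closed_sequentially by blast
  have \<phi>lim: "(\<lambda>n. \<phi> (X n)) \<longlonglongrightarrow> \<phi> y"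
  proof (rule Lim_null[THEN iffD2], rule Lim_null_comparison)
    show "\<forall>\<^sub>F n in sequentially. norm (\<phi> (X n) - \<phi> y) \<le> K * norm (X n - y)"
      using bd diff X(1) yS \<phi>diff by (metis (mono_tags, lifting) always_eventually)
    show "(\<lambda>n. K * norm (X n - y)) \<longlonglongrightarrow> 0"
      using y by (auto intro!: tendsto_mult_right_zero tendsto_norm_zero simp: Lim_null[symmetric])
  qed
  have "(\<lambda>n. F (X n)) \<longlonglongrightarrow> F y"
    unfolding F_def by (intro tendsto_intros y \<phi>lim)
  moreover have "(\<lambda>n. d + 1 / Suc n) \<longlonglongrightarrow> d + 0"
    by (intro tendsto_intros) (use LIMSEQ_inverse_real_of_nat in \<open>simp add: inverse_eq_divide\<close>)
  ultimately have "F y \<le> d + 0"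
    by (rule LIMSEQ_le) (use X(2) less_imp_le in blast)
  then have Fy: "F y \<le> F x" if "x \<in> S" for x using dle[OF that] by simp
  have re: "Re (cinner x y) = Re (\<phi> x)" if x: "x \<in> S" for x
  proof -
    define a where "a = Re (cinner x y) - Re (\<phi> x)"
    have ge: "0 \<le> t\<^sup>2 * (norm x)\<^sup>2 + 2 * t * a" for t
    proof -
      have "F y \<le> F (y + scaleR t x)" using Fy add yS scR x by blast
      moreover have "Re (cinner y x) = Re (cinner x y)" using cinner_commute[of x y] by simp
      moreover have "Re (\<phi> (y + scaleR t x)) = Re (\<phi> y) + t * Re (\<phi> x)"
        by (simp add: \<phi>add[OF yS scR[OF x]] \<phi>R[OF x])
      moreover have "(norm (y + scaleR t x))\<^sup>2 = (norm y)\<^sup>2 + t\<^sup>2 * (norm x)\<^sup>2 + 2 * (t * Re (cinner y x))"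
        using H.nm_add_sq[of y "scaleR t x"] by (simp add: cinner_simps scaleR_cscale power_mult_distrib)
      ultimately show ?thesis
        by (simp add: F_def a_def algebra_simps)
    qed
    have "a = 0"
    proof (rule ccontr)
      assume "a \<noteq> 0"
      \<comment> \<open>The quadratic inequality \<open>ge\<close> is tested at
        \<open>t = - a / q\<close>. The summand 1 keeps the denominator positive when
        \<open>x = 0\<close>.\<close>
      define q where "q = (norm x)\<^sup>2 + 1"
      have q: "q > 0" by (simp add: q_def add_nonneg_pos)
      have "t\<^sup>2 * (norm x)\<^sup>2 \<le> t\<^sup>2 * q" for t :: real by (simp add: q_def mult_left_mono)
      then have "0 \<le> (- a / q)\<^sup>2 * q + 2 * (- a / q) * a" using ge[of "- a / q"] by (smt (verit))
      also have "\<dots> = - (a\<^sup>2 / q)" using q by (simp add: power2_eq_square field_simps)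
      also have "\<dots> < 0" using q \<open>a \<noteq> 0\<close> by simp
      finally show False by simp
    qed
    then show ?thesis by (simp add: a_def)
  qed
  have "\<phi> x = cinner x y" if x: "x \<in> S" for x
  proof -
    \<comment> \<open>The imaginary part at \<open>x\<close> is read off from the real part at
      \<open>\<i> x\<close>.\<close>
    have "Im (cinner x y) = Im (\<phi> x)"
      using re[OF sc[OF x, of \<i>]] \<phi>sc[OF x] by (simp add: cinner_simps)
    then show ?thesis using re[OF x] by (simp add: complex_eq_iff)
  qed
  then show ?thesis using yS by blast
qed

lemma Riesz_representation:
  fixes \<phi> :: "'h::chilbert \<Rightarrow> complex"
  assumes "\<And>x y. \<phi> (x + y) = \<phi> x + \<phi> y" "\<And>c x. \<phi> (cscale c x) = c * \<phi> x" "\<And>x. cmod (\<phi> x) \<le> K * norm x"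
  shows "\<exists>y. \<forall>x. \<phi> x = cinner x y"
  using Riesz_closed_subspace[of UNIV \<phi> K] assms by auto

lemma adjoint_exists:
  fixes A :: "'a::chilbert \<Rightarrow> 'b::chilbert"
  assumes b: "bounded_linear A" and s: "\<And>c x. A (cscale c x) = cscale c (A x)"
  shows "\<exists>B. \<forall>x y. cinner (A x) y = cinner x (B y)"
proof -
  interpret bounded_linear A by (rule b)
  obtain K where K: "\<And>x. norm (A x) \<le> norm x * K" using bounded by blast
  have "\<exists>z. \<forall>x. cinner (A x) y = cinner x z" for y
  proof (rule Riesz_representation[where K = "K * norm y"])
    fix x
    have "cmod (cinner (A x) y) \<le> norm (A x) * norm y" by (rule cmod_cinner_le)
    also have "\<dots> \<le> norm x * K * norm y" using K by (simp add: mult_right_mono)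
    finally show "cmod (cinner (A x) y) \<le> K * norm y * norm x" by (simp add: algebra_simps)
  qed (simp_all add: add s cinner_simps)
  then show ?thesis by metis
qed

lemma adj_cinner:
  fixes A :: "'a::chilbert \<Rightarrow> 'b::chilbert"
  assumes b: "bounded_linear A" and s: "\<And>c x. A (cscale c x) = cscale c (A x)"
  shows "cinner (A x) y = cinner x (adj cinner UNIV cinner UNIV A y)"
proof -
  have "\<exists>B. is_adj cinner UNIV cinner UNIV A B"
    using adjoint_exists[OF assms] by (auto simp: is_adj_def)
  then have "is_adj cinner UNIV cinner UNIV A (adj cinner UNIV cinner UNIV A)"
    unfolding adj_def by (rule someI_ex)
  then show ?thesis by (simp add: is_adj_def)
qed

lemma adjoint_add: 
  assumes "\<And>x y. cinner (A x) y = cinner (x::'a::chilbert) (B (y::'b::chilbert))"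
  shows "B (u + v) = B u + B v"
  by (rule cinner_ext) (simp add: cinner_simps flip: assms)

lemma adjoint_cscale: 
  assumes "\<And>x y. cinner (A x) y = cinner (x::'a::chilbert) (B (y::'b::chilbert))"
  shows "B (cscale c v) = cscale c (B v)"
  by (rule cinner_ext) (simp add: cinner_simps flip: assms)

lemma adjoint_norm_le: 
  assumes "\<And>x y. cinner (A x) y = cinner (x::'a::chilbert) (B (y::'b::chilbert))"
    and K: "\<And>x. norm (A x) \<le> K * norm x" "K \<ge> 0"
  shows "norm (B v) \<le> K * norm v"
proof (cases "norm (B v) = 0")
  case False
  have "(norm (B v))\<^sup>2 = Re (cinner (A (B v)) v)" by (simp add: assms cinner_self)
  also have "\<dots> \<le> norm (A (B v)) * norm v"
    by (rule order_trans[OF complex_Re_le_cmod cmod_cinner_le])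
  also have "\<dots> \<le> K * norm (B v) * norm v" using K by (simp add: mult_right_mono)
  finally have "norm (B v) * norm (B v) \<le> norm (B v) * (K * norm v)" by (simp add: power2_eq_square algebra_simps)
  then show ?thesis using False by simp
qed (use K in simp)

lemma adjoint_bounded: 
  assumes "\<And>x y. cinner (A x) y = cinner (x::'a::chilbert) (B (y::'b::chilbert))"
    and "bounded_linear A"
  shows "bounded_linear B"
proof -
  obtain K where K: "K \<ge> 0" "\<And>x. norm (A x) \<le> norm x * K"
    using bounded_linear.nonneg_bounded[OF assms(2)] by blast
  show ?thesis
    by (rule bounded_linear_cscaleI[where K = K])
       (use K in \<open>auto simp: mult.commute adjoint_add[OF assms(1)] adjoint_cscale[OF assms(1)]
          intro: adjoint_norm_le[OF assms(1), of K]\<close>)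
qed

lemma summable_on_product_nonneg:
  fixes f :: "'a \<Rightarrow> real" and g :: "'b \<Rightarrow> real"
  assumes f: "f summable_on A" and g: "g summable_on B"
    and nn: "\<And>x. x \<in> A \<Longrightarrow> 0 \<le> f x" "\<And>y. y \<in> B \<Longrightarrow> 0 \<le> g y"
  shows "(\<lambda>(x, y). f x * g y) summable_on A \<times> B"
proof (rule nonneg_bdd_above_summable_on)
  show "bdd_above (sum (\<lambda>(x, y). f x * g y) ` {F. F \<subseteq> A \<times> B \<and> finite F})"
  proof (rule bdd_aboveI2)
    fix F assume F: "F \<in> {F. F \<subseteq> A \<times> B \<and> finite F}"
    have "(\<Sum>(x, y)\<in>F. f x * g y) \<le> (\<Sum>(x, y)\<in>fst ` F \<times> snd ` F. f x * g y)"
      by (rule sum_mono2) (use F nn in \<open>force intro!: mult_nonneg_nonneg\<close>)+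
    also have "\<dots> = sum f (fst ` F) * sum g (snd ` F)"
      by (simp add: sum_product sum.cartesian_product)
    also have "\<dots> \<le> infsum f A * infsum g B"
      using F nn by (intro mult_mono finite_sum_le_infsum f g sum_nonneg infsum_nonneg) auto
    finally show "(\<Sum>(x, y)\<in>F. f x * g y) \<le> infsum f A * infsum g B" .
  qed
qed (use nn in auto)

section \<open>Square roots of positive operators\<close>

text \<open>The power series coefficients of \<open>1 - sqrt (1 - x)\<close>, i.e. of the solution of
  \<open>2 y = x + y\<^sup>2\<close> with \<open>y 0 = 0\<close>; their nonnegativity makes their sum at most 1.\<close>

fun sqrt_coef :: "nat \<Rightarrow> real" where
  "sqrt_coef n = (if n = 0 then 0 else if n = 1 then 1 / 2
     else (\<Sum>i\<in>{1..<n}. sqrt_coef i * sqrt_coef (n - i)) / 2)"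

declare sqrt_coef.simps [simp del]

lemma sqrt_coef_0 [simp]: "sqrt_coef 0 = 0"
  by (simp add: sqrt_coef.simps)

lemma sqrt_coef_nonneg: "0 \<le> sqrt_coef n"
proof (induction n rule: less_induct)
  case (less n)
  then show ?case by (subst sqrt_coef.simps) (auto intro!: sum_nonneg)
qed

text \<open>The equation \<open>y^2 = 2 y - x\<close> written for the coefficients of the
  series.\<close>

lemma sqrt_coef_conv: "(\<Sum>i\<le>n. sqrt_coef i * sqrt_coef (n - i)) = 2 * sqrt_coef n - (if n = 1 then 1 else 0)"
proof -
  consider "n = 0" | "n = 1" | "n > 1" by linarith
  then show ?thesis
  proof cases
    case 3
    have "(\<Sum>i\<le>n. sqrt_coef i * sqrt_coef (n - i)) = (\<Sum>i\<in>{1..<n}. sqrt_coef i * sqrt_coef (n - i))"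
      by (rule sum.mono_neutral_right) (auto simp: not_less Suc_le_eq)
    also have "\<dots> = 2 * sqrt_coef n" using 3 by (subst (3) sqrt_coef.simps) simp
    finally show ?thesis using 3 by simp
  qed (simp_all add: sqrt_coef.simps[of "Suc 0"])
qed

text \<open>The bound 1 reproduces itself: if \<open>P\<close> denotes the partial sum up to
  \<open>N\<close> and \<open>P'\<close> the next one, the quadratic equation gives
  \<open>2 P' - 1 \<le> P^2 \<le> 1\<close>.\<close>

lemma sqrt_coef_partial_le: "(\<Sum>n\<le>N. sqrt_coef n) \<le> 1"
proof (induction N)
  case (Suc N)
  have "2 * (\<Sum>n\<le>Suc N. sqrt_coef n) - 1 = (\<Sum>n\<le>Suc N. 2 * sqrt_coef n - (if n = 1 then 1 else 0))"
    by (simp add: sum_subtractf sum_distrib_left)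
  also have "\<dots> = (\<Sum>n\<le>Suc N. \<Sum>i\<le>n. sqrt_coef i * sqrt_coef (n - i))"
    by (simp add: sqrt_coef_conv)
  also have "\<dots> = (\<Sum>(n, i)\<in>(SIGMA n:{..Suc N}. {..n}). sqrt_coef i * sqrt_coef (n - i))"
    by (subst sum.Sigma) auto
  also have "\<dots> = (\<Sum>(i, k)\<in>{(i, k). i + k \<le> Suc N}. sqrt_coef i * sqrt_coef k)"
    by (rule sum.reindex_bij_witness[where i = "\<lambda>(i, k). (i + k, i)" and j = "\<lambda>(n, i). (i, n - i)"]) auto
  \<comment> \<open>The vanishing coefficient at 0 is essential: once both indices are positive with
    sum at most \<open>N + 1\<close>, each is at most \<open>N\<close>, and the induction
    closes.\<close>
  also have "\<dots> = (\<Sum>(i, k)\<in>{(i, k). i + k \<le> Suc N \<and> i \<noteq> 0 \<and> k \<noteq> 0}. sqrt_coef i * sqrt_coef k)"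
    by (rule sum.mono_neutral_right)
       (auto intro!: gr0I intro: finite_subset[of _ "{..Suc N} \<times> {..Suc N}"])
  also have "\<dots> \<le> (\<Sum>(i, k)\<in>{..N} \<times> {..N}. sqrt_coef i * sqrt_coef k)"
    by (rule sum_mono2) (auto simp: sqrt_coef_nonneg)
  also have "\<dots> = (\<Sum>n\<le>N. sqrt_coef n) * (\<Sum>n\<le>N. sqrt_coef n)"
    by (simp add: sum_product sum.cartesian_product)
  also have "\<dots> \<le> 1 * 1"
    using Suc by (intro mult_mono) (auto intro: sum_nonneg sqrt_coef_nonneg)
  finally show ?case by simp
qed simp

lemma sqrt_coef_sum_le: "finite F \<Longrightarrow> (\<Sum>n\<in>F. sqrt_coef n) \<le> 1"
proof -
  assume F: "finite F"
  then obtain N where "F \<subseteq> {..N}" using finite_nat_set_iff_bounded_le by auto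
  then have "(\<Sum>n\<in>F. sqrt_coef n) \<le> (\<Sum>n\<le>N. sqrt_coef n)"
    by (intro sum_mono2) (auto simp: sqrt_coef_nonneg)
  then show ?thesis using sqrt_coef_partial_le order_trans by blast
qed

lemma sqrt_coef_summable: "sqrt_coef summable_on UNIV"
  by (rule nonneg_bdd_above_summable_on)
     (auto intro!: bdd_aboveI2[of _ _ 1] sqrt_coef_nonneg sqrt_coef_sum_le)

lemma sqrt_coef_infsum_le: "infsum sqrt_coef UNIV \<le> 1"
  by (rule infsum_le_finite_sums[OF sqrt_coef_summable]) (rule sqrt_coef_sum_le)

text \<open>This is \<open>1 - (1 - B)^(1/2)\<close>, so the positive root of \<open>1 - B\<close>
  is the identity minus this series.\<close>

definition sqrt_series :: "('h::chilbert \<Rightarrow> 'h) \<Rightarrow> 'h \<Rightarrow> 'h" where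
  "sqrt_series B x = infsum (\<lambda>n. sqrt_coef n *\<^sub>R (B ^^ n) x) UNIV"

lemma posop_selfadjoint:
  fixes A :: "'h::chilbert \<Rightarrow> 'h"
  assumes add: "\<And>x y. A (x + y) = A x + A y" and sc: "\<And>c x. A (cscale c x) = cscale c (A x)"
    and pos: "posop cinner UNIV A"
  shows "cinner (A x) y = cinner x (A y)"
proof -
  have im: "Im (cinner (A z) z) = 0" for z using pos by (simp add: posop_def)
  have 1: "Im (cinner (A x) y) + Im (cinner (A y) x) = 0"
    using im[of "x + y"] im[of x] im[of y] by (simp add: add cinner_simps)
  have 2: "Re (cinner (A y) x) - Re (cinner (A x) y) = 0"
    using im[of "x + cscale \<i> y"] im[of x] im[of y] by (simp add: add sc cinner_simps)
  have "cinner (A x) y = cnj (cinner (A y) x)" using 1 2 by (simp add: complex_eq_iff)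
  then show ?thesis using cinner_commute[of "A y" x] by simp
qed

text \<open>Positivity is tested at \<open>x - A x / K\<close>. A consequence is that a vanishing
  form \<open>(A x, x)\<close> forces \<open>A x = 0\<close>, which drives the uniqueness of
  positive roots.\<close>

lemma posop_norm_sq_le:
  fixes A :: "'h::chilbert \<Rightarrow> 'h"
  assumes add: "\<And>x y. A (x + y) = A x + A y" and sc: "\<And>c x. A (cscale c x) = cscale c (A x)"
    and pos: "posop cinner UNIV A" and K: "K > 0" "\<And>x. norm (A x) \<le> K * norm x"
  shows "(norm (A x))\<^sup>2 \<le> K * Re (cinner (A x) x)"
proof -
  define t where "t = 1 / K"
  define u where "u = cscale (- of_real t) (A x)"
  have sa: "cinner (A x) y = cinner x (A y)" for x y by (rule posop_selfadjoint[OF add sc pos])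
  have "0 \<le> Re (cinner (A (x + u)) (x + u))" using pos by (simp add: posop_def)
  also have "\<dots> = Re (cinner (A x) x) - 2 * t * (norm (A x))\<^sup>2 + t\<^sup>2 * Re (cinner (A (A x)) (A x))"
    by (simp add: u_def add sc cinner_simps sa[of "A x" x] cinner_self power2_eq_square algebra_simps)
  also have "Re (cinner (A (A x)) (A x)) \<le> K * (norm (A x))\<^sup>2"
  proof -
    have "Re (cinner (A (A x)) (A x)) \<le> norm (A (A x)) * norm (A x)"
      by (rule order_trans[OF complex_Re_le_cmod cmod_cinner_le])
    also have "\<dots> \<le> K * norm (A x) * norm (A x)" using K(2) by (simp add: mult_right_mono)
    finally show ?thesis by (simp add: power2_eq_square)
  qed
  finally have "0 \<le> Re (cinner (A x) x) - 2 * t * (norm (A x))\<^sup>2 + t\<^sup>2 * (K * (norm (A x))\<^sup>2)"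
    by (simp add: mult_left_mono)
  then show ?thesis using K(1) by (simp add: t_def power2_eq_square field_simps)
qed

locale positive_contraction =
  fixes B :: "'h::chilbert \<Rightarrow> 'h"
  assumes add: "B (x + y) = B x + B y" and sc: "B (cscale c x) = cscale c (B x)"
    and pos: "posop cinner UNIV B" and contr: "norm (B x) \<le> norm x"
begin

lemma bl: "bounded_linear B"
  by (rule bounded_linear_cscaleI[where K = 1]) (simp_all add: add sc contr)

lemma pow_add: "(B ^^ n) (x + y) = (B ^^ n) x + (B ^^ n) y"
  by (induction n) (simp_all add: add)

lemma pow_sc: "(B ^^ n) (cscale c x) = cscale c ((B ^^ n) x)"
  by (induction n) (simp_all add: sc)

lemma pow_le: "norm ((B ^^ n) x) \<le> norm x"
  by (induction n) (auto intro: order_trans[OF contr])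

lemma bl_pow: "bounded_linear (B ^^ n)"
  by (rule bounded_linear_cscaleI[where K = 1]) (simp_all add: pow_add pow_sc pow_le)

lemma selfadj: "cinner (B x) y = cinner x (B y)"
  by (rule posop_selfadjoint[OF add sc pos])

lemma pow_selfadj: "cinner ((B ^^ n) x) y = cinner x ((B ^^ n) y)"
  by (induction n arbitrary: x y) (simp_all add: selfadj funpow_swap1)

lemma abs_summable: "(\<lambda>n. norm (sqrt_coef n *\<^sub>R (B ^^ n) x)) summable_on UNIV"
proof (rule Infinite_Sum.abs_summable_on_comparison_test')
  show "(\<lambda>n. sqrt_coef n * norm x) summable_on UNIV"
    by (intro summable_on_cmult_left sqrt_coef_summable)
qed (simp add: sqrt_coef_nonneg pow_le mult_left_mono)

lemma series: "((\<lambda>n. sqrt_coef n *\<^sub>R (B ^^ n) x) has_sum sqrt_series B x) UNIV"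
  unfolding sqrt_series_def using abs_summable_summable[OF abs_summable] by simp

lemma series_norm: "norm (sqrt_series B x) \<le> norm x"
proof -
  have "norm (sqrt_series B x) \<le> (\<Sum>\<^sub>\<infinity>n. norm (sqrt_coef n *\<^sub>R (B ^^ n) x))"
    unfolding sqrt_series_def by (rule norm_infsum_bound[OF abs_summable])
  also have "\<dots> \<le> (\<Sum>\<^sub>\<infinity>n. sqrt_coef n * norm x)"
    by (intro infsum_mono abs_summable summable_on_cmult_left sqrt_coef_summable)
       (simp add: sqrt_coef_nonneg pow_le mult_left_mono)
  also have "\<dots> = infsum sqrt_coef UNIV * norm x" by (rule infsum_cmult_left')
  also have "\<dots> \<le> 1 * norm x" by (intro mult_right_mono sqrt_coef_infsum_le) auto
  finally show ?thesis by simp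
qed

lemma series_add: "sqrt_series B (x + y) = sqrt_series B x + sqrt_series B y"
  using has_sum_add[OF series[of x] series[of y]] series[of "x + y"]
  by (simp add: pow_add scaleR_add_right has_sum_unique)

lemma series_scale: "sqrt_series B (cscale c x) = cscale c (sqrt_series B x)"
  using has_sum_bounded_linear[OF bounded_linear_cscale_right[of c] series[of x]] series[of "cscale c x"]
  by (simp add: pow_sc scaleR_cscale_commute has_sum_unique)

lemma series_intertwine:
  assumes L: "bounded_linear L" and A: "positive_contraction A" and c: "\<And>x. L (B x) = A (L x)"
  shows "L (sqrt_series B x) = sqrt_series A (L x)"
proof -
  interpret A: positive_contraction A by (rule A)
  interpret L: bounded_linear L by (rule L)
  have "L ((B ^^ n) x) = (A ^^ n) (L x)" for n by (induction n) (simp_all add: c)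
  then show ?thesis
    using has_sum_bounded_linear[OF L series[of x]] A.series[of "L x"]
    by (simp add: L.scaleR has_sum_unique)
qed

lemma series_posop: "posop cinner UNIV (\<lambda>x. x - sqrt_series B x)"
  unfolding posop_def
proof (intro ballI conjI)
  fix x
  have r: "cinner ((B ^^ n) x) x = of_real (Re (cinner ((B ^^ n) x) x))" for n
    using pow_selfadj[of n x x] cinner_commute[of "(B ^^ n) x" x] by (simp add: complex_eq_iff)
  have "((\<lambda>n. cinner (sqrt_coef n *\<^sub>R (B ^^ n) x) x) has_sum cinner (sqrt_series B x) x) UNIV"
    by (rule has_sum_bounded_linear[OF bounded_linear_cinner_left series])
  then have "((\<lambda>n. Im (cinner (sqrt_coef n *\<^sub>R (B ^^ n) x) x)) has_sum Im (cinner (sqrt_series B x) x)) UNIV"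
    by (rule has_sum_Im)
  moreover have "Im (cinner (sqrt_coef n *\<^sub>R (B ^^ n) x) x) = 0" for n
    using r[of n] by (simp add: scaleR_cscale cinner_simps complex_eq_iff)
  ultimately have im: "Im (cinner (sqrt_series B x) x) = 0"
    using has_sum_unique[OF has_sum_0_simp] by fastforce
  then show "Im (cinner (x - sqrt_series B x) x) = 0"
    by (simp add: cinner_simps cinner_self)
  have "Re (cinner (sqrt_series B x) x) \<le> norm (sqrt_series B x) * norm x"
    by (rule order_trans[OF complex_Re_le_cmod cmod_cinner_le])
  also have "\<dots> \<le> norm x * norm x" by (intro mult_right_mono series_norm) auto
  finally show "0 \<le> Re (cinner (x - sqrt_series B x) x)"
    by (simp add: cinner_simps cinner_self power2_eq_square)
qed

text \<open>A double series that converges absolutely is summed in two ways: by rows it gives the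
  series applied twice, along antidiagonals the convolution identity gives
  \<open>2 S - B\<close>.\<close>

lemma series_twice: "sqrt_series B (sqrt_series B x) = 2 *\<^sub>R sqrt_series B x - B x"
proof -
  define f where "f = (\<lambda>(n, k). (sqrt_coef n * sqrt_coef k) *\<^sub>R (B ^^ (n + k)) x)"
  have "(\<lambda>(n, k). norm (sqrt_coef n) * norm (sqrt_coef k)) summable_on UNIV \<times> UNIV"
    using summable_on_product_nonneg[OF sqrt_coef_summable sqrt_coef_summable] by (simp add: sqrt_coef_nonneg)
  then have "(\<lambda>p. (case p of (n, k) \<Rightarrow> norm (sqrt_coef n) * norm (sqrt_coef k)) * norm x) summable_on UNIV \<times> UNIV"
    by (rule summable_on_cmult_left)
  then have "(\<lambda>p. norm (f p)) summable_on UNIV \<times> UNIV"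
    by (rule Infinite_Sum.abs_summable_on_comparison_test')
       (auto simp: f_def sqrt_coef_nonneg intro!: mult_left_mono pow_le mult_nonneg_nonneg)
  then have "f summable_on UNIV \<times> UNIV" by (rule abs_summable_summable)
  then obtain s where s: "(f has_sum s) (UNIV \<times> UNIV)" by (auto simp: summable_on_def)
  have "((\<lambda>n. sqrt_coef n *\<^sub>R (B ^^ n) (sqrt_series B x)) has_sum s) UNIV"
  proof (rule has_sum_SigmaD[OF s])
    fix n
    interpret L: bounded_linear "B ^^ n" by (rule bl_pow)
    have "((\<lambda>k. sqrt_coef n *\<^sub>R (B ^^ n) (sqrt_coef k *\<^sub>R (B ^^ k) x)) has_sum sqrt_coef n *\<^sub>R (B ^^ n) (sqrt_series B x)) UNIV"
      by (intro has_sum_scaleR has_sum_bounded_linear[OF bl_pow series])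
    then show "((\<lambda>k. f (n, k)) has_sum sqrt_coef n *\<^sub>R (B ^^ n) (sqrt_series B x)) UNIV"
      by (simp add: f_def L.scaleR funpow_add)
  qed
  then have s1: "s = sqrt_series B (sqrt_series B x)" using series has_sum_unique by blast
  have "((\<lambda>(n, i). f (i, n - i)) has_sum s) (SIGMA n:UNIV. {..n})"
    by (subst has_sum_reindex_bij_witness[where j = "\<lambda>(n, i). (i, n - i)" and i = "\<lambda>(i, k). (i + k, i)"
          and T = "UNIV \<times> UNIV" and h = f and s' = s]) (use s in auto)
  then have "((\<lambda>n. (2 * sqrt_coef n - (if n = 1 then 1 else 0)) *\<^sub>R (B ^^ n) x) has_sum s) UNIV"
  proof (rule has_sum_SigmaD)
    fix n
    have "(\<Sum>i\<le>n. f (i, n - i)) = (2 * sqrt_coef n - (if n = 1 then 1 else 0)) *\<^sub>R (B ^^ n) x"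
      unfolding sqrt_coef_conv[symmetric] scaleR_sum_left by (rule sum.cong) (auto simp: f_def)
    then show "((\<lambda>i. case (n, i) of (n, i) \<Rightarrow> f (i, n - i)) has_sum
        (2 * sqrt_coef n - (if n = 1 then 1 else 0)) *\<^sub>R (B ^^ n) x) {..n}"
      by (intro has_sum_finiteI) auto
  qed
  moreover have "((\<lambda>n. 2 *\<^sub>R (sqrt_coef n *\<^sub>R (B ^^ n) x) - (if n = 1 then B x else 0)) has_sum 2 *\<^sub>R sqrt_series B x - B x) UNIV"
  proof -
    have "((\<lambda>n::nat. if n = 1 then B x else 0) has_sum B x) UNIV"
      by (rule has_sum_finite_neutralI[where B = "{1}"]) auto
    then have "((\<lambda>n::nat. - (if n = 1 then B x else 0)) has_sum - B x) UNIV"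
      by (simp only: has_sum_uminus minus_minus)
    from has_sum_add[OF has_sum_scaleR[OF series[of x], of 2] this]
    show ?thesis by simp
  qed
  moreover have "(2 * sqrt_coef n - (if n = 1 then 1 else 0)) *\<^sub>R (B ^^ n) x
    = 2 *\<^sub>R (sqrt_coef n *\<^sub>R (B ^^ n) x) - (if n = 1 then B x else 0)" for n
    by (auto simp: algebra_simps)
  ultimately show ?thesis using s1 has_sum_unique by fastforce
qed

lemma sqrt_square:
  "(\<lambda>x. x - sqrt_series B x) ((\<lambda>x. x - sqrt_series B x) x) = x - B x"
proof -
  have "sqrt_series B (x - sqrt_series B x) = sqrt_series B x - sqrt_series B (sqrt_series B x)"
    using series_add[of "x - sqrt_series B x" "sqrt_series B x"] by (metis add_diff_cancel_right' diff_add_cancel)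
  then show ?thesis by (simp add: series_twice scaleR_2)
qed

text \<open>\<open>R\<close> commutes with \<open>B = 1 - R^2\<close>, hence with the root
  \<open>Q\<close> given by the series. For \<open>y = R x - Q x\<close> this yields
  \<open>(R + Q) y = R^2 x - Q^2 x = 0\<close>; both positive forms then vanish at \<open>y\<close>,
  so \<open>R y = Q y = 0\<close> and \<open>(y, y) = (x, (R - Q) y) = 0\<close>. Uniqueness allows
  the root chosen by \<open>psqrt\<close> to be replaced by the explicit series.\<close>

lemma sqrt_unique:
  assumes Radd: "\<And>x y. R (x + y) = R x + R y" and Rsc: "\<And>c x. R (cscale c x) = cscale c (R x)"
    and Rpos: "posop cinner UNIV R" and Rb: "\<And>x. norm (R x) \<le> K * norm x"
    and sq: "\<And>x. R (R x) = x - B x"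
  shows "R x = x - sqrt_series B x"
proof -
  define Q where "Q = (\<lambda>x. x - sqrt_series B x)"
  have Rbl: "bounded_linear R" by (rule bounded_linear_cscaleI[OF Radd Rsc Rb])
  have Rd: "R (x - y) = R x - R y" for x y using bounded_linear.linear[OF Rbl] by (rule linear_diff)
  have "R (B x) = B (R x)" for x
  proof -
    have "B x = x - R (R x)" for x by (simp add: sq)
    then show ?thesis by (metis Rd)
  qed
  then have RQ: "R (Q x) = Q (R x)" for x
    unfolding Q_def Rd using series_intertwine[OF Rbl positive_contraction_axioms] by simp
  have Qpos: "posop cinner UNIV Q" unfolding Q_def by (rule series_posop)
  have Qadd: "Q (x + y) = Q x + Q y" and Qsc: "Q (cscale c x) = cscale c (Q x)" for c x y
    by (simp_all add: Q_def series_add series_scale cscale_diff_right)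
  have Qb: "norm (Q x) \<le> 2 * norm x" for x
    using norm_triangle_ineq4[of x "sqrt_series B x"] series_norm[of x] by (simp add: Q_def)
  have Qd: "Q (x - y) = Q x - Q y" for x y using Qadd[of "x - y" y] by simp
  have QQ: "Q (Q x) = R (R x)" for x using sqrt_square by (simp add: Q_def sq)
  define y where "y = R x - Q x"
  have "R y + Q y = 0" by (simp add: y_def Rd Qd RQ QQ)
  then have "Re (cinner (R y) y) + Re (cinner (Q y) y) = 0"
    using cinner_add_left[of "R y" "Q y" y] H.ip_zero_left[of y] by (metis UNIV_I plus_complex.simps(1) zero_complex.simps(1))
  then have z: "Re (cinner (R y) y) = 0" "Re (cinner (Q y) y) = 0"
    using Rpos Qpos by (simp_all add: posop_def add_nonneg_eq_0_iff)
  define K' where "K' = max K 1"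
  have "norm (R x) \<le> K' * norm x" for x using Rb[of x] mult_right_mono[of K K' "norm x"] by (simp add: K'_def)
  then have "R y = 0"
    using posop_norm_sq_le[OF Radd Rsc Rpos, of K' y] z by (simp add: K'_def)
  moreover have "Q y = 0"
    using posop_norm_sq_le[OF Qadd Qsc Qpos _ Qb, of y] z by simp
  ultimately have "cinner x (R y - Q y) = 0" by (simp add: cinner_simps)
  moreover have "cinner x (R y - Q y) = cinner y y"
    using posop_selfadjoint[OF Radd Rsc Rpos, of x y] posop_selfadjoint[OF Qadd Qsc Qpos, of x y]
    by (metis H.ip_diff_left H.ip_diff_right UNIV_I y_def)
  ultimately show ?thesis using cinner_eq_zero[of y] by (simp add: y_def Q_def)
qed

end

text \<open>For a positive bound \<open>k\<close> of \<open>A\<close>, the operator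
  \<open>B = 1 - A / k\<close> is a positive contraction, because the norm of \<open>A x\<close>
  squared is at most \<open>k (A x, x)\<close>. The root of \<open>A\<close> is then
  \<open>sqrt k\<close> times the root of \<open>1 - B\<close>.\<close>

lemma psqrt_exists:
  fixes A :: "'h::chilbert \<Rightarrow> 'h"
  assumes add: "\<And>x y. A (x + y) = A x + A y" and sc: "\<And>c x. A (cscale c x) = cscale c (A x)"
    and pos: "posop cinner UNIV A" and K: "\<And>x. norm (A x) \<le> K * norm x"
  shows "\<exists>R. linear_on UNIV UNIV R \<and> bnd_on cinner UNIV cinner R \<and> posop cinner UNIV R \<and> (\<forall>x. R (R x) = A x)"
proof -
  define k where "k = max K 1"
  have k: "k > 0" by (simp add: k_def)
  have Ak: "norm (A x) \<le> k * norm x" for x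
    using K[of x] mult_right_mono[of K k "norm x"] by (simp add: k_def)
  have ub: "Re (cinner (A x) x) \<le> k * (norm x)\<^sup>2" for x
  proof -
    have "Re (cinner (A x) x) \<le> norm (A x) * norm x"
      by (rule order_trans[OF complex_Re_le_cmod cmod_cinner_le])
    also have "\<dots> \<le> k * norm x * norm x" using Ak by (simp add: mult_right_mono)
    finally show ?thesis by (simp add: power2_eq_square)
  qed
  define B where "B = (\<lambda>x. x - (1 / k) *\<^sub>R A x)"
  have re: "Re (cinner (B x) x) = (norm x)\<^sup>2 - Re (cinner (A x) x) / k" for x
    by (simp add: B_def cinner_simps cinner_self scaleR_cscale)
  have "positive_contraction B"
  proof
    fix x y c
    show "B (x + y) = B x + B y" by (simp add: B_def add algebra_simps)
    show "B (cscale c x) = cscale c (B x)"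
      by (simp add: B_def sc cscale_diff_right scaleR_cscale_commute)
    show "posop cinner UNIV B"
      using pos ub k unfolding posop_def re
      by (auto simp: field_simps) (simp add: B_def cinner_simps cinner_self scaleR_cscale)
    have "(norm (B x))\<^sup>2 = (norm x)\<^sup>2 + (norm (A x))\<^sup>2 / k\<^sup>2 - 2 * (Re (cinner (A x) x) / k)"
      using H.nm_diff_sq[of x "(1 / k) *\<^sub>R A x"] cinner_commute[of "A x" x]
      by (simp add: B_def power_divide cinner_simps scaleR_cscale norm_divide)
    also have "(norm (A x))\<^sup>2 / k\<^sup>2 \<le> Re (cinner (A x) x) / k"
      using posop_norm_sq_le[OF add sc pos k Ak, of x] k by (simp add: field_simps power2_eq_square)
    also have "(norm x)\<^sup>2 + Re (cinner (A x) x) / k - 2 * (Re (cinner (A x) x) / k) \<le> (norm x)\<^sup>2"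
      using pos k by (simp add: posop_def)
    finally show "norm (B x) \<le> norm x" by simp
  qed
  then interpret positive_contraction B .
  define R where "R = (\<lambda>x. sqrt k *\<^sub>R (x - sqrt_series B x))"
  have Radd: "R (x + y) = R x + R y" for x y by (simp add: R_def series_add algebra_simps)
  have Rsc: "R (cscale c x) = cscale c (R x)" for c x
    by (simp add: R_def series_scale cscale_diff_right scaleR_cscale_commute)
  have Rb: "norm (R x) \<le> 2 * sqrt k * norm x" for x
    using norm_triangle_ineq4[of x "sqrt_series B x"] series_norm[of x] k
    by (simp add: R_def mult.commute[of 2] mult.assoc)
  have "posop cinner UNIV R"
    using series_posop k by (simp add: posop_def R_def scaleR_cscale cinner_simps)
  moreover have "R (R x) = A x" for x
  proof -
    have "(\<lambda>x. x - sqrt_series B x) (sqrt k *\<^sub>R u) = sqrt k *\<^sub>R (u - sqrt_series B u)" for u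
      by (simp add: scaleR_cscale series_scale cscale_diff_right)
    then have "R (R x) = k *\<^sub>R (x - B x)"
      unfolding R_def using sqrt_square[of x] k by simp
    then show ?thesis using k by (simp add: B_def)
  qed
  ultimately show ?thesis
    using Radd Rsc Rb by (intro exI[of _ R]) (auto simp: linear_on_def bnd_on_def)
qed

lemma psqrt_props:
  fixes A :: "'h::chilbert \<Rightarrow> 'h"
  assumes "\<And>x y. A (x + y) = A x + A y" "\<And>c x. A (cscale c x) = cscale c (A x)"
    "posop cinner UNIV A" "\<And>x. norm (A x) \<le> K * norm x"
  defines "R \<equiv> psqrt cinner UNIV A"
  shows "\<And>x y. R (x + y) = R x + R y" "\<And>c x. R (cscale c x) = cscale c (R x)"
    "posop cinner UNIV R" "\<exists>k. \<forall>x. norm (R x) \<le> k * norm x" "\<And>x. R (R x) = A x"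
proof -
  have "linear_on UNIV UNIV R \<and> bnd_on cinner UNIV cinner R \<and> posop cinner UNIV R \<and> (\<forall>x\<in>UNIV. R (R x) = A x)"
    unfolding R_def psqrt_def
    by (rule someI_ex[where P = "\<lambda>R. linear_on UNIV UNIV R \<and> bnd_on cinner UNIV cinner R
          \<and> posop cinner UNIV R \<and> (\<forall>x\<in>UNIV. R (R x) = A x)"])
       (use psqrt_exists[OF assms(1-4)] in simp)
  then show "\<And>x y. R (x + y) = R x + R y" "\<And>c x. R (cscale c x) = cscale c (R x)"
    "posop cinner UNIV R" "\<exists>k. \<forall>x. norm (R x) \<le> k * norm x" "\<And>x. R (R x) = A x"
    by (auto simp: linear_on_def bnd_on_def)
qed

section \<open>Finite powers of a Hilbert space\<close>

instantiation vec :: (cvec, finite) cvec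
begin
definition cscale_vec :: "complex \<Rightarrow> 'a ^ 'b \<Rightarrow> 'a ^ 'b"
  where "cscale_vec c v = (\<chi> i. cscale c (v $ i))"
instance
  by standard (simp_all add: cscale_vec_def vec_eq_iff cscale_add_right cscale_add_left cscale_cscale cscale_one)
end

instantiation vec :: (chilbert, finite) chilbert
begin
definition cinner_vec :: "'a ^ 'b \<Rightarrow> 'a ^ 'b \<Rightarrow> complex"
  where "cinner_vec v w = (\<Sum>i\<in>UNIV. cinner (v $ i) (w $ i))"
instance
proof
  fix x y z :: "'a ^ 'b" and r :: real and c :: complex
  have nn: "0 \<le> Re (cinner (x $ i) (x $ i))" for i by (rule cinner_nonneg)
  show "r *\<^sub>R x = cscale (complex_of_real r) x"
    by (simp add: cscale_vec_def vec_eq_iff scaleR_cscale)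
  show "cinner (x + y) z = cinner x z + cinner y z"
    by (simp add: cinner_vec_def cinner_add_left sum.distrib)
  show "cinner (cscale c x) y = c * cinner x y"
    by (simp add: cinner_vec_def cscale_vec_def cinner_cscale_left sum_distrib_left)
  show "cinner y x = cnj (cinner x y)"
    by (simp add: cinner_vec_def cinner_commute[symmetric])
  show "0 \<le> Re (cinner x x)"
    by (simp add: cinner_vec_def sum_nonneg nn)
  show "norm x = sqrt (Re (cinner x x))"
    by (simp add: norm_vec_def L2_set_def cinner_vec_def cinner_self)
  show "cinner x x = 0 \<Longrightarrow> x = 0"
  proof -
    assume "cinner x x = 0"
    then have "(\<Sum>i\<in>UNIV. Re (cinner (x $ i) (x $ i))) = 0" by (simp add: cinner_vec_def complex_eq_iff)
    then have "\<forall>i. Re (cinner (x $ i) (x $ i)) = 0" by (simp add: sum_nonneg_eq_0_iff nn)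
    then show "x = 0" by (simp add: vec_eq_iff cinner_self)
  qed
qed
end

lemma norm_vec_sq: "(norm v)\<^sup>2 = (\<Sum>i\<in>UNIV. (norm (v $ i :: 'h::chilbert))\<^sup>2)"
  by (simp add: norm_vec_def L2_set_def sum_nonneg)

lemma ipn_vec: "ipn x y = cinner (vec_lambda x :: 'h::chilbert ^ 'n) (vec_lambda y)"
  by (simp add: ipn_def cinner_vec_def)

text \<open>\<open>psqrt ipn\<close> is a choice among operators on the function type. Conjugation
  with \<open>vec_lambda\<close> shows that a candidate exists, and then carries the properties of
  the chosen one back to the Hilbert space \<open>'h ^ 'n\<close>.\<close>

lemma psqrt_ipn_props:
  fixes A :: "'h::chilbert ^ 'n \<Rightarrow> 'h ^ 'n"
  assumes "\<And>x y. A (x + y) = A x + A y" "\<And>c x. A (cscale c x) = cscale c (A x)"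
    "posop cinner UNIV A" "\<And>x. norm (A x) \<le> K * norm x"
  defines "R \<equiv> (\<lambda>v. vec_lambda (psqrt ipn UNIV (\<lambda>x. vec_nth (A (vec_lambda x))) (vec_nth v)))"
  shows "\<And>x y. R (x + y) = R x + R y" "\<And>c x. R (cscale c x) = cscale c (R x)"
    "posop cinner UNIV R" "\<exists>k. \<forall>x. norm (R x) \<le> k * norm x" "\<And>x. R (R x) = A x"
proof -
  define A' where "A' = (\<lambda>x. vec_nth (A (vec_lambda x)))"
  define P where "P = psqrt ipn UNIV A'"
  have nrm: "nrm ipn x = norm (vec_lambda x :: 'h ^ 'n)" for x
    by (simp add: nrm_def ipn_vec norm_cinner)
  have lam: "vec_lambda (x + y) = vec_lambda x + (vec_lambda y :: 'h ^ 'n)"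
       "vec_lambda (cscale c x) = cscale c (vec_lambda x :: 'h ^ 'n)"
       "vec_nth (v + w) = vec_nth v + vec_nth w"
       "vec_nth (cscale c v) = cscale c (vec_nth v)" for x y c and v w :: "'h ^ 'n"
    by (auto simp: vec_eq_iff cscale_vec_def cscale_fun_def)
  obtain Q where Q: "linear_on UNIV UNIV Q" "bnd_on cinner UNIV cinner Q" "posop cinner UNIV Q" "\<And>x. Q (Q x) = A x"
    using psqrt_exists[OF assms(1-4)] by auto
  obtain k where k: "\<And>x. norm (Q x) \<le> k * norm x" using Q(2) by (auto simp: bnd_on_def)
  have "linear_on UNIV UNIV (\<lambda>x. vec_nth (Q (vec_lambda x))) \<and> bnd_on ipn UNIV ipn (\<lambda>x. vec_nth (Q (vec_lambda x)))
    \<and> posop ipn UNIV (\<lambda>x. vec_nth (Q (vec_lambda x))) \<and> (\<forall>x\<in>UNIV. vec_nth (Q (vec_lambda (vec_nth (Q (vec_lambda x))))) = A' x)"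
    using Q k by (auto simp: linear_on_def bnd_on_def posop_def nrm ipn_vec A'_def lam)
  then have "linear_on UNIV UNIV P \<and> bnd_on ipn UNIV ipn P \<and> posop ipn UNIV P \<and> (\<forall>x\<in>UNIV. P (P x) = A' x)"
    unfolding P_def psqrt_def by (intro someI_ex[where P = "\<lambda>R. linear_on UNIV UNIV R \<and> bnd_on ipn UNIV ipn R
      \<and> posop ipn UNIV R \<and> (\<forall>x\<in>UNIV. R (R x) = A' x)"] exI)
  then have P: "P (x + y) = P x + P y" "P (cscale c x) = cscale c (P x)" "P (P x) = A' x"
      "posop ipn UNIV P" "bnd_on ipn UNIV ipn P" for x y c
    by (auto simp: linear_on_def)
  have R: "R v = vec_lambda (P (vec_nth v))" for v by (simp add: R_def P_def A'_def)
  have nth: "vec_nth (R v) = P (vec_nth v)" for v by (simp add: R vec_lambda_inverse)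
  show "R (x + y) = R x + R y" for x y by (simp add: R P lam)
  show "R (cscale c x) = cscale c (R x)" for x c by (simp add: R P lam)
  show "R (R x) = A x" for x using R[of "R x"] by (simp add: nth P A'_def)
  show "posop cinner UNIV R" unfolding posop_def
  proof
    fix v
    show "Im (cinner (R v) v) = 0 \<and> 0 \<le> Re (cinner (R v) v)"
      using P(4)[unfolded posop_def, rule_format, of "vec_nth v"] by (simp add: ipn_vec R)
  qed
  obtain k where k: "\<And>x. nrm ipn (P x) \<le> k * nrm ipn x" using P(5) by (auto simp: bnd_on_def)
  show "\<exists>k. \<forall>x. norm (R x) \<le> k * norm x"
  proof (intro exI allI)
    fix v
    show "norm (R v) \<le> k * norm v" using k[of "vec_nth v"] by (simp add: nrm R)
  qed
qed

lemma has_sum_diff: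
  fixes f g :: "'a \<Rightarrow> 'b::topological_ab_group_add"
  assumes "(f has_sum a) A" "(g has_sum b) A"
  shows "((\<lambda>x. f x - g x) has_sum (a - b)) A"
proof -
  have "((\<lambda>x. - g x) has_sum - b) A" using assms(2) by (simp only: has_sum_uminus minus_minus)
  from has_sum_add[OF assms(1) this] show ?thesis by simp
qed

lemma has_sum_sum:
  fixes f :: "'i \<Rightarrow> 'a \<Rightarrow> 'b::topological_comm_monoid_add"
  assumes "\<And>i. i \<in> I \<Longrightarrow> (f i has_sum a i) A"
  shows "((\<lambda>x. \<Sum>i\<in>I. f i x) has_sum (\<Sum>i\<in>I. a i)) A"
  using assms by (induction I rule: infinite_finite_induct) (auto intro!: has_sum_add)

section \<open>Multi-indices and the weights rho\<close>

definition up :: "'n \<Rightarrow> ('n \<Rightarrow> nat) \<Rightarrow> 'n \<Rightarrow> nat" where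
  "up i \<alpha> = \<alpha>(i := Suc (\<alpha> i))"

text \<open>Truncated subtraction makes \<open>dn i\<close> inverse to \<open>up i\<close> only
  where the i-th entry is positive; this is the source of the guards \<open>0 < \<alpha> i\<close>
  in the sums below.\<close>

definition dn :: "'n \<Rightarrow> ('n \<Rightarrow> nat) \<Rightarrow> 'n \<Rightarrow> nat" where
  "dn i \<alpha> = \<alpha>(i := \<alpha> i - 1)"

text \<open>The weight of \<open>H\<^sub>l\<close> including \<open>l = 0\<close>, where truncated subtraction makes \<open>rho 0\<close> junk.\<close>

definition rr :: "nat \<Rightarrow> ('n::finite \<Rightarrow> nat) \<Rightarrow> real" where
  "rr l \<alpha> = (if l = 0 then (if \<alpha> = 0 then 1 else 0) else rho l \<alpha>)"

lemma dn_up [simp]: "dn i (up i \<alpha>) = \<alpha>"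
  by (simp add: up_def dn_def)

lemma up_dn: "0 < \<alpha> i \<Longrightarrow> up i (dn i \<alpha>) = \<alpha>"
  by (simp add: up_def dn_def)

lemma up_pos [simp]: "0 < up i \<alpha> i"
  by (simp add: up_def)

lemma bij_up: "bij_betw (up i) UNIV {\<alpha>. 0 < \<alpha> i}"
  by (rule bij_betw_byWitness[where f' = "dn i"]) (auto simp: up_dn)

lemma up_add: "up i \<alpha> + \<beta> = up i (\<alpha> + \<beta>)" "\<alpha> + up i \<beta> = up i (\<alpha> + \<beta>)"
  by (auto simp: up_def fun_eq_iff)

lemma sum_up [simp]: "sum (up i \<alpha>) UNIV = Suc (sum \<alpha> (UNIV::'n::finite set))"
  by (simp add: up_def sum.remove[of UNIV i])

lemma sum_dn: "0 < \<alpha> i \<Longrightarrow> sum \<alpha> UNIV = Suc (sum (dn i \<alpha>) (UNIV::'n::finite set))"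
  using sum_up[of i "dn i \<alpha>"] by (simp add: up_dn)

lemma prod_pow_up:
  "(\<Prod>k\<in>UNIV. x k ^ up i \<alpha> k) = x i * (\<Prod>k\<in>(UNIV::'n::finite set). x k ^ \<alpha> k :: 'a::comm_semiring_1)"
  by (simp add: up_def prod.remove[of UNIV i] mult.assoc)

lemma zpow_up: "zpow z (up i \<alpha>) = z i * zpow z \<alpha>"
  by (simp add: zpow_def prod_pow_up)

lemma zpow_add: "zpow z (\<alpha> + \<beta>) = zpow z \<alpha> * zpow z \<beta>"
  by (simp add: zpow_def power_add prod.distrib)

lemma zpow_0 [simp]: "zpow z 0 = 1"
  by (simp add: zpow_def)

lemma cmod_zpow: "cmod (zpow z \<alpha>) = (\<Prod>k\<in>UNIV. cmod (z k) ^ \<alpha> k)"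
  by (simp add: zpow_def prod_norm[symmetric] norm_power)

lemma rho_pos [simp]: "0 < rho l \<alpha>"
  by (simp add: rho_def prod_pos)

lemma rho_nonneg [simp]: "0 \<le> rho l \<alpha>"
  by (rule less_imp_le) simp

lemma rho_neq_0 [simp]: "rho l \<alpha> \<noteq> 0"
  using rho_pos[of l \<alpha>] by linarith

lemma rr_nonneg [simp]: "0 \<le> rr l \<alpha>"
  by (simp add: rr_def)

lemma rr_pos: "l \<ge> 1 \<Longrightarrow> rr l \<alpha> = rho l \<alpha>"
  by (simp add: rr_def)

lemma rr_0 [simp]: "rr l 0 = 1"
  by (simp add: rr_def rho_def)

lemma rho_0 [simp]: "rho (Suc l) 0 = 1"
  by (simp add: rho_def)

lemma prod_fact_dn:
  assumes "0 < \<alpha> i"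
  shows "(\<Prod>k\<in>(UNIV::'n::finite set). fact (\<alpha> k) :: real) = real (\<alpha> i) * (\<Prod>k\<in>UNIV. fact (dn i \<alpha> k))"
proof -
  have "fact (\<alpha> i) = (real (\<alpha> i) * fact (\<alpha> i - 1))" using assms by (simp add: fact_reduce)
  then show ?thesis by (simp add: dn_def prod.remove[of UNIV i] mult.assoc)
qed

text \<open>The weights are the coefficients of \<open>(1 - t_1 - ... - t_n)^(-m)\<close>.
  Multiplying this series by \<open>1 - t_1 - ... - t_n\<close> lowers the exponent by one, and
  comparison of coefficients gives the recursion.\<close>

lemma rho_rec:
  fixes \<alpha> :: "'n::finite \<Rightarrow> nat"
  assumes m: "m \<ge> 1"
  shows "rho m \<alpha> = rr (m - 1) \<alpha> + (\<Sum>i\<in>UNIV. if 0 < \<alpha> i then rho m (dn i \<alpha>) else 0)"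
proof (cases "\<alpha> = 0")
  case True
  then show ?thesis using m by (cases m) simp_all
next
  case False
  define s where "s = sum \<alpha> UNIV"
  define P where "P = (\<Prod>k\<in>UNIV. fact (\<alpha> k) :: real)"
  have P: "P > 0" by (simp add: P_def prod_pos)
  obtain i0 where "\<alpha> i0 \<noteq> 0" using False by (auto simp: fun_eq_iff)
  then have s: "s \<ge> 1" by (simp add: s_def sum.remove[of UNIV i0])
  \<comment> \<open>The common factor of all three terms: they are \<open>m + s - 1\<close>,
    \<open>m - 1\<close> and \<open>s\<close> times \<open>q\<close>. For \<open>m = 1\<close> the
    factor \<open>m - 1 = 0\<close> agrees with the weight of H_0, which vanishes at \<alpha>
    \<noteq> 0.\<close>
  define q where "q = fact (m + s - 2) / (P * fact (m - 1))"
  have "(if 0 < \<alpha> i then rho m (dn i \<alpha>) else 0) = \<alpha> i * q" for i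
  proof (cases "0 < \<alpha> i")
    case True
    define R where "R = (\<Prod>k\<in>UNIV. fact (dn i \<alpha> k) :: real)"
    have "P = \<alpha> i * R" using prod_fact_dn[of \<alpha> i, OF True] by (simp add: P_def R_def)
    moreover have "R > 0" by (simp add: R_def prod_pos)
    moreover have "m + sum (dn i \<alpha>) UNIV - 1 = m + s - 2"
      using sum_dn[of \<alpha> i, OF True] by (simp add: s_def)
    ultimately show ?thesis using True by (simp add: rho_def q_def R_def[symmetric])
  qed simp
  then have "(\<Sum>i\<in>UNIV. if 0 < \<alpha> i then rho m (dn i \<alpha>) else 0) = s * q"
    by (simp add: s_def sum_distrib_right)
  moreover have "rr (m - 1) \<alpha> = (m - 1) * q"
  proof (cases "m = 1")
    case False
    then have m2: "m \<ge> 2" using m by simp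
    then have "fact (m - 1) = (real (m - 1) * fact (m - 2))"
      by (metis Suc_1 diff_Suc_eq_diff_pred fact_reduce le_eq_less_or_eq less_Suc_eq_le diff_Suc_1 zero_less_diff of_nat_id Suc_le_lessD)
    moreover have "m - 1 + s - 1 = m + s - 2" using m2 by simp
    ultimately show ?thesis using m2
      by (simp add: rr_def rho_def q_def s_def[symmetric] P_def[symmetric] numeral_2_eq_2)
  qed (use \<open>\<alpha> \<noteq> 0\<close> in \<open>simp add: rr_def\<close>)
  moreover have "rho m \<alpha> = (m + s - 1) * q"
  proof -
    have "fact (m + s - 1) = (real (m + s - 1) * fact (m + s - 2))"
      using m s by (subst fact_reduce) (auto simp: numeral_2_eq_2)
    then show ?thesis by (simp add: rho_def q_def s_def[symmetric] P_def[symmetric])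
  qed
  moreover have "real (m + s - 1) = real (m - 1) + real s" using m by simp
  ultimately show ?thesis by (simp add: distrib_right)
qed

lemma rr_le_rho: "m \<ge> 1 \<Longrightarrow> rr (m - 1) \<alpha> \<le> rho m \<alpha>"
  by (subst rho_rec[of m \<alpha>]) (auto intro!: sum_nonneg)

lemma rho_le_up:
  assumes "m \<ge> 1"
  shows "rho m \<alpha> \<le> rho m (up i \<alpha>)"
proof -
  have "rho m \<alpha> = (if 0 < up i \<alpha> i then rho m (dn i (up i \<alpha>)) else 0)" by simp
  also have "\<dots> \<le> (\<Sum>k\<in>UNIV. if 0 < up i \<alpha> k then rho m (dn k (up i \<alpha>)) else 0)"
    by (rule member_le_sum) auto
  also have "\<dots> \<le> rho m (up i \<alpha>)" using assms by (subst rho_rec[of m "up i \<alpha>"]) auto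
  finally show ?thesis .
qed

text \<open>This identity replaces all further manipulation of binomial coefficients.\<close>

lemma rho_split:
  fixes F :: "('n::finite \<Rightarrow> nat) \<Rightarrow> 'b::banach"
  assumes m: "m \<ge> 1" and F: "(\<lambda>\<alpha>. rho m \<alpha> * norm (F \<alpha>)) summable_on UNIV"
  shows "(\<lambda>\<alpha>. rr (m - 1) \<alpha> * norm (F \<alpha>)) summable_on UNIV"
    and "(\<lambda>\<alpha>. rho m \<alpha> * norm (F (up i \<alpha>))) summable_on UNIV"
    and "(\<Sum>\<^sub>\<infinity>\<alpha>. rho m \<alpha> *\<^sub>R F \<alpha>) = (\<Sum>\<^sub>\<infinity>\<alpha>. rr (m - 1) \<alpha> *\<^sub>R F \<alpha>)
           + (\<Sum>i\<in>UNIV. \<Sum>\<^sub>\<infinity>\<alpha>. rho m \<alpha> *\<^sub>R F (up i \<alpha>))"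
proof -
  have up_summable: "(\<lambda>\<alpha>. rho m \<alpha> * norm (F (up i \<alpha>))) summable_on UNIV" for i
  proof -
    have "(\<lambda>\<alpha>. rho m \<alpha> * norm (F \<alpha>)) summable_on {\<alpha>. 0 < \<alpha> i}"
      using F by (rule summable_on_subset_banach) auto
    then have "(\<lambda>\<alpha>. rho m (up i \<alpha>) * norm (F (up i \<alpha>))) summable_on UNIV"
      by (subst summable_on_reindex_bij_betw[OF bij_up])
    then show ?thesis
      by (rule summable_on_comparison_test) (auto intro!: mult_right_mono rho_le_up m)
  qed
  then show "(\<lambda>\<alpha>. rho m \<alpha> * norm (F (up i \<alpha>))) summable_on UNIV" .
  show rr_summable: "(\<lambda>\<alpha>. rr (m - 1) \<alpha> * norm (F \<alpha>)) summable_on UNIV"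
    using F by (rule summable_on_comparison_test) (intro mult_right_mono rr_le_rho m mult_nonneg_nonneg rr_nonneg norm_ge_zero)+
  have 1: "((\<lambda>\<alpha>. rr (m - 1) \<alpha> *\<^sub>R F \<alpha>) has_sum (\<Sum>\<^sub>\<infinity>\<alpha>. rr (m - 1) \<alpha> *\<^sub>R F \<alpha>)) UNIV"
    by (rule has_sum_infsum, rule abs_summable_summable) (use rr_summable in simp)
  have 2: "((\<lambda>\<alpha>. if 0 < \<alpha> i then rho m (dn i \<alpha>) *\<^sub>R F \<alpha> else 0) has_sum
      (\<Sum>\<^sub>\<infinity>\<alpha>. rho m \<alpha> *\<^sub>R F (up i \<alpha>))) UNIV" for i
  proof -
    have "((\<lambda>\<alpha>. rho m \<alpha> *\<^sub>R F (up i \<alpha>)) has_sum (\<Sum>\<^sub>\<infinity>\<alpha>. rho m \<alpha> *\<^sub>R F (up i \<alpha>))) UNIV"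
      by (rule has_sum_infsum, rule abs_summable_summable) (use up_summable in simp)
    then have "((\<lambda>\<alpha>. (\<lambda>\<beta>. rho m (dn i \<beta>) *\<^sub>R F \<beta>) (up i \<alpha>)) has_sum (\<Sum>\<^sub>\<infinity>\<alpha>. rho m \<alpha> *\<^sub>R F (up i \<alpha>))) UNIV"
      by simp
    then have "((\<lambda>\<alpha>. rho m (dn i \<alpha>) *\<^sub>R F \<alpha>) has_sum (\<Sum>\<^sub>\<infinity>\<alpha>. rho m \<alpha> *\<^sub>R F (up i \<alpha>))) {\<alpha>. 0 < \<alpha> i}"
      by (subst (asm) has_sum_reindex_bij_betw[OF bij_up])
    then show ?thesis by (subst has_sum_cong_neutral[where T = "{\<alpha>. 0 < \<alpha> i}"
          and g = "\<lambda>\<alpha>. rho m (dn i \<alpha>) *\<^sub>R F \<alpha>"]) auto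
  qed
  have "((\<lambda>\<alpha>. rr (m - 1) \<alpha> *\<^sub>R F \<alpha> + (\<Sum>i\<in>UNIV. if 0 < \<alpha> i then rho m (dn i \<alpha>) *\<^sub>R F \<alpha> else 0)) has_sum
     ((\<Sum>\<^sub>\<infinity>\<alpha>. rr (m - 1) \<alpha> *\<^sub>R F \<alpha>) + (\<Sum>i\<in>UNIV. \<Sum>\<^sub>\<infinity>\<alpha>. rho m \<alpha> *\<^sub>R F (up i \<alpha>)))) UNIV"
    by (intro has_sum_add 1 has_sum_sum 2)
  moreover have "rr (m - 1) \<alpha> *\<^sub>R F \<alpha> + (\<Sum>i\<in>UNIV. if 0 < \<alpha> i then rho m (dn i \<alpha>) *\<^sub>R F \<alpha> else 0) = rho m \<alpha> *\<^sub>R F \<alpha>" for \<alpha>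
    by (subst rho_rec[OF m, of \<alpha>]) (auto simp: scaleR_add_left scaleR_sum_left intro!: sum.cong)
  ultimately show "(\<Sum>\<^sub>\<infinity>\<alpha>. rho m \<alpha> *\<^sub>R F \<alpha>) = (\<Sum>\<^sub>\<infinity>\<alpha>. rr (m - 1) \<alpha> *\<^sub>R F \<alpha>)
           + (\<Sum>i\<in>UNIV. \<Sum>\<^sub>\<infinity>\<alpha>. rho m \<alpha> *\<^sub>R F (up i \<alpha>))"
    by (simp add: infsumI)
qed

section \<open>Sums taken by total degree\<close>

lemma finite_degree_le: "finite {\<alpha> :: 'n::finite \<Rightarrow> nat. sum \<alpha> UNIV \<le> N}"
proof (rule finite_subset)
  show "{\<alpha> :: 'n \<Rightarrow> nat. sum \<alpha> UNIV \<le> N} \<subseteq> {\<alpha>. \<forall>i. (i \<in> UNIV \<longrightarrow> \<alpha> i \<in> {..N}) \<and> (i \<notin> UNIV \<longrightarrow> \<alpha> i = 0)}"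
  proof clarsimp
    fix \<alpha> :: "'n \<Rightarrow> nat" and i assume "sum \<alpha> UNIV \<le> N"
    then show "\<alpha> i \<le> N" using member_le_sum[of i UNIV \<alpha>] by simp
  qed
qed (rule finite_set_of_finite_funs; simp)

lemma finite_subset_degree_le:
  assumes "finite F"
  obtains N where "F \<subseteq> {\<alpha> :: 'n::finite \<Rightarrow> nat. sum \<alpha> UNIV \<le> N}"
proof
  show "F \<subseteq> {\<alpha>. sum \<alpha> UNIV \<le> Max ((\<lambda>\<alpha>. sum \<alpha> UNIV) ` F)}" using assms by auto
qed

lemma has_sum_by_degree:
  fixes f :: "('n::finite \<Rightarrow> nat) \<Rightarrow> real"
  assumes nn: "\<And>\<alpha>. 0 \<le> f \<alpha>" and lim: "(\<lambda>N. \<Sum>\<alpha> | sum \<alpha> UNIV \<le> N. f \<alpha>) \<longlonglongrightarrow> L"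
  shows "(f has_sum L) UNIV"
proof -
  define p where "p N = (\<Sum>\<alpha> | sum \<alpha> UNIV \<le> N. f \<alpha>)" for N
  have "incseq p" unfolding p_def
    by (intro monoI sum_mono2 finite_degree_le) (auto intro: nn)
  then have pL: "p N \<le> L" for N using lim incseq_le unfolding p_def by blast
  have FL: "sum f F \<le> L" if F: "finite F" for F
  proof -
    obtain N where "F \<subseteq> {\<alpha>. sum \<alpha> UNIV \<le> N}" using finite_subset_degree_le[OF F] .
    then have "sum f F \<le> p N" unfolding p_def by (intro sum_mono2 finite_degree_le) (auto intro: nn)
    then show ?thesis using pL order_trans by blast
  qed
  have s: "f summable_on UNIV"
    by (rule nonneg_bdd_above_summable_on) (auto intro!: bdd_aboveI2[of _ _ L] nn FL)
  have "infsum f UNIV \<le> L" using s FL by (rule infsum_le_finite_sums)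
  moreover have "p N \<le> infsum f UNIV" for N
    unfolding p_def by (intro finite_sum_le_infsum s finite_degree_le) (auto intro: nn)
  then have "L \<le> infsum f UNIV" using lim[folded p_def] by (intro LIMSEQ_le_const2[of p]) auto
  ultimately show ?thesis using s by (simp add: has_sum_iff)
qed

lemma summable_by_degree:
  fixes f :: "('n::finite \<Rightarrow> nat) \<Rightarrow> real"
  assumes nn: "\<And>\<alpha>. 0 \<le> f \<alpha>" and bd: "\<And>N. (\<Sum>\<alpha> | sum \<alpha> UNIV \<le> N. f \<alpha>) \<le> L"
  shows "f summable_on UNIV"
proof (rule nonneg_bdd_above_summable_on)
  show "bdd_above (sum f ` {F. F \<subseteq> UNIV \<and> finite F})"
  proof (rule bdd_aboveI2)
    fix F assume "F \<in> {F :: ('n \<Rightarrow> nat) set. F \<subseteq> UNIV \<and> finite F}"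
    then obtain N where "F \<subseteq> {\<alpha>. sum \<alpha> UNIV \<le> N}" using finite_subset_degree_le by auto
    then have "sum f F \<le> (\<Sum>\<alpha> | sum \<alpha> UNIV \<le> N. f \<alpha>)"
      by (intro sum_mono2 finite_degree_le) (auto intro: nn)
    then show "sum f F \<le> L" using bd order_trans by blast
  qed
qed (rule nn)

text \<open>The splitting applied to \<open>F\<close> cut off above degree \<open>N\<close>. It
  serves where summability still has to be proved. The shifted sums stop at degree below
  \<open>N\<close> because \<open>up\<close> raises the degree by one.\<close>

lemma rho_split_truncated:
  fixes F :: "('n::finite \<Rightarrow> nat) \<Rightarrow> real"
  assumes m: "m \<ge> 1"
  shows "(\<Sum>\<alpha> | sum \<alpha> UNIV \<le> N. rho m \<alpha> * F \<alpha>) = (\<Sum>\<alpha> | sum \<alpha> UNIV \<le> N. rr (m - 1) \<alpha> * F \<alpha>)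
     + (\<Sum>i\<in>UNIV. \<Sum>\<alpha> | sum \<alpha> UNIV < N. rho m \<alpha> * F (up i \<alpha>))"
proof -
  define G where "G \<alpha> = (if sum \<alpha> UNIV \<le> N then F \<alpha> else 0)" for \<alpha> :: "'n \<Rightarrow> nat"
  have fin: "finite {\<alpha> :: 'n \<Rightarrow> nat. sum \<alpha> UNIV < N}"
    by (rule finite_subset[OF _ finite_degree_le[of N]]) auto
  have i: "(\<Sum>\<^sub>\<infinity>\<alpha>. w \<alpha> * G \<alpha>) = (\<Sum>\<alpha> | sum \<alpha> UNIV \<le> N. w \<alpha> * F \<alpha>)" for w
    by (rule infsumI, rule has_sum_finite_neutralI[OF finite_degree_le[of N]]) (auto simp: G_def intro!: sum.cong)
  have ii: "(\<Sum>\<^sub>\<infinity>\<alpha>. rho m \<alpha> * G (up i \<alpha>)) = (\<Sum>\<alpha> | sum \<alpha> UNIV < N. rho m \<alpha> * F (up i \<alpha>))" for i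
    by (rule infsumI, rule has_sum_finite_neutralI[OF fin]) (auto simp: G_def intro!: sum.cong)
  have "(\<lambda>\<alpha>. rho m \<alpha> * norm (G \<alpha>)) summable_on UNIV"
    by (rule finite_nonzero_values_imp_summable_on)
       (rule finite_subset[OF _ finite_degree_le[of N]], auto simp: G_def split: if_splits)
  from rho_split(3)[OF m this] show ?thesis by (simp add: i ii)
qed

text \<open>Induction on \<open>l\<close>: the splitting bounds a truncated sum \<open>a\<close> of
  weight \<open>l + 1\<close> by \<open>K + (t_1 + ... + t_n) a\<close>, where \<open>K\<close>
  bounds the sums of weight \<open>l\<close>. Solving for \<open>a\<close> gives a bound independent
  of the truncation.\<close>

lemma rho_power_summable:
  fixes t :: "'n::finite \<Rightarrow> real"
  assumes t: "\<And>i. 0 \<le> t i" and t1: "sum t UNIV < 1"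
  shows "(\<lambda>\<alpha>. rr l \<alpha> * (\<Prod>i\<in>UNIV. t i ^ \<alpha> i)) summable_on UNIV"
proof -
  define p where "p \<alpha> = (\<Prod>i\<in>UNIV. t i ^ \<alpha> i)" for \<alpha>
  have p: "0 \<le> p \<alpha>" for \<alpha> by (simp add: p_def t prod_nonneg)
  have "\<exists>K. \<forall>N. (\<Sum>\<alpha> | sum \<alpha> UNIV \<le> N. rr l \<alpha> * p \<alpha>) \<le> K"
  proof (induction l)
    case 0
    have "(\<Sum>\<alpha> | sum \<alpha> UNIV \<le> N. rr 0 \<alpha> * p \<alpha>) \<le> 1" for N
    proof -
      have "(\<Sum>\<alpha> | sum \<alpha> UNIV \<le> N. rr 0 \<alpha> * p \<alpha>) = (\<Sum>\<alpha>\<in>{0}. rr 0 \<alpha> * p \<alpha>)"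
        by (rule sum.mono_neutral_right[OF finite_degree_le]) (auto simp: rr_def)
      then show ?thesis by (simp add: p_def)
    qed
    then show ?case by blast
  next
    case (Suc l)
    then obtain K where K: "\<And>N. (\<Sum>\<alpha> | sum \<alpha> UNIV \<le> N. rr l \<alpha> * p \<alpha>) \<le> K" by blast
    have "(\<Sum>\<alpha> | sum \<alpha> UNIV \<le> N. rr (Suc l) \<alpha> * p \<alpha>) \<le> K / (1 - sum t UNIV)" for N
    proof -
      define a where "a = (\<Sum>\<alpha> | sum \<alpha> UNIV \<le> N. rho (Suc l) \<alpha> * p \<alpha>)"
      have "(\<Sum>\<alpha> | sum \<alpha> UNIV < N. rho (Suc l) \<alpha> * p (up i \<alpha>)) \<le> t i * a" for i
      proof -
        have "(\<Sum>\<alpha> | sum \<alpha> UNIV < N. rho (Suc l) \<alpha> * p (up i \<alpha>))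
            = t i * (\<Sum>\<alpha> | sum \<alpha> UNIV < N. rho (Suc l) \<alpha> * p \<alpha>)"
          by (simp add: p_def prod_pow_up sum_distrib_left algebra_simps)
        also have "\<dots> \<le> t i * a" unfolding a_def
          by (intro mult_left_mono t sum_mono2 finite_degree_le) (auto simp: p)
        finally show ?thesis .
      qed
      then have "a \<le> K + (\<Sum>i\<in>UNIV. t i * a)"
        using K[of N] by (subst a_def, subst rho_split_truncated) (auto intro!: add_mono sum_mono)
      then have "a * (1 - sum t UNIV) \<le> K" by (simp add: algebra_simps sum_distrib_left)
      then have "a \<le> K / (1 - sum t UNIV)" using t1 by (simp add: pos_le_divide_eq)
      then show ?thesis by (simp add: a_def rr_pos)
    qed
    then show ?case by blast
  qed
  then show ?thesis using summable_by_degree[of "\<lambda>\<alpha>. rr l \<alpha> * p \<alpha>"] p by (auto simp: p_def)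
qed

lemma rr_zpow_sq_summable:
  assumes "z \<in> Bn"
  shows "(\<lambda>\<alpha>. rr l \<alpha> * (cmod (zpow z \<alpha>))\<^sup>2) summable_on UNIV"
proof -
  have "(cmod (zpow z \<alpha>))\<^sup>2 = (\<Prod>i\<in>UNIV. ((cmod (z i))\<^sup>2) ^ \<alpha> i)" for \<alpha>
    by (simp add: cmod_zpow prod_power_distrib mult.commute flip: power_mult)
  then show ?thesis using rho_power_summable[of "\<lambda>i. (cmod (z i))\<^sup>2" l] assms by (simp add: Bn_def)
qed

text \<open>Against coefficients that are merely bounded, absolute convergence is obtained on the
  smaller ball where the moduli of the coordinates sum to less than 1. This ball still determines
  all coefficients.\<close>

lemma rr_zpow_summable:
  assumes "(\<Sum>i\<in>UNIV. cmod (z i)) < 1"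
  shows "(\<lambda>\<alpha>. rr l \<alpha> * cmod (zpow z \<alpha>)) summable_on UNIV"
  using rho_power_summable[of "\<lambda>i. cmod (z i)" l] assms by (simp add: cmod_zpow)

lemma l1_ball_Bn:
  assumes "(\<Sum>i\<in>UNIV. cmod (z i)) < 1"
  shows "z \<in> Bn"
proof -
  have "cmod (z i) \<le> 1" for i using member_le_sum[of i UNIV "\<lambda>i. cmod (z i)"] assms by simp
  then have "(cmod (z i))\<^sup>2 \<le> cmod (z i)" for i
    using mult_left_le[of "cmod (z i)" "cmod (z i)"] by (simp add: power2_eq_square)
  then have "(\<Sum>i\<in>UNIV. (cmod (z i))\<^sup>2) \<le> (\<Sum>i\<in>UNIV. cmod (z i))" by (rule sum_mono)
  then show ?thesis using assms by (simp add: Bn_def)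
qed

section \<open>Iterated shifts and telescoping\<close>

definition Eop :: "(('n::finite \<Rightarrow> nat) \<Rightarrow> real) \<Rightarrow> ('n \<Rightarrow> nat) \<Rightarrow> real" where
  "Eop F \<alpha> = (\<Sum>i\<in>UNIV. F (up i \<alpha>))"

lemma Eop_pow_mono: "(\<And>\<alpha>. F \<alpha> \<le> G \<alpha>) \<Longrightarrow> (Eop ^^ k) F \<alpha> \<le> (Eop ^^ k) G \<alpha>"
  by (induction k arbitrary: \<alpha>) (auto simp: Eop_def intro!: sum_mono)

lemma Eop_pow_0: "(Eop ^^ k) (\<lambda>_. 0) \<alpha> = 0"
  by (induction k arbitrary: \<alpha>) (auto simp: Eop_def)

lemma Eop_pow_linear: "(Eop ^^ k) (\<lambda>\<alpha>. a * F \<alpha> + b * G \<alpha>) \<alpha> = a * (Eop ^^ k) F \<alpha> + b * (Eop ^^ k) G \<alpha>"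
  by (induction k arbitrary: \<alpha>) (auto simp: Eop_def sum.distrib sum_distrib_left)

text \<open>The left side sums \<open>F\<close> over all words of length \<open>k\<close> in the n
  unit shifts. A multi-index \<alpha> of degree \<open>k\<close> is the content of
  \<open>k! / \<alpha>!\<close> words, and this number is \<open>rho 1 \<alpha>\<close>.\<close>

lemma Eop_pow_at_0: "(Eop ^^ k) F 0 = (\<Sum>\<alpha> | sum \<alpha> UNIV = k. rho 1 \<alpha> * F \<alpha>)"
proof (induction k arbitrary: F)
  case 0
  have "{\<alpha> :: 'a \<Rightarrow> nat. sum \<alpha> UNIV = 0} = {0}" by (auto simp: fun_eq_iff)
  then show ?case by (simp add: zero_fun_def rho_0[of 0, unfolded zero_fun_def])
next
  case (Suc k)
  have fin: "finite {\<alpha> :: 'a \<Rightarrow> nat. sum \<alpha> UNIV = k}" for k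
    by (rule finite_subset[OF _ finite_degree_le[of k]]) auto
  have "(Eop ^^ Suc k) F 0 = (\<Sum>\<alpha> | sum \<alpha> UNIV = k. rho 1 \<alpha> * Eop F \<alpha>)"
    unfolding funpow_Suc_right o_apply by (rule Suc.IH)
  also have "\<dots> = (\<Sum>i\<in>UNIV. \<Sum>\<alpha> | sum \<alpha> UNIV = k. rho 1 \<alpha> * F (up i \<alpha>))"
    by (simp add: Eop_def sum_distrib_left sum.swap[of _ UNIV])
  also have "\<dots> = (\<Sum>i\<in>UNIV. \<Sum>\<alpha> | sum \<alpha> UNIV = Suc k. if 0 < \<alpha> i then rho 1 (dn i \<alpha>) * F \<alpha> else 0)"
  proof (rule sum.cong[OF refl])
    fix i
    have "(\<Sum>\<alpha> | sum \<alpha> UNIV = k. rho 1 \<alpha> * F (up i \<alpha>))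
        = (\<Sum>\<alpha> | sum \<alpha> UNIV = Suc k \<and> 0 < \<alpha> i. rho 1 (dn i \<alpha>) * F \<alpha>)"
      by (rule sum.reindex_bij_witness[where i = "dn i" and j = "up i"]) (auto simp: up_dn dest: sum_dn)
    also have "\<dots> = (\<Sum>\<alpha> | sum \<alpha> UNIV = Suc k. if 0 < \<alpha> i then rho 1 (dn i \<alpha>) * F \<alpha> else 0)"
      using sum.inter_filter[OF fin[of "Suc k"], of "\<lambda>\<alpha>. rho 1 (dn i \<alpha>) * F \<alpha>" "\<lambda>\<alpha>. 0 < \<alpha> i"]
      by (simp add: conj_commute)
    finally show "(\<Sum>\<alpha> | sum \<alpha> UNIV = k. rho 1 \<alpha> * F (up i \<alpha>)) = \<dots>" .
  qed
  also have "\<dots> = (\<Sum>\<alpha> | sum \<alpha> UNIV = Suc k. rho 1 \<alpha> * F \<alpha>)"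
  proof (subst sum.swap, rule sum.cong[OF refl])
    fix \<alpha> :: "'a \<Rightarrow> nat" assume "\<alpha> \<in> {\<alpha>. sum \<alpha> UNIV = Suc k}"
    then have "rr 0 \<alpha> = 0" by (auto simp: rr_def)
    then have "rho 1 \<alpha> = (\<Sum>i\<in>UNIV. if 0 < \<alpha> i then rho 1 (dn i \<alpha>) else 0)"
      by (subst rho_rec) simp_all
    then show "(\<Sum>i\<in>UNIV. if 0 < \<alpha> i then rho 1 (dn i \<alpha>) * F \<alpha> else 0) = rho 1 \<alpha> * F \<alpha>"
      by (auto simp: sum_distrib_right intro!: sum.cong)
  qed
  finally show ?case .
qed

text \<open>The terms of degree \<open>k\<close> add up to the difference of \<open>Eop^k G\<close>
  and \<open>Eop^(k+1) G\<close> at 0. Nonnegativity of \<open>F\<close> turns the limit over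
  degrees into an unconditional sum.\<close>

lemma telescope_has_sum:
  fixes G :: "('n::finite \<Rightarrow> nat) \<Rightarrow> real"
  assumes F: "\<And>\<alpha>. F \<alpha> = G \<alpha> - Eop G \<alpha>" "\<And>\<alpha>. 0 \<le> F \<alpha>" and lim: "(\<lambda>k. (Eop ^^ k) G 0) \<longlonglongrightarrow> 0"
  shows "((\<lambda>\<alpha>. rho 1 \<alpha> * F \<alpha>) has_sum G 0) UNIV"
proof (rule has_sum_by_degree)
  have eq: "(\<Sum>\<alpha> | sum \<alpha> UNIV \<le> N. rho 1 \<alpha> * F \<alpha>) = G 0 - (Eop ^^ Suc N) G 0" for N
  proof -
    have "(\<Sum>\<alpha> | sum \<alpha> UNIV \<le> N. rho 1 \<alpha> * F \<alpha>)
        = (\<Sum>k\<le>N. \<Sum>\<alpha> | \<alpha> \<in> {\<alpha>. sum \<alpha> UNIV \<le> N} \<and> sum \<alpha> UNIV = k. rho 1 \<alpha> * F \<alpha>)"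
      by (rule sum.group[symmetric, OF finite_degree_le]) auto
    also have "\<dots> = (\<Sum>k\<le>N. \<Sum>\<alpha> | sum \<alpha> UNIV = k. rho 1 \<alpha> * F \<alpha>)"
      by (intro sum.cong refl) auto
    also have "\<dots> = (\<Sum>k\<le>N. (Eop ^^ k) F 0)" by (simp add: Eop_pow_at_0)
    also have "\<dots> = (\<Sum>k\<le>N. (Eop ^^ k) G 0 - (Eop ^^ Suc k) G 0)"
    proof (rule sum.cong[OF refl])
      fix k
      have "F = (\<lambda>\<alpha>. 1 * G \<alpha> + (- 1) * Eop G \<alpha>)" by (simp add: F(1) fun_eq_iff)
      then show "(Eop ^^ k) F 0 = (Eop ^^ k) G 0 - (Eop ^^ Suc k) G 0"
        by (simp only: Eop_pow_linear) (simp add: funpow_swap1)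
    qed
    also have "\<dots> = G 0 - (Eop ^^ Suc N) G 0" by (subst sum_telescope) simp
    finally show ?thesis .
  qed
  have "(\<lambda>N. G 0 - (Eop ^^ Suc N) G 0) \<longlonglongrightarrow> G 0 - 0"
    by (intro tendsto_diff tendsto_const LIMSEQ_Suc lim)
  then show "(\<lambda>N. \<Sum>\<alpha> | sum \<alpha> UNIV \<le> N. rho 1 \<alpha> * F \<alpha>) \<longlonglongrightarrow> G 0" unfolding eq by simp
qed (simp add: F(2))

section \<open>Uniqueness of power series coefficients\<close>

lemma powser_unique:
  fixes p :: "nat \<Rightarrow> complex"
  assumes "\<And>t. cmod t \<le> 1 \<Longrightarrow> (\<lambda>k. t ^ k * p k) sums 0"
  shows "p k = 0"
proof -
  have "summable (\<lambda>k. p k * 1 ^ k)" using assms[of 1] by (simp add: sums_iff)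
  then have "conv_radius p \<ge> norm (1::complex)" by (rule conv_radius_geI)
  then have r: "fps_conv_radius (Abs_fps p) > 0"
    by (simp add: fps_conv_radius_def) (metis ereal_less(2) less_le_trans one_ereal_def zero_less_one)
  have "Abs_fps p = 0"
  proof (rule eval_fps_eqD[OF r])
    have "eval_fps (Abs_fps p) t = eval_fps 0 t" if "t \<in> ball 0 1" for t
      using assms[of t] that by (simp add: eval_fps_def sums_iff mult.commute)
    then show "\<forall>\<^sub>F z in nhds 0. eval_fps (Abs_fps p) z = eval_fps 0 z"
      by (intro eventually_nhds_in_open[of "ball 0 1", THEN eventually_mono]) auto
  qed simp
  then show ?thesis by (metis fps_nth_Abs_fps fps_zero_nth)
qed

text \<open>The coordinates in \<open>A\<close> are split off one at a time by rescaling a single variable.\<close>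

lemma multi_powser_unique_aux:
  fixes c :: "('n::finite \<Rightarrow> nat) \<Rightarrow> complex"
  assumes 0: "\<And>z. (\<Sum>i\<in>UNIV. cmod (z i)) < 1 \<Longrightarrow> ((\<lambda>\<alpha>. zpow z \<alpha> * c \<alpha>) has_sum 0) UNIV"
    and z: "(\<Sum>i\<in>UNIV. cmod (z i)) < 1" and A: "finite A"
  shows "((\<lambda>\<alpha>. zpow z \<alpha> * c \<alpha>) has_sum 0) {\<alpha>. \<forall>i\<in>A. \<alpha> i = \<kappa> i}"
  using A z
proof (induction A arbitrary: z)
  case empty
  then show ?case using 0 by simp
next
  case (insert i A z)
  define X where "X = {\<alpha>. \<forall>i\<in>A. \<alpha> i = \<kappa> i}"
  define f where "f \<alpha> = zpow z \<alpha> * c \<alpha>" for \<alpha>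
  have sf: "f summable_on Y" if "Y \<subseteq> X" for Y
  proof (rule summable_on_subset_banach[OF _ that])
    show "f summable_on X"
      unfolding f_def X_def by (rule has_sum_imp_summable[OF insert.IH[OF insert.prems]])
  qed
  define p where "p k = infsum f {\<alpha>\<in>X. \<alpha> i = k}" for k
  have "(\<lambda>k. t ^ k * p k) sums 0" if t: "cmod t \<le> 1" for t
  proof -
    define w where "w = z(i := t * z i)"
    have zw: "zpow w \<alpha> = t ^ \<alpha> i * zpow z \<alpha>" for \<alpha>
      by (simp add: zpow_def w_def prod.remove[of UNIV i] power_mult_distrib mult.assoc)
    have "(\<Sum>i\<in>UNIV. cmod (w i)) \<le> (\<Sum>i\<in>UNIV. cmod (z i))"
      by (rule sum_mono) (use t in \<open>auto simp: w_def norm_mult mult_left_le_one_le\<close>)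
    then have "((\<lambda>\<alpha>. zpow w \<alpha> * c \<alpha>) has_sum 0) X"
      unfolding X_def using insert.prems by (intro insert.IH) simp
    then have "((\<lambda>\<alpha>. t ^ \<alpha> i * f \<alpha>) has_sum 0) X" by (simp add: zw f_def mult.assoc)
    then have "((\<lambda>(k, \<alpha>). t ^ k * f \<alpha>) has_sum 0) (SIGMA k:UNIV. {\<alpha>\<in>X. \<alpha> i = k})"
      by (subst has_sum_reindex_bij_witness[where j = snd and i = "\<lambda>\<alpha>. (\<alpha> i, \<alpha>)" and T = X
            and h = "\<lambda>\<alpha>. t ^ \<alpha> i * f \<alpha>" and s' = 0]) auto
    then have "((\<lambda>k. t ^ k * p k) has_sum 0) UNIV"
      by (rule has_sum_SigmaD) (auto simp: p_def intro!: has_sum_cmult_right has_sum_infsum sf)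
    then show ?thesis by (rule has_sum_imp_sums)
  qed
  then have "p (\<kappa> i) = 0" by (rule powser_unique)
  moreover have "(f has_sum p (\<kappa> i)) {\<alpha>\<in>X. \<alpha> i = \<kappa> i}"
    unfolding p_def by (intro has_sum_infsum sf) auto
  moreover have "{\<alpha>\<in>X. \<alpha> i = \<kappa> i} = {\<alpha>. \<forall>j\<in>insert i A. \<alpha> j = \<kappa> j}" by (auto simp: X_def)
  ultimately have "(f has_sum 0) {\<alpha>. \<forall>j\<in>insert i A. \<alpha> j = \<kappa> j}" by (simp only:)
  then show ?case unfolding f_def .
qed

lemma multi_powser_unique_complex:
  fixes c :: "('n::finite \<Rightarrow> nat) \<Rightarrow> complex"
  assumes "\<And>z. (\<Sum>i\<in>UNIV. cmod (z i)) < 1 \<Longrightarrow> ((\<lambda>\<alpha>. zpow z \<alpha> * c \<alpha>) has_sum 0) UNIV"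
  shows "c \<kappa> = 0"
proof -
  \<comment> \<open>The constant point with coordinates \<open>r\<close> lies in the ball of
    convergence and has no vanishing coordinate, so its monomials can be cancelled.\<close>
  define r where "r = 1 / (real CARD('n) + 1)"
  have r: "r > 0" "CARD('n) * r < 1" by (simp_all add: r_def add_pos_nonneg field_simps)
  define z where "z = (\<lambda>_::'n. complex_of_real r)"
  have "(\<Sum>i\<in>UNIV. cmod (z i)) < 1" using r by (simp add: z_def)
  then have "((\<lambda>\<alpha>. zpow z \<alpha> * c \<alpha>) has_sum 0) {\<alpha>. \<forall>i\<in>UNIV. \<alpha> i = \<kappa> i}"
    by (intro multi_powser_unique_aux assms) auto
  moreover have "{\<alpha>. \<forall>i\<in>UNIV. \<alpha> i = \<kappa> i} = {\<kappa>}" by auto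
  ultimately have "zpow z \<kappa> * c \<kappa> = 0" by (simp add: has_sum_finite_iff)
  moreover have "z i \<noteq> 0" for i using r by (simp add: z_def)
  then have "zpow z \<kappa> \<noteq> 0" by (simp add: zpow_def)
  ultimately show ?thesis by simp
qed

lemma multi_powser_unique:
  fixes c d :: "('n::finite \<Rightarrow> nat) \<Rightarrow> 'h::chilbert"
  assumes "\<And>z. (\<Sum>i\<in>UNIV. cmod (z i)) < 1 \<Longrightarrow> \<exists>s. ((\<lambda>\<alpha>. cscale (zpow z \<alpha>) (c \<alpha>)) has_sum s) UNIV
      \<and> ((\<lambda>\<alpha>. cscale (zpow z \<alpha>) (d \<alpha>)) has_sum s) UNIV"
  shows "c = d"
proof
  fix \<kappa>
  have "cinner (c \<kappa> - d \<kappa>) v = 0" for v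
  proof (rule multi_powser_unique_complex)
    fix z :: "'n \<Rightarrow> complex" assume "(\<Sum>i\<in>UNIV. cmod (z i)) < 1"
    then obtain s where s: "((\<lambda>\<alpha>. cscale (zpow z \<alpha>) (c \<alpha>)) has_sum s) UNIV"
        "((\<lambda>\<alpha>. cscale (zpow z \<alpha>) (d \<alpha>)) has_sum s) UNIV" using assms by blast
    have "((\<lambda>\<alpha>. cinner (cscale (zpow z \<alpha>) (c \<alpha>) - cscale (zpow z \<alpha>) (d \<alpha>)) v) has_sum cinner (s - s) v) UNIV"
      using has_sum_bounded_linear[OF bounded_linear_cinner_left has_sum_diff[OF s]] .
    then show "((\<lambda>\<alpha>. zpow z \<alpha> * cinner (c \<alpha> - d \<alpha>) v) has_sum 0) UNIV"
      by (simp add: cinner_simps algebra_simps)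
  qed
  from this[of "c \<kappa> - d \<kappa>"] show "c \<kappa> = d \<kappa>" using cinner_eq_zero[of "c \<kappa> - d \<kappa>"] by simp
qed

section \<open>Spaces of power series with square summable coefficients\<close>

lemma summable_mult_of_squares:
  fixes f g :: "'a \<Rightarrow> real"
  assumes f: "(\<lambda>x. (f x)\<^sup>2) summable_on A" and g: "(\<lambda>x. (g x)\<^sup>2) summable_on A"
  shows "(\<lambda>x. \<bar>f x * g x\<bar>) summable_on A"
proof (rule summable_on_comparison_test)
  show "(\<lambda>x. (f x)\<^sup>2 + (g x)\<^sup>2) summable_on A" by (intro summable_on_add f g)
  show "\<bar>f x * g x\<bar> \<le> (f x)\<^sup>2 + (g x)\<^sup>2" for x
  proof -
    have "2 * \<bar>f x * g x\<bar> \<le> (f x)\<^sup>2 + (g x)\<^sup>2"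
      using sum_squares_bound[of "\<bar>f x\<bar>" "\<bar>g x\<bar>"] by (simp add: abs_mult mult.assoc)
    then show ?thesis using abs_ge_zero[of "f x * g x"] by linarith
  qed
qed auto

lemma Cauchy_Schwarz_infsum:
  fixes f g :: "'a \<Rightarrow> real"
  assumes f: "(\<lambda>x. (f x)\<^sup>2) summable_on A" and g: "(\<lambda>x. (g x)\<^sup>2) summable_on A"
  shows "(\<Sum>\<^sub>\<infinity>x\<in>A. \<bar>f x * g x\<bar>) \<le> sqrt (\<Sum>\<^sub>\<infinity>x\<in>A. (f x)\<^sup>2) * sqrt (\<Sum>\<^sub>\<infinity>x\<in>A. (g x)\<^sup>2)"
proof (rule infsum_le_finite_sums[OF summable_mult_of_squares[OF f g]])
  fix F assume F: "finite F" "F \<subseteq> A"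
  have "(\<Sum>x\<in>F. \<bar>f x * g x\<bar>) \<le> L2_set f F * L2_set g F"
    using L2_set_mult_ineq[of f g F] by (simp add: abs_mult)
  also have "\<dots> \<le> sqrt (\<Sum>\<^sub>\<infinity>x\<in>A. (f x)\<^sup>2) * sqrt (\<Sum>\<^sub>\<infinity>x\<in>A. (g x)\<^sup>2)"
    unfolding L2_set_def
    by (intro mult_mono real_sqrt_le_mono finite_sum_le_infsum f g F) (auto intro: sum_nonneg infsum_nonneg)
  finally show "(\<Sum>x\<in>F. \<bar>f x * g x\<bar>) \<le> sqrt (\<Sum>\<^sub>\<infinity>x\<in>A. (f x)\<^sup>2) * sqrt (\<Sum>\<^sub>\<infinity>x\<in>A. (g x)\<^sup>2)" .
qed

text \<open>The assumptions on convergence hold for Hilbert spaces as well as for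
  function spaces with the topology of pointwise convergence.\<close>

locale pspace = ipspace ip E for ip :: "'e::{cvec,topological_space} \<Rightarrow> 'e \<Rightarrow> complex" and E +
  fixes N :: "'n::finite itself"
  assumes add_has_sum: "\<And>(c::('n \<Rightarrow> nat) \<Rightarrow> 'e) d s t. (c has_sum s) UNIV \<Longrightarrow> (d has_sum t) UNIV \<Longrightarrow>
        ((\<lambda>\<alpha>. c \<alpha> + d \<alpha>) has_sum (s + t)) UNIV"
    and scale_has_sum: "\<And>(c::('n \<Rightarrow> nat) \<Rightarrow> 'e) k s. (c has_sum s) UNIV \<Longrightarrow> ((\<lambda>\<alpha>. cscale k (c \<alpha>)) has_sum cscale k s) UNIV"
    and zero_has_sum: "\<And>s. ((\<lambda>_::'n \<Rightarrow> nat. 0::'e) has_sum s) UNIV \<Longrightarrow> s = 0"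
    and coef_unique: "\<And>c d. (\<And>\<alpha>. c \<alpha> \<in> E) \<Longrightarrow> (\<And>\<alpha>. d \<alpha> \<in> E) \<Longrightarrow>
        (\<And>z::'n \<Rightarrow> complex. z \<in> Bn \<Longrightarrow> \<exists>s. ((\<lambda>\<alpha>. cscale (zpow z \<alpha>) (c \<alpha>)) has_sum s) UNIV
            \<and> ((\<lambda>\<alpha>. cscale (zpow z \<alpha>) (d \<alpha>)) has_sum s) UNIV) \<Longrightarrow> c = d"
    and conv: "\<And>c (z::'n \<Rightarrow> complex). (\<And>\<alpha>. c \<alpha> \<in> E) \<Longrightarrow> z \<in> Bn \<Longrightarrow>
        (\<lambda>\<alpha>. cmod (zpow z \<alpha>) * nrm ip (c \<alpha>)) summable_on UNIV \<Longrightarrow>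
        \<exists>s. ((\<lambda>\<alpha>. cscale (zpow z \<alpha>) (c \<alpha>)) has_sum s) UNIV"
begin

definition sqs :: "nat \<Rightarrow> (('n \<Rightarrow> nat) \<Rightarrow> 'e) \<Rightarrow> bool" where
  "sqs l c \<longleftrightarrow> (\<forall>\<alpha>. c \<alpha> \<in> E) \<and> (\<lambda>\<alpha>. (nm (c \<alpha>))\<^sup>2 / rho l \<alpha>) summable_on UNIV"

lemma is_coef_iff:
  "is_coef l ip E c f \<longleftrightarrow> sqs l c \<and> (\<forall>z\<in>Bn. ((\<lambda>\<alpha>. cscale (zpow z \<alpha>) (c \<alpha>)) has_sum f z) UNIV)"
proof (cases "\<forall>\<alpha>. c \<alpha> \<in> E")
  case True
  then have "Re (ip (c \<alpha>) (c \<alpha>)) = (nm (c \<alpha>))\<^sup>2" for \<alpha> by (simp add: nm_sq)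
  then show ?thesis by (simp add: is_coef_def sqs_def)
qed (auto simp: is_coef_def sqs_def)

lemma sqs_root: "sqs l c \<Longrightarrow> (\<lambda>\<alpha>. (nm (c \<alpha>) / sqrt (rho l \<alpha>))\<^sup>2) summable_on UNIV"
  by (simp add: sqs_def power_divide)

text \<open>Cauchy-Schwarz after distributing \<open>sqrt (rho l \<alpha>)\<close> over the two
  factors; the sum under the first root is the reproducing kernel at (z, z).\<close>

lemma abs_conv:
  assumes c: "sqs l c" and z: "z \<in> Bn" and l: "l \<ge> 1"
  shows "(\<lambda>\<alpha>. cmod (zpow z \<alpha>) * nm (c \<alpha>)) summable_on UNIV"
    and "(\<Sum>\<^sub>\<infinity>\<alpha>. cmod (zpow z \<alpha>) * nm (c \<alpha>))
      \<le> sqrt (\<Sum>\<^sub>\<infinity>\<alpha>. rr l \<alpha> * (cmod (zpow z \<alpha>))\<^sup>2) * sqrt (\<Sum>\<^sub>\<infinity>\<alpha>. (nm (c \<alpha>))\<^sup>2 / rho l \<alpha>)"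
proof -
  have 1: "(\<lambda>\<alpha>. (sqrt (rho l \<alpha>) * cmod (zpow z \<alpha>))\<^sup>2) summable_on UNIV"
    using rr_zpow_sq_summable[OF z, of l] l by (simp add: power_mult_distrib rr_pos)
  have eq: "\<bar>sqrt (rho l \<alpha>) * cmod (zpow z \<alpha>) * (nm (c \<alpha>) / sqrt (rho l \<alpha>))\<bar> = cmod (zpow z \<alpha>) * nm (c \<alpha>)" for \<alpha>
    using c by (simp add: sqs_def abs_mult)
  show "(\<lambda>\<alpha>. cmod (zpow z \<alpha>) * nm (c \<alpha>)) summable_on UNIV"
    using summable_mult_of_squares[OF 1 sqs_root[OF c]] by (simp only: eq)
  show "(\<Sum>\<^sub>\<infinity>\<alpha>. cmod (zpow z \<alpha>) * nm (c \<alpha>))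
      \<le> sqrt (\<Sum>\<^sub>\<infinity>\<alpha>. rr l \<alpha> * (cmod (zpow z \<alpha>))\<^sup>2) * sqrt (\<Sum>\<^sub>\<infinity>\<alpha>. (nm (c \<alpha>))\<^sup>2 / rho l \<alpha>)"
    using Cauchy_Schwarz_infsum[OF 1 sqs_root[OF c], unfolded eq] l
    by (simp add: power_mult_distrib power_divide rr_pos)
qed

lemma coef_ex:
  assumes c: "sqs l c" and l: "l \<ge> 1"
  obtains f where "f \<in> hsp l ip E" "is_coef l ip E c f"
proof -
  have "\<exists>s. ((\<lambda>\<alpha>. cscale (zpow z \<alpha>) (c \<alpha>)) has_sum s) UNIV" if "z \<in> Bn" for z :: "'n \<Rightarrow> complex"
    using c that by (intro conv abs_conv(1)[OF c that l]) (auto simp: sqs_def)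
  then obtain g where g: "\<And>z :: 'n \<Rightarrow> complex. z \<in> Bn \<Longrightarrow> ((\<lambda>\<alpha>. cscale (zpow z \<alpha>) (c \<alpha>)) has_sum g z) UNIV"
    by metis
  define f where "f z = (if z \<in> Bn then g z else 0)" for z
  have "is_coef l ip E c f" using c g by (simp add: is_coef_iff f_def)
  then show ?thesis using that[of f] l by (auto simp: hsp_def f_def)
qed

lemma is_coef_unique: "is_coef l ip E c f \<Longrightarrow> is_coef l' ip E d f \<Longrightarrow> c = d"
  for f :: "('n \<Rightarrow> complex) \<Rightarrow> 'e"
  by (rule coef_unique) (auto simp: is_coef_def)

lemma hcoef_eq: "is_coef l ip E c f \<Longrightarrow> hcoef l ip E f = c"
  for f :: "('n \<Rightarrow> complex) \<Rightarrow> 'e"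
  unfolding hcoef_def by (rule some_equality) (auto intro: is_coef_unique)

lemma is_coef_hcoef: "l \<ge> 1 \<Longrightarrow> f \<in> hsp l ip E \<Longrightarrow> is_coef l ip E (hcoef l ip E f) f"
  for f :: "('n \<Rightarrow> complex) \<Rightarrow> 'e"
  unfolding hcoef_def by (rule someI_ex[where P = "\<lambda>c. is_coef l ip E c f"]) (auto simp: hsp_def)

lemma hsp_outside: "f \<in> hsp l ip E \<Longrightarrow> z \<notin> Bn \<Longrightarrow> f z = 0"
  by (auto simp: hsp_def split: if_splits)

lemma hspI: "l \<ge> 1 \<Longrightarrow> is_coef l ip E c f \<Longrightarrow> (\<And>z. z \<notin> Bn \<Longrightarrow> f z = 0) \<Longrightarrow> f \<in> hsp l ip E"
  by (auto simp: hsp_def)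

lemma ip_summable:
  assumes c: "sqs l c" and d: "sqs l d"
  shows "(\<lambda>\<alpha>. cmod (ip (c \<alpha>) (d \<alpha>) / of_real (rho l \<alpha>))) summable_on UNIV"
proof (rule Infinite_Sum.abs_summable_on_comparison_test')
  show "(\<lambda>\<alpha>. \<bar>nm (c \<alpha>) / sqrt (rho l \<alpha>) * (nm (d \<alpha>) / sqrt (rho l \<alpha>))\<bar>) summable_on UNIV"
    by (rule summable_mult_of_squares[OF sqs_root[OF c] sqs_root[OF d]])
  fix \<alpha>
  have "cmod (ip (c \<alpha>) (d \<alpha>)) \<le> nm (c \<alpha>) * nm (d \<alpha>)"
    using c d by (intro Cauchy_Schwarz) (auto simp: sqs_def)
  then show "norm (ip (c \<alpha>) (d \<alpha>) / of_real (rho l \<alpha>)) \<le> \<bar>nm (c \<alpha>) / sqrt (rho l \<alpha>) * (nm (d \<alpha>) / sqrt (rho l \<alpha>))\<bar>"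
    using c d by (simp add: norm_divide sqs_def divide_right_mono)
qed

lemma sqs_add: "sqs l c \<Longrightarrow> sqs l d \<Longrightarrow> sqs l (\<lambda>\<alpha>. c \<alpha> + d \<alpha>)"
proof -
  assume c: "sqs l c" and d: "sqs l d"
  have "(\<lambda>\<alpha>. (nm (c \<alpha> + d \<alpha>))\<^sup>2 / rho l \<alpha>) summable_on UNIV"
  proof (rule summable_on_comparison_test)
    show "(\<lambda>\<alpha>. 2 * ((nm (c \<alpha>))\<^sup>2 / rho l \<alpha>) + 2 * ((nm (d \<alpha>))\<^sup>2 / rho l \<alpha>)) summable_on UNIV"
      using c d by (intro summable_on_add summable_on_cmult_right) (auto simp: sqs_def)
    fix \<alpha>
    have cd: "c \<alpha> \<in> E" "d \<alpha> \<in> E" using c d by (auto simp: sqs_def)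
    have "0 \<le> (nm (c \<alpha> - d \<alpha>))\<^sup>2" by simp
    then have "(nm (c \<alpha> + d \<alpha>))\<^sup>2 \<le> 2 * (nm (c \<alpha>))\<^sup>2 + 2 * (nm (d \<alpha>))\<^sup>2"
      using cd by (simp add: nm_add_sq nm_diff_sq)
    then show "(nm (c \<alpha> + d \<alpha>))\<^sup>2 / rho l \<alpha> \<le> 2 * ((nm (c \<alpha>))\<^sup>2 / rho l \<alpha>) + 2 * ((nm (d \<alpha>))\<^sup>2 / rho l \<alpha>)"
      using divide_right_mono[of _ _ "rho l \<alpha>"] by (fastforce simp: add_divide_distrib)
  qed auto
  then show ?thesis using c d by (auto simp: sqs_def add_closed)
qed

lemma sqs_scale: "sqs l c \<Longrightarrow> sqs l (\<lambda>\<alpha>. cscale k (c \<alpha>))"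
  using summable_on_cmult_right[of "\<lambda>\<alpha>. (nm (c \<alpha>))\<^sup>2 / rho l \<alpha>" UNIV "(cmod k)\<^sup>2"]
  by (auto simp: sqs_def scale_closed nm_scale power_mult_distrib)

lemma sqs_0: "sqs l (\<lambda>_. 0)"
  by (simp add: sqs_def zero_closed)

lemma is_coef_add: "is_coef l ip E c f \<Longrightarrow> is_coef l ip E d g \<Longrightarrow> is_coef l ip E (\<lambda>\<alpha>. c \<alpha> + d \<alpha>) (f + g)"
  for f :: "('n \<Rightarrow> complex) \<Rightarrow> 'e"
  unfolding is_coef_iff by (auto simp: cscale_add_right intro: sqs_add add_has_sum)

lemma is_coef_scale: "is_coef l ip E c f \<Longrightarrow> is_coef l ip E (\<lambda>\<alpha>. cscale k (c \<alpha>)) (cscale k f)"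
  for f :: "('n \<Rightarrow> complex) \<Rightarrow> 'e"
proof -
  have "cscale (zpow z \<alpha>) (cscale k (c \<alpha>)) = cscale k (cscale (zpow z \<alpha>) (c \<alpha>))" for z \<alpha>
    by (simp add: cscale_cscale mult.commute)
  then show "is_coef l ip E c f \<Longrightarrow> ?thesis"
    unfolding is_coef_iff by (auto simp: cscale_fun_def intro: sqs_scale scale_has_sum)
qed

lemma is_coef_eq: "is_coef l ip E c f \<Longrightarrow> is_coef l ip E c g \<Longrightarrow> z \<in> Bn \<Longrightarrow> f z = g z"
  for f :: "('n \<Rightarrow> complex) \<Rightarrow> 'e"
proof -
  assume f: "is_coef l ip E c f" and g: "is_coef l ip E c g" and z: "z \<in> Bn"
  from is_coef_add[OF f is_coef_scale[OF g, of "- 1"]]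
  have "is_coef l ip E (\<lambda>_. 0) (f + cscale (- 1) g)" by (simp add: cscale_neg_one)
  then have "((\<lambda>_::'n \<Rightarrow> nat. 0) has_sum (f + cscale (- 1) g) z) UNIV" using z by (fastforce simp: is_coef_iff)
  then have "(f + cscale (- 1) g) z = 0" by (rule zero_has_sum)
  then show ?thesis by (simp add: cscale_fun_def cscale_neg_one)
qed

lemma hip_eq:
  fixes f g :: "('n \<Rightarrow> complex) \<Rightarrow> 'e"
  shows "l \<ge> 1 \<Longrightarrow> is_coef l ip E c f \<Longrightarrow> is_coef l ip E d g \<Longrightarrow>
    hip l ip E f g = (\<Sum>\<^sub>\<infinity>\<alpha>. ip (c \<alpha>) (d \<alpha>) / of_real (rho l \<alpha>))"
  by (simp add: hip_def hcoef_eq)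

lemma hip_self:
  fixes f :: "('n \<Rightarrow> complex) \<Rightarrow> 'e"
  assumes l: "l \<ge> 1" and c: "is_coef l ip E c f"
  shows "hip l ip E f f = of_real (\<Sum>\<^sub>\<infinity>\<alpha>. (nm (c \<alpha>))\<^sup>2 / rho l \<alpha>)"
proof -
  have "ip (c \<alpha>) (c \<alpha>) / of_real (rho l \<alpha>) = of_real ((nm (c \<alpha>))\<^sup>2 / rho l \<alpha>)" for \<alpha>
    using c by (simp add: is_coef_def ip_self)
  moreover have "(\<Sum>\<^sub>\<infinity>\<alpha>. of_real ((nm (c \<alpha>))\<^sup>2 / rho l \<alpha>)) = (of_real (\<Sum>\<^sub>\<infinity>\<alpha>. (nm (c \<alpha>))\<^sup>2 / rho l \<alpha>) :: complex)"
    using c by (intro infsumI has_sum_of_real has_sum_infsum) (auto simp: is_coef_iff sqs_def)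
  ultimately show ?thesis by (simp add: hip_eq[OF l c c])
qed

lemma ipspace_hsp:
  assumes l: "l \<ge> 1"
  shows "ipspace (hip l ip E) (hsp l ip E :: (('n \<Rightarrow> complex) \<Rightarrow> 'e) set)"
proof
  fix f g h :: "('n \<Rightarrow> complex) \<Rightarrow> 'e" and k
  note co = is_coef_hcoef[OF l]
  assume f: "f \<in> hsp l ip E"
  let ?c = "hcoef l ip E f"
  have sf: "sqs l ?c" using co[OF f] by (simp add: is_coef_iff)
  show "cscale k f \<in> hsp l ip E"
    by (rule hspI[OF l is_coef_scale[OF co[OF f]]]) (simp add: cscale_fun_def hsp_outside[OF f])
  show "0 \<le> Re (hip l ip E f f)"
    by (simp add: hip_self[OF l co[OF f]] infsum_nonneg)
  show "f = 0" if "hip l ip E f f = 0"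
  proof -
    have 0: "(\<Sum>\<^sub>\<infinity>\<alpha>. (nm (?c \<alpha>))\<^sup>2 / rho l \<alpha>) = 0"
      using that unfolding hip_self[OF l co[OF f]] by simp
    have "(nm (?c \<alpha>))\<^sup>2 / rho l \<alpha> = 0" for \<alpha>
      by (rule nonneg_infsum_le_0D[of "\<lambda>\<alpha>. (nm (?c \<alpha>))\<^sup>2 / rho l \<alpha>" UNIV]) (use 0 sf in \<open>auto simp: sqs_def\<close>)
    then have "?c = (\<lambda>_. 0)" using sf nm_eq_0 by (auto simp: sqs_def)
    then have c0: "is_coef l ip E (\<lambda>_. 0) f" using co[OF f] by simp
    have "is_coef l ip E (\<lambda>_. 0) (0 :: ('n \<Rightarrow> complex) \<Rightarrow> 'e)" by (simp add: is_coef_iff sqs_0)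
    then have "f z = 0" for z using is_coef_eq[OF c0] hsp_outside[OF f, of z] by (cases "z \<in> Bn") auto
    then show ?thesis by (simp add: fun_eq_iff)
  qed
  assume g: "g \<in> hsp l ip E"
  let ?d = "hcoef l ip E g"
  have sg: "sqs l ?d" using co[OF g] by (simp add: is_coef_iff)
  show "f + g \<in> hsp l ip E"
    by (rule hspI[OF l is_coef_add[OF co[OF f] co[OF g]]]) (simp add: hsp_outside[OF f] hsp_outside[OF g])
  have mem: "?c \<alpha> \<in> E" "?d \<alpha> \<in> E" for \<alpha> using sf sg by (auto simp: sqs_def)
  show "hip l ip E (cscale k f) g = k * hip l ip E f g"
    unfolding hip_eq[OF l is_coef_scale[OF co[OF f]] co[OF g]] hip_eq[OF l co[OF f] co[OF g]]
    by (subst infsum_cmult_right'[symmetric]) (simp add: ip_scale_left mem)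
  show "hip l ip E g f = cnj (hip l ip E f g)"
    unfolding hip_eq[OF l co[OF g] co[OF f]] hip_eq[OF l co[OF f] co[OF g]]
    by (subst infsum_cnj[symmetric]) (simp add: ip_commute[symmetric] mem)
  assume h: "h \<in> hsp l ip E"
  let ?e = "hcoef l ip E h"
  have sh: "sqs l ?e" using co[OF h] by (simp add: is_coef_iff)
  have mem': "?e \<alpha> \<in> E" for \<alpha> using sh by (auto simp: sqs_def)
  show "hip l ip E (f + g) h = hip l ip E f h + hip l ip E g h"
    unfolding hip_eq[OF l is_coef_add[OF co[OF f] co[OF g]] co[OF h]] hip_eq[OF l co[OF f] co[OF h]] hip_eq[OF l co[OF g] co[OF h]]
    using infsum_add[OF abs_summable_summable[OF ip_summable[OF sf sh]] abs_summable_summable[OF ip_summable[OF sg sh]]]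
    by (simp add: ip_add_left mem mem' add_divide_distrib)
next
  have "is_coef l ip E (\<lambda>_. 0) (0 :: ('n \<Rightarrow> complex) \<Rightarrow> 'e)" by (simp add: is_coef_iff sqs_0)
  then show "(0 :: ('n \<Rightarrow> complex) \<Rightarrow> 'e) \<in> hsp l ip E" by (rule hspI[OF l]) simp
qed

end

section \<open>The scalar spaces H_l, including l = 0\<close>

text \<open>Coefficients in a form that is uniform in \<open>l\<close>; \<open>hcoef\<close> is meaningless for \<open>l = 0\<close>.\<close>

definition hc :: "nat \<Rightarrow> 'h::chilbert set \<Rightarrow> (('n::finite \<Rightarrow> complex) \<Rightarrow> 'h) \<Rightarrow> ('n \<Rightarrow> nat) \<Rightarrow> 'h" where
  "hc l D f = (if l = 0 then (\<lambda>\<alpha>. if \<alpha> = 0 then f 0 else 0) else hcoef l cinner D f)"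

definition mkf :: "(('n::finite \<Rightarrow> nat) \<Rightarrow> 'h::chilbert) \<Rightarrow> ('n \<Rightarrow> complex) \<Rightarrow> 'h" where
  "mkf c z = (if z \<in> Bn then infsum (\<lambda>\<alpha>. cscale (zpow z \<alpha>) (c \<alpha>)) UNIV else 0)"

text \<open>The square root of the kernel of H_l at (z, z), which bounds the evaluation at
  \<open>z\<close>.\<close>

definition kap :: "nat \<Rightarrow> ('n::finite \<Rightarrow> complex) \<Rightarrow> real" where
  "kap l z = sqrt (\<Sum>\<^sub>\<infinity>\<alpha>. rr l \<alpha> * (cmod (zpow z \<alpha>))\<^sup>2)"

lemma kap_nonneg [simp]: "0 \<le> kap l z"
  by (simp add: kap_def infsum_nonneg)

lemma zero_Bn [simp]: "0 \<in> Bn"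
  by (simp add: Bn_def)

text \<open>The space of coefficients. The type argument records the number of variables, which
  \<open>D\<close> does not determine.\<close>

locale csub =
  fixes D :: "'h::chilbert set" and N :: "'n::finite itself"
  assumes D0: "0 \<in> D" and Dadd: "x \<in> D \<Longrightarrow> y \<in> D \<Longrightarrow> x + y \<in> D" and Dsc: "x \<in> D \<Longrightarrow> cscale c x \<in> D"
begin

sublocale P: pspace cinner D "TYPE('n)"
proof -
  interpret ipspace cinner D using D0 Dadd Dsc by (intro H.ipspace_subspace) auto
  show "pspace TYPE('n) cinner D"
  proof (intro pspace.intro ipspace_axioms pspace_axioms.intro)
    show "c = d" if "\<And>z::'n \<Rightarrow> complex. z \<in> Bn \<Longrightarrow> \<exists>s. ((\<lambda>\<alpha>. cscale (zpow z \<alpha>) (c \<alpha>)) has_sum s) UNIV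
            \<and> ((\<lambda>\<alpha>. cscale (zpow z \<alpha>) (d \<alpha>)) has_sum s) UNIV" for c d :: "('n \<Rightarrow> nat) \<Rightarrow> 'h"
      by (rule multi_powser_unique) (use that l1_ball_Bn in blast)
    show "\<exists>s. ((\<lambda>\<alpha>. cscale (zpow z \<alpha>) (c \<alpha>)) has_sum s) UNIV"
      if "(\<lambda>\<alpha>. cmod (zpow z \<alpha>) * nrm cinner (c \<alpha>)) summable_on UNIV" for c and z :: "'n \<Rightarrow> complex"
      using abs_summable_summable[of "\<lambda>\<alpha>. cscale (zpow z \<alpha>) (c \<alpha>)"] that
      by (auto simp: summable_on_def)
    show "((\<lambda>\<alpha>. cscale k (c \<alpha>)) has_sum cscale k s) UNIV" if "(c has_sum s) UNIV" for c :: "('n \<Rightarrow> nat) \<Rightarrow> 'h" and k s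
      by (rule has_sum_bounded_linear[OF bounded_linear_cscale_right that])
    show "s = 0" if "((\<lambda>_::'n \<Rightarrow> nat. 0::'h) has_sum s) UNIV" for s
      using has_sum_unique[OF that has_sum_0_simp] .
  qed (rule has_sum_add)
qed

abbreviation HS :: "nat \<Rightarrow> (('n \<Rightarrow> complex) \<Rightarrow> 'h) set" where "HS l \<equiv> hsp l cinner D"
abbreviation HI :: "nat \<Rightarrow> (('n \<Rightarrow> complex) \<Rightarrow> 'h) \<Rightarrow> (('n \<Rightarrow> complex) \<Rightarrow> 'h) \<Rightarrow> complex" where "HI l \<equiv> hip l cinner D"

lemma hsp_0_iff: "f \<in> HS 0 \<longleftrightarrow> f 0 \<in> D \<and> f = (\<lambda>z. if z \<in> Bn then f 0 else 0)"
  by (auto simp: hsp_def)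

lemma hc_mem: "f \<in> HS l \<Longrightarrow> hc l D f \<alpha> \<in> D"
  using P.is_coef_hcoef[of l f] D0 hsp_0_iff[of f] by (cases "l = 0") (auto simp: hc_def is_coef_def)

lemma hc_zero: "rr l \<alpha> = 0 \<Longrightarrow> hc l D f \<alpha> = 0"
  by (auto simp: rr_def hc_def split: if_splits)

lemma has_sum_at_0: "((\<lambda>\<alpha>. if \<alpha> = 0 then x else 0) has_sum x) (UNIV :: ('n \<Rightarrow> nat) set)"
  for x :: "'a::{comm_monoid_add,topological_space}"
  by (rule has_sum_finite_neutralI[where B = "{0}"]) auto

lemma hc_has_sum: "f \<in> HS l \<Longrightarrow> z \<in> Bn \<Longrightarrow> ((\<lambda>\<alpha>. cscale (zpow z \<alpha>) (hc l D f \<alpha>)) has_sum f z) UNIV"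
proof (cases "l = 0")
  case True
  assume f: "f \<in> HS l" and z: "z \<in> Bn"
  have "f z = f 0" using f z True hsp_0_iff by (metis (full_types))
  moreover have "(\<lambda>\<alpha>. cscale (zpow z \<alpha>) (hc l D f \<alpha>)) = (\<lambda>\<alpha>. if \<alpha> = 0 then f 0 else 0)"
    using True by (intro ext) (auto simp: hc_def cscale_one)
  ultimately show ?thesis using has_sum_at_0[of "f 0"] by simp
qed (use P.is_coef_hcoef[of l f] in \<open>auto simp: hc_def is_coef_def\<close>)

lemma hc_summable: "f \<in> HS l \<Longrightarrow> (\<lambda>\<alpha>. (norm (hc l D f \<alpha>))\<^sup>2 / rr l \<alpha>) summable_on UNIV"
proof (cases "l = 0")
  case True
  have "(\<lambda>\<alpha>. (norm (hc l D f \<alpha>))\<^sup>2 / rr l \<alpha>) = (\<lambda>\<alpha>. if \<alpha> = 0 then (norm (f 0))\<^sup>2 else 0)"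
    using True by (intro ext) (auto simp: hc_def)
  then show ?thesis using has_sum_imp_summable[OF has_sum_at_0] by simp
qed (use P.is_coef_hcoef[of l f] in \<open>auto simp: hc_def is_coef_def cinner_self rr_def\<close>)

lemma hip_hc: "HI l f g = (\<Sum>\<^sub>\<infinity>\<alpha>. cinner (hc l D f \<alpha>) (hc l D g \<alpha>) / of_real (rr l \<alpha>))"
proof (cases "l = 0")
  case True
  have "(\<lambda>\<alpha>. cinner (hc l D f \<alpha>) (hc l D g \<alpha>) / of_real (rr l \<alpha>)) = (\<lambda>\<alpha>. if \<alpha> = 0 then cinner (f 0) (g 0) else 0)"
    using True by (intro ext) (auto simp: hc_def)
  then show ?thesis using infsumI[OF has_sum_at_0, of "cinner (f 0) (g 0)"] True by (simp add: hip_def)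
qed (simp add: hip_def hc_def rr_def)

lemma hip_hc_self: "f \<in> HS l \<Longrightarrow> HI l f f = of_real (\<Sum>\<^sub>\<infinity>\<alpha>. (norm (hc l D f \<alpha>))\<^sup>2 / rr l \<alpha>)"
  unfolding hip_hc
proof -
  assume f: "f \<in> HS l"
  have "((\<lambda>\<alpha>. complex_of_real ((norm (hc l D f \<alpha>))\<^sup>2 / rr l \<alpha>)) has_sum
      of_real (\<Sum>\<^sub>\<infinity>\<alpha>. (norm (hc l D f \<alpha>))\<^sup>2 / rr l \<alpha>)) UNIV"
    by (intro has_sum_of_real has_sum_infsum hc_summable f)
  then show "(\<Sum>\<^sub>\<infinity>\<alpha>. cinner (hc l D f \<alpha>) (hc l D f \<alpha>) / of_real (rr l \<alpha>))
      = of_real (\<Sum>\<^sub>\<infinity>\<alpha>. (norm (hc l D f \<alpha>))\<^sup>2 / rr l \<alpha>)"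
    by (simp add: cinner_self infsumI)
qed

lemma hc_eq:
  assumes f: "f \<in> HS l" and c: "\<And>\<alpha>. rr l \<alpha> = 0 \<Longrightarrow> c \<alpha> = 0"
    and s: "\<And>z. (\<Sum>i\<in>UNIV. cmod (z i)) < 1 \<Longrightarrow> ((\<lambda>\<alpha>. cscale (zpow z \<alpha>) (c \<alpha>)) has_sum f z) UNIV"
  shows "hc l D f = c"
  using hc_has_sum[OF f] s l1_ball_Bn by (intro multi_powser_unique) blast

lemma mkf_hc:
  assumes c: "\<And>\<alpha>. c \<alpha> \<in> D" "\<And>\<alpha>. rr l \<alpha> = 0 \<Longrightarrow> c \<alpha> = 0"
    "(\<lambda>\<alpha>. (norm (c \<alpha>))\<^sup>2 / rr l \<alpha>) summable_on UNIV"
  shows "mkf c \<in> HS l" "hc l D (mkf c :: ('n \<Rightarrow> complex) \<Rightarrow> 'h) = c"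
proof -
  have "mkf c \<in> HS l \<and> hc l D (mkf c :: ('n \<Rightarrow> complex) \<Rightarrow> 'h) = c"
  proof (cases "l = 0")
    case True
    then have c0: "\<alpha> \<noteq> 0 \<Longrightarrow> c \<alpha> = 0" for \<alpha> using c(2)[of \<alpha>] by (simp add: rr_def)
    have "(\<lambda>\<alpha>. cscale (zpow z \<alpha>) (c \<alpha>)) = (\<lambda>\<alpha>. if \<alpha> = 0 then c 0 else 0)" for z
      using c0 by (intro ext) (auto simp: cscale_one)
    then have "mkf c = (\<lambda>z. if z \<in> Bn then c 0 else 0)"
      using infsumI[OF has_sum_at_0, of "c 0"] by (simp add: mkf_def fun_eq_iff)
    then show ?thesis using True c(1) c0 by (auto simp: hsp_0_iff hc_def)
  next
    case False
    then have l: "l \<ge> 1" by simp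
    have "P.sqs l c" using c l by (simp add: P.sqs_def rr_pos)
    then obtain f where f: "f \<in> HS l" "is_coef l cinner D c f" using P.coef_ex l by blast
    have "f = mkf c"
      using P.hsp_outside[OF f(1)] f(2) by (auto simp: fun_eq_iff mkf_def is_coef_def infsumI)
    then show ?thesis using f l by (simp add: hc_def P.hcoef_eq)
  qed
  then show "mkf c \<in> HS l" "hc l D (mkf c :: ('n \<Rightarrow> complex) \<Rightarrow> 'h) = c" by auto
qed

lemma ipspace_HS: "ipspace (HI l) (HS l)"
proof (cases "l = 0")
  case True
  show ?thesis unfolding True
  proof
    fix f g h :: "('n \<Rightarrow> complex) \<Rightarrow> 'h" and k
    show "(0::('n \<Rightarrow> complex) \<Rightarrow> 'h) \<in> HS 0" using D0 by (auto simp: hsp_def fun_eq_iff)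
    show "0 \<le> Re (HI 0 f f)" by (simp add: hip_def cinner_nonneg)
    show "HI 0 (cscale k f) g = k * HI 0 f g" by (simp add: hip_def cscale_fun_def cinner_simps)
    show "HI 0 g f = cnj (HI 0 f g)" by (simp add: hip_def cinner_commute[symmetric])
    show "HI 0 (f + g) h = HI 0 f h + HI 0 g h" by (simp add: hip_def cinner_simps)
    assume "f \<in> HS 0"
    then obtain a where f: "a \<in> D" "f = (\<lambda>z. if z \<in> Bn then a else 0)" by (auto simp: hsp_def)
    show "cscale k f \<in> HS 0"
      using f Dsc[OF f(1), of k] by (auto simp: hsp_def cscale_fun_def fun_eq_iff intro!: bexI[of _ "cscale k a"])
    show "HI 0 f f = 0 \<Longrightarrow> f = 0" using f by (simp add: hip_def fun_eq_iff cinner_self)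
    assume "g \<in> HS 0"
    then obtain b where g: "b \<in> D" "g = (\<lambda>z. if z \<in> Bn then b else 0)" by (auto simp: hsp_def)
    show "f + g \<in> HS 0"
      using f g Dadd[OF f(1) g(1)] by (auto simp: hsp_def fun_eq_iff intro!: bexI[of _ "a + b"])
  qed
next
  case False
  then show ?thesis by (intro P.ipspace_hsp) simp
qed

lemma hc_add: "f \<in> HS l \<Longrightarrow> g \<in> HS l \<Longrightarrow> hc l D (f + g) \<alpha> = hc l D f \<alpha> + hc l D g \<alpha>"
  using P.hcoef_eq[OF P.is_coef_add[OF P.is_coef_hcoef[of l f] P.is_coef_hcoef[of l g]]]
  by (cases "l = 0") (auto simp: hc_def)

lemma hc_scale: "f \<in> HS l \<Longrightarrow> hc l D (cscale k f) \<alpha> = cscale k (hc l D f \<alpha>)"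
  using P.hcoef_eq[OF P.is_coef_scale[OF P.is_coef_hcoef[of l f]], of k]
  by (cases "l = 0") (auto simp: hc_def cscale_fun_def)

lemma HS_outside: "f \<in> HS l \<Longrightarrow> z \<notin> Bn \<Longrightarrow> f z = 0"
  by (rule P.hsp_outside)

lemma HS_eq: "f \<in> HS l \<Longrightarrow> g \<in> HS l \<Longrightarrow> hc l D f = hc l D g \<Longrightarrow> f = g"
proof
  fix z assume "f \<in> HS l" "g \<in> HS l" "hc l D f = hc l D g"
  then show "f z = g z"
    using hc_has_sum[of f l z] hc_has_sum[of g l z] HS_outside[of f l z] HS_outside[of g l z]
    by (cases "z \<in> Bn") (auto intro: has_sum_unique)
qed

lemma hc_abs:
  assumes f: "f \<in> HS l" and z: "z \<in> Bn"
  shows "(\<lambda>\<alpha>. cmod (zpow z \<alpha>) * norm (hc l D f \<alpha>)) summable_on UNIV"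
    and "(\<Sum>\<^sub>\<infinity>\<alpha>. cmod (zpow z \<alpha>) * norm (hc l D f \<alpha>)) \<le> kap l z * nrm (HI l) f"
proof -
  have 1: "(\<lambda>\<alpha>. (sqrt (rr l \<alpha>) * cmod (zpow z \<alpha>))\<^sup>2) summable_on UNIV"
    using rr_zpow_sq_summable[OF z, of l] by (simp add: power_mult_distrib)
  have 2: "(\<lambda>\<alpha>. (norm (hc l D f \<alpha>) / sqrt (rr l \<alpha>))\<^sup>2) summable_on UNIV"
    using hc_summable[OF f] by (simp add: power_divide)
  have eq: "\<bar>sqrt (rr l \<alpha>) * cmod (zpow z \<alpha>) * (norm (hc l D f \<alpha>) / sqrt (rr l \<alpha>))\<bar> = cmod (zpow z \<alpha>) * norm (hc l D f \<alpha>)" for \<alpha>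
    using hc_zero[of l \<alpha> f] by (cases "rr l \<alpha> = 0") (simp_all add: abs_mult)
  show "(\<lambda>\<alpha>. cmod (zpow z \<alpha>) * norm (hc l D f \<alpha>)) summable_on UNIV"
    using summable_mult_of_squares[OF 1 2] by (simp only: eq)
  show "(\<Sum>\<^sub>\<infinity>\<alpha>. cmod (zpow z \<alpha>) * norm (hc l D f \<alpha>)) \<le> kap l z * nrm (HI l) f"
    using Cauchy_Schwarz_infsum[OF 1 2, unfolded eq]
    by (simp add: power_mult_distrib power_divide kap_def nrm_def hip_hc_self[OF f])
qed

lemma HS_eval_bound:
  assumes f: "f \<in> HS l" and z: "z \<in> Bn"
  shows "norm (f z) \<le> kap l z * nrm (HI l) f"
proof -
  have "norm (f z) = norm (\<Sum>\<^sub>\<infinity>\<alpha>. cscale (zpow z \<alpha>) (hc l D f \<alpha>))"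
    using infsumI[OF hc_has_sum[OF f z]] by simp
  also have "\<dots> \<le> (\<Sum>\<^sub>\<infinity>\<alpha>. cmod (zpow z \<alpha>) * norm (hc l D f \<alpha>))"
    using norm_infsum_bound[of "\<lambda>\<alpha>. cscale (zpow z \<alpha>) (hc l D f \<alpha>)" UNIV] hc_abs(1)[OF f z] by simp
  also have "\<dots> \<le> kap l z * nrm (HI l) f" by (rule hc_abs(2)[OF f z])
  finally show ?thesis .
qed

end

section \<open>The operators attached to a hypercontraction\<close>

lemma up_induct [case_names zero up]:
  assumes "P 0" "\<And>i \<alpha>. P \<alpha> \<Longrightarrow> P (up i \<alpha>)"
  shows "P (\<alpha> :: 'n::finite \<Rightarrow> nat)"
proof (induction "sum \<alpha> UNIV" arbitrary: \<alpha>)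
  case 0
  then have "\<alpha> = 0" by (auto simp: fun_eq_iff)
  then show ?case using assms(1) by (simp only:)
next
  case (Suc k)
  then obtain i where i: "0 < \<alpha> i" by (metis gr0I nat.distinct(1) sum.neutral)
  then have "P (dn i \<alpha>)" using Suc sum_dn[of \<alpha> i] by simp
  then show ?case using assms(2)[of "dn i \<alpha>" i] up_dn[of \<alpha> i] i by simp
qed

lemma enum_n_props: "distinct (enum_n :: 'n::finite list)" "set (enum_n :: 'n list) = UNIV"
proof -
  have "\<exists>xs :: 'n list. distinct xs \<and> set xs = UNIV"
    using finite_distinct_list[of "UNIV :: 'n set"] by auto
  then have "distinct (enum_n :: 'n list) \<and> set (enum_n :: 'n list) = UNIV"
    unfolding enum_n_def by (rule someI_ex)
  then show "distinct (enum_n :: 'n list)" "set (enum_n :: 'n list) = UNIV" by auto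
qed

lemma cblin_comp: "cblin A \<Longrightarrow> cblin B \<Longrightarrow> cblin (A \<circ> B)"
  by (auto simp: cblin_def comp_def intro: bounded_linear_compose)

lemma cblin_id: "cblin id"
  by (simp add: cblin_def id_def bounded_linear_ident)

lemma commute_pow: "A \<circ> B = B \<circ> A \<Longrightarrow> A \<circ> (B ^^ k) = (B ^^ k) \<circ> A"
  by (induction k) (simp_all add: fun_eq_iff)

locale hyper =
  fixes T :: "'n::finite \<Rightarrow> 'h::chilbert \<Rightarrow> 'h"
    and m :: nat
    and U :: "'h \<Rightarrow> ('n \<Rightarrow> complex) \<Rightarrow> 'h"
  assumes bl: "\<And>i. cblin (T i)"
    and comm: "\<And>i k. T i \<circ> T k = T k \<circ> T i"
    and hc: "hypercontraction T m"
    and pu: "pure T"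
    and U: "is_U T m U"
begin

abbreviation Ts where "Ts \<equiv> Tst T"

lemma m1: "m \<ge> 1"
  using hc by (simp add: hypercontraction_def)

lemma T_add: "T i (x + y) = T i x + T i y"
  by (rule cblin_add[OF bl])

lemma T_sc: "T i (cscale c x) = cscale c (T i x)"
  by (rule cblin_cscale[OF bl])

lemma Ts_adj: "cinner (T i x) y = cinner x (Ts i y)"
  unfolding Tst_def by (rule adj_cinner[OF cblin_bounded[OF bl] T_sc])

lemma Ts_adj': "cinner (Ts i x) y = cinner x (T i y)"
  using Ts_adj[of i y x] cinner_commute by metis

lemma Ts_add: "Ts i (x + y) = Ts i x + Ts i y"
  by (rule adjoint_add[OF Ts_adj])

lemma Ts_sc: "Ts i (cscale c x) = cscale c (Ts i x)"
  by (rule adjoint_cscale[OF Ts_adj])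

lemma Ts_bl: "bounded_linear (Ts i)"
  by (rule adjoint_bounded[OF Ts_adj cblin_bounded[OF bl]])

lemma T_bl: "bounded_linear (T i)"
  by (rule cblin_bounded[OF bl])

subsection \<open>Multi-index powers\<close>

lemma fold_comm: "T k \<circ> fold (\<lambda>i F. (T i ^^ \<alpha> i) \<circ> F) xs F = fold (\<lambda>i F. (T i ^^ \<alpha> i) \<circ> F) xs (T k \<circ> F)"
proof (induction xs arbitrary: F)
  case (Cons a xs)
  have "T k \<circ> ((T a ^^ \<alpha> a) \<circ> F) = (T a ^^ \<alpha> a) \<circ> (T k \<circ> F)"
    using commute_pow[OF comm[of k a], of "\<alpha> a"] by (metis comp_assoc)
  then show ?case using Cons.IH[of "(T a ^^ \<alpha> a) \<circ> F"] by (simp only: fold_simps)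
qed simp

text \<open>The product is formed along an arbitrary enumeration of the indices. Raising one
  exponent changes a single factor, and commutativity moves the additional \<open>T k\<close> to the
  front.\<close>

lemma fold_up:
  fixes F :: "'c \<Rightarrow> 'h"
  shows "distinct xs \<Longrightarrow> fold (\<lambda>i F. (T i ^^ up k \<alpha> i) \<circ> F) xs F =
     (if k \<in> set xs then T k \<circ> fold (\<lambda>i F. (T i ^^ \<alpha> i) \<circ> F) xs F else fold (\<lambda>i F. (T i ^^ \<alpha> i) \<circ> F) xs F)"
proof (induction xs arbitrary: F)
  case (Cons a xs)
  show ?case
  proof (cases "a = k")
    case True
    then have *: "(T a ^^ up k \<alpha> a) \<circ> F = T k \<circ> ((T a ^^ \<alpha> a) \<circ> F)" by (simp add: up_def comp_assoc)
    have "fold (\<lambda>i F. (T i ^^ up k \<alpha> i) \<circ> F) xs G = fold (\<lambda>i F. (T i ^^ \<alpha> i) \<circ> F) xs G"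
      for G :: "'c \<Rightarrow> 'h"
    proof -
      have "distinct xs" "k \<notin> set xs" using Cons.prems True by auto
      then show ?thesis using Cons.IH[of G] by (simp only: if_False)
    qed
    with * show ?thesis using True by (simp only: fold_simps fold_comm list.set insert_iff simp_thms if_True)
  next
    case False
    then have *: "(T a ^^ up k \<alpha> a) \<circ> F = (T a ^^ \<alpha> a) \<circ> F" by (simp add: up_def)
    have "k \<in> set (a # xs) \<longleftrightarrow> k \<in> set xs" "distinct xs" using False Cons.prems by auto
    then show ?thesis using Cons.IH[of "(T a ^^ \<alpha> a) \<circ> F"] by (simp only: fold_simps *)
  qed
qed simp

lemma opprod_up: "opprod T (up i \<alpha>) = T i \<circ> opprod T \<alpha>"
  unfolding opprod_def using fold_up[OF enum_n_props(1), of i \<alpha> id] by (simp add: enum_n_props)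

lemma opprod_0: "opprod T 0 = id"
proof -
  have "fold (\<lambda>i F. (T i ^^ (0::'n \<Rightarrow> nat) i) \<circ> F) xs F = F" for xs F by (induction xs) simp_all
  then show ?thesis by (simp add: opprod_def)
qed

lemma opprod_cblin: "cblin (opprod T \<alpha>)"
  by (induction \<alpha> rule: up_induct) (simp_all only: opprod_0 opprod_up cblin_id cblin_comp bl)

lemma opprod_comm: "opprod T \<alpha> \<circ> T i = T i \<circ> opprod T \<alpha>"
proof (induction \<alpha> rule: up_induct)
  case (up k \<alpha>)
  then show ?case unfolding opprod_up using comm[of i k] by (metis comp_assoc)
qed (simp add: opprod_0 comp_def flip: zero_fun_def)

lemma Tsa_adj: "cinner (opprod T \<alpha> x) y = cinner x (Tsa T \<alpha> y)"
  unfolding Tsa_def by (rule adj_cinner[OF cblin_bounded[OF opprod_cblin] cblin_cscale[OF opprod_cblin]])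

lemma Tsa_add: "Tsa T \<alpha> (x + y) = Tsa T \<alpha> x + Tsa T \<alpha> y"
  by (rule adjoint_add[OF Tsa_adj])

lemma Tsa_sc: "Tsa T \<alpha> (cscale c x) = cscale c (Tsa T \<alpha> x)"
  by (rule adjoint_cscale[OF Tsa_adj])

lemma Tsa_0 [simp]: "Tsa T 0 x = x"
  by (rule cinner_ext) (simp add: Tsa_adj[symmetric] opprod_0)

lemma Tsa_up: "Tsa T (up i \<alpha>) x = Tsa T \<alpha> (Ts i x)"
  by (rule cinner_ext) (simp add: Tsa_adj[symmetric] opprod_up Ts_adj)

lemma Tsa_up': "Tsa T (up i \<alpha>) x = Ts i (Tsa T \<alpha> x)"
  by (rule cinner_ext) (simp add: Tsa_adj[symmetric] Ts_adj[symmetric] opprod_up opprod_comm[symmetric, THEN fun_cong, simplified])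

subsection \<open>Defect operators\<close>

lemma sigma_inner: "cinner (sigmaT T X x) x = (\<Sum>i\<in>UNIV. cinner (X (Ts i x)) (Ts i x))"
  by (simp add: sigmaT_def cinner_sum_left Ts_adj)

lemma DeltaT_1: "DeltaT T 1 x = x - (\<Sum>i\<in>UNIV. T i (Ts i x))"
  by (simp add: DeltaT_def sigmaT_def)

lemma row_sq: "Re (cinner (x - (\<Sum>i\<in>UNIV. T i (Ts i x))) x) = (norm x)\<^sup>2 - (\<Sum>i\<in>UNIV. (norm (Ts i x))\<^sup>2)"
  by (simp add: cinner_simps cinner_sum_left Ts_adj cinner_self)

lemma row_contraction: "(\<Sum>i\<in>UNIV. (norm (Ts i x))\<^sup>2) \<le> (norm x)\<^sup>2"
proof -
  have "0 \<le> Re (cinner (DeltaT T 1 x) x)" using hc unfolding hypercontraction_def posop_def by blast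
  then show ?thesis unfolding DeltaT_1 row_sq by simp
qed

lemma Ts_contr: "norm (Ts i x) \<le> norm x"
proof -
  have "(norm (Ts i x))\<^sup>2 \<le> (\<Sum>i\<in>UNIV. (norm (Ts i x))\<^sup>2)" by (rule member_le_sum) auto
  then show ?thesis using row_contraction[of x] by (simp add: power2_le_imp_le)
qed

lemma Tsa_contr: "norm (Tsa T \<alpha> x) \<le> norm x"
  by (induction \<alpha> rule: up_induct) (auto simp: Tsa_up' simp flip: zero_fun_def intro: order_trans[OF Ts_contr])

lemma DeltaT_Suc: "DeltaT T (Suc k) x = DeltaT T k x - (\<Sum>i\<in>UNIV. T i (DeltaT T k (Ts i x)))"
  by (simp add: DeltaT_def sigmaT_def)

lemma DeltaT_add: "DeltaT T k (x + y) = DeltaT T k x + DeltaT T k y"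
proof (induction k arbitrary: x y)
  case 0
  then show ?case by (simp add: DeltaT_def)
next
  case (Suc k)
  show ?case by (simp add: DeltaT_Suc Suc T_add Ts_add sum.distrib)
qed

lemma DeltaT_sc: "DeltaT T k (cscale c x) = cscale c (DeltaT T k x)"
proof (induction k arbitrary: x)
  case 0
  then show ?case by (simp add: DeltaT_def)
next
  case (Suc k)
  show ?case by (simp add: DeltaT_Suc Suc T_sc Ts_sc cscale_diff_right cscale_sum_right)
qed

lemma DeltaT_bl: "bounded_linear (DeltaT T k)"
proof (induction k)
  case 0
  then show ?case by (simp add: DeltaT_def id_def bounded_linear_ident)
next
  case (Suc k)
  have "bounded_linear (\<lambda>x. DeltaT T k x - (\<Sum>i\<in>UNIV. T i (DeltaT T k (Ts i x))))"
    by (intro bounded_linear_sub bounded_linear_sum Suc bounded_linear_compose[OF T_bl]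
        bounded_linear_compose[OF Suc Ts_bl])
  then show ?case by (simp add: DeltaT_Suc[abs_def])
qed

abbreviation C where "C \<equiv> Cop T m"

lemma Delta_norm: "\<exists>K. \<forall>x. norm (DeltaT T m x) \<le> K * norm x"
  using bounded_linear.bounded[OF DeltaT_bl] by (metis mult.commute)

lemma C_facts: "\<And>x y. C (x + y) = C x + C y" "\<And>c x. C (cscale c x) = cscale c (C x)" "bounded_linear C"
proof -
  obtain K where K: "\<And>x. norm (DeltaT T m x) \<le> K * norm x" using Delta_norm by blast
  have pos: "posop cinner UNIV (DeltaT T m)" using hc by (simp add: hypercontraction_def)
  note P = psqrt_props[OF DeltaT_add DeltaT_sc pos K, folded Cop_def]
  show "\<And>x y. C (x + y) = C x + C y" "\<And>c x. C (cscale c x) = cscale c (C x)" using P by auto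
  from P(4) obtain k where "\<And>x. norm (C x) \<le> k * norm x" by blast
  with P(1,2) show "bounded_linear C" by (rule bounded_linear_cscaleI)
qed

definition KC where "KC = (SOME K. K \<ge> 0 \<and> (\<forall>x. norm (C x) \<le> K * norm x))"

lemma KC: "KC \<ge> 0" "norm (C x) \<le> KC * norm x"
proof -
  have "\<exists>K. K \<ge> 0 \<and> (\<forall>x. norm (C x) \<le> K * norm x)"
    using bounded_linear.nonneg_bounded[OF C_facts(3)] by (metis mult.commute)
  then have "KC \<ge> 0 \<and> (\<forall>x. norm (C x) \<le> KC * norm x)"
    unfolding KC_def by (rule someI_ex)
  then show "KC \<ge> 0" "norm (C x) \<le> KC * norm x" by auto
qed

text \<open>\<open>H\<^sup>n\<close> is taken as the type \<open>'h ^ 'n\<close>, which, unlike the function type, is an instance of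
  \<open>chilbert\<close>; \<open>Dv\<close> is \<open>D\<^sub>T\<close> transported to it.\<close>

definition Tv :: "'h ^ 'n \<Rightarrow> 'h" where "Tv v = (\<Sum>i\<in>UNIV. T i (v $ i))"
definition Tvs :: "'h \<Rightarrow> 'h ^ 'n" where "Tvs x = (\<chi> i. Ts i x)"
definition Dv :: "'h ^ 'n \<Rightarrow> 'h ^ 'n" where "Dv v = vec_lambda (DT T (vec_nth v))"
abbreviation Ds where "Ds \<equiv> DTs T"

lemma Tvs_adj: "cinner (Tvs x) v = cinner x (Tv v)"
  by (simp add: Tv_def Tvs_def cinner_vec_def cinner_sum_right Ts_adj')

lemma Tv_adj: "cinner (Tv v) x = cinner v (Tvs x)"
  using Tvs_adj[of x v] cinner_commute by metis

lemma Tvs_norm_sq: "(norm (Tvs x))\<^sup>2 = (\<Sum>i\<in>UNIV. (norm (Ts i x))\<^sup>2)"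
  by (simp add: norm_vec_sq Tvs_def)

lemma Tvs_contr: "norm (Tvs x) \<le> norm x"
  using row_contraction[of x] Tvs_norm_sq[of x] by (simp add: power2_le_imp_le)

lemma Tv_contr: "norm (Tv v) \<le> norm v"
  using adjoint_norm_le[OF Tvs_adj, of 1] Tvs_contr by simp

lemma Tv_add: "Tv (v + w) = Tv v + Tv w"
  by (rule adjoint_add[OF Tvs_adj])

lemma Tv_sc: "Tv (cscale c v) = cscale c (Tv v)"
  by (rule adjoint_cscale[OF Tvs_adj])

lemma Tvs_add: "Tvs (v + w) = Tvs v + Tvs w"
  by (rule adjoint_add[OF Tv_adj])

lemma Tvs_sc: "Tvs (cscale c v) = cscale c (Tvs v)"
  by (rule adjoint_cscale[OF Tv_adj])

lemma Tv_bl: "bounded_linear Tv"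
  by (rule bounded_linear_cscaleI[where K = 1]) (simp_all add: Tv_add Tv_sc Tv_contr)

sublocale B1: positive_contraction "\<lambda>v. Tvs (Tv v)"
  by standard (auto simp: Tv_add Tvs_add Tv_sc Tvs_sc posop_def Tvs_adj cinner_self
      intro: order_trans[OF Tvs_contr Tv_contr])

sublocale B2: positive_contraction "\<lambda>x. Tv (Tvs x)"
  by standard (auto simp: Tv_add Tvs_add Tv_sc Tvs_sc posop_def Tv_adj cinner_self
      intro: order_trans[OF Tv_contr Tvs_contr])

text \<open>Uniqueness identifies the chosen root with the series, so that selfadjointness and
  intertwining can be read off from the series.\<close>

lemma Ds_eq: "Ds x = x - sqrt_series (\<lambda>x. Tv (Tvs x)) x"
proof -
  have Ds: "Ds = psqrt cinner UNIV (\<lambda>x. x - Tv (Tvs x))" by (simp add: DTs_def Tv_def Tvs_def)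
  have pos: "posop cinner UNIV (\<lambda>x. x - Tv (Tvs x))"
    using Tvs_contr by (simp add: posop_def cinner_simps Tv_adj cinner_self power_mono)
  have nb: "norm (x - Tv (Tvs x)) \<le> 2 * norm x" for x
    using norm_triangle_ineq4[of x "Tv (Tvs x)"] B2.contr[of x] by simp
  note P = psqrt_props[OF _ _ pos nb, folded Ds]
  have a: "x + y - Tv (Tvs (x + y)) = x - Tv (Tvs x) + (y - Tv (Tvs y))" for x y
    by (simp add: B2.add)
  have s: "cscale c x - Tv (Tvs (cscale c x)) = cscale c (x - Tv (Tvs x))" for c x
    by (simp add: B2.sc cscale_diff_right)
  obtain K where K: "\<And>x. norm (Ds x) \<le> K * norm x" using P(4)[OF a s] by blast
  show ?thesis
    by (rule B2.sqrt_unique[OF P(1)[OF a s] P(2)[OF a s] P(3)[OF a s] K P(5)[OF a s]])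
qed

lemma Dv_eq: "Dv v = v - sqrt_series (\<lambda>v. Tvs (Tv v)) v"
proof -
  have A: "(\<lambda>x. x - (\<lambda>i. Ts i (\<Sum>j\<in>UNIV. T j (x j)))) = (\<lambda>x. vec_nth (vec_lambda x - Tvs (Tv (vec_lambda x))))"
    by (auto simp: fun_eq_iff Tv_def Tvs_def)
  have Dv: "Dv = (\<lambda>v. vec_lambda (psqrt ipn UNIV (\<lambda>x. vec_nth (vec_lambda x - Tvs (Tv (vec_lambda x)))) (vec_nth v)))"
    unfolding Dv_def DT_def A ..
  have pos: "posop cinner UNIV (\<lambda>x. x - Tvs (Tv x))"
    using Tv_contr by (simp add: posop_def cinner_simps Tvs_adj cinner_self power_mono)
  have nb: "norm (x - Tvs (Tv x)) \<le> 2 * norm x" for x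
    using norm_triangle_ineq4[of x "Tvs (Tv x)"] B1.contr[of x] by simp
  note P = psqrt_ipn_props[OF _ _ pos nb]
  have a: "x + y - Tvs (Tv (x + y)) = x - Tvs (Tv x) + (y - Tvs (Tv y))" for x y
    by (simp add: B1.add)
  have s: "cscale c x - Tvs (Tv (cscale c x)) = cscale c (x - Tvs (Tv x))" for c x
    by (simp add: B1.sc cscale_diff_right)
  obtain K where K: "\<And>x. norm (Dv x) \<le> K * norm x" using P(4)[OF a s] unfolding Dv by blast
  show ?thesis unfolding Dv
    by (rule B1.sqrt_unique[OF P(1)[OF a s] P(2)[OF a s] P(3)[OF a s] K[unfolded Dv] P(5)[OF a s]])
qed

lemma Ds_add: "Ds (x + y) = Ds x + Ds y"
  by (simp add: Ds_eq B2.series_add)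

lemma Ds_sc: "Ds (cscale c x) = cscale c (Ds x)"
  by (simp add: Ds_eq B2.series_scale cscale_diff_right)

lemma Dv_add: "Dv (x + y) = Dv x + Dv y"
  by (simp add: Dv_eq B1.series_add)

lemma Dv_sc: "Dv (cscale c x) = cscale c (Dv x)"
  by (simp add: Dv_eq B1.series_scale cscale_diff_right)

lemma Ds_selfadj: "cinner (Ds x) y = cinner x (Ds y)"
  by (rule posop_selfadjoint[OF Ds_add Ds_sc]) (simp add: Ds_eq[abs_def] B2.series_posop)

lemma Dv_selfadj: "cinner (Dv x) y = cinner x (Dv y)"
  by (rule posop_selfadjoint[OF Dv_add Dv_sc]) (simp add: Dv_eq[abs_def] B1.series_posop)

lemma Ds_sq: "Ds (Ds x) = x - Tv (Tvs x)"
  using B2.sqrt_square[of x] by (simp add: Ds_eq)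

lemma Dv_sq: "Dv (Dv x) = x - Tvs (Tv x)"
  using B1.sqrt_square[of x] by (simp add: Dv_eq)

lemma Ds_norm_sq: "(norm (Ds x))\<^sup>2 = (norm x)\<^sup>2 - (norm (Tvs x))\<^sup>2"
proof -
  have "cinner (Ds x) (Ds x) = cinner x x - cinner (Tvs x) (Tvs x)"
    by (simp add: Ds_selfadj Ds_sq cinner_simps Tvs_adj)
  then show ?thesis by (simp add: cinner_self complex_eq_iff)
qed

lemma Dv_norm_sq: "(norm (Dv x))\<^sup>2 = (norm x)\<^sup>2 - (norm (Tv x))\<^sup>2"
proof -
  have "cinner (Dv x) (Dv x) = cinner x x - cinner (Tv x) (Tv x)"
    by (simp add: Dv_selfadj Dv_sq cinner_simps Tv_adj)
  then show ?thesis by (simp add: cinner_self complex_eq_iff)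
qed

lemma Dv_contr: "norm (Dv x) \<le> norm x"
  using Dv_norm_sq[of x] by (simp add: power2_le_imp_le)

lemma Dv_bl: "bounded_linear Dv"
  by (rule bounded_linear_cscaleI[where K = 1]) (simp_all add: Dv_add Dv_sc Dv_contr)

lemma Tv_Dv: "Tv (Dv v) = Ds (Tv v)"
proof -
  interpret L: bounded_linear Tv by (rule Tv_bl)
  show ?thesis
    using B1.series_intertwine[OF Tv_bl B2.positive_contraction_axioms, of v]
    by (simp add: Dv_eq Ds_eq L.diff)
qed

lemma Dv_Tvs: "Dv (Tvs x) = Tvs (Ds x)"
  by (rule cinner_ext) (simp add: Dv_selfadj[symmetric] Tv_adj[symmetric] Tv_Dv Ds_selfadj)

lemma DT_vec: "DT T x = vec_nth (Dv (vec_lambda x))"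
  by (simp add: Dv_def vec_lambda_inverse)

end

text \<open>Continuity of addition is an explicit assumption because the lemma also serves the type
  \<open>'n \<Rightarrow> 'h\<close>, where closures refer to pointwise convergence. As the index
  set is finite, these are the norm closures in H^n.\<close>

lemma closure_add_mem:
  fixes S :: "'a::{topological_space, plus} set"
  assumes cont: "continuous_on UNIV (\<lambda>p::'a \<times> 'a. fst p + snd p)"
    and S: "\<And>x y. x \<in> S \<Longrightarrow> y \<in> S \<Longrightarrow> x + y \<in> S"
    and x: "x \<in> closure S" and y: "y \<in> closure S"
  shows "x + y \<in> closure S"
proof -
  have "(\<lambda>p. fst p + snd p) ` closure (S \<times> S) \<subseteq> closure S"
    by (rule image_closure_subset[OF continuous_on_subset[OF cont]]) (auto intro!: closure_subset[THEN subsetD] S)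
  moreover have "(x, y) \<in> closure (S \<times> S)" using x y by (simp add: closure_Times)
  ultimately show ?thesis by force
qed

lemma closure_image_mem:
  assumes "continuous_on UNIV f" "\<And>x. x \<in> S \<Longrightarrow> f x \<in> closure W" "x \<in> closure S"
  shows "f x \<in> closure W"
  using image_closure_subset[OF continuous_on_subset[OF assms(1)], of S "closure W"] assms(2,3) by auto

lemma polarization:
  assumes "ipspace ip1 S1" "ipspace ip2 S2"
    and x: "x \<in> S1" "y \<in> S1" and x': "x' \<in> S2" "y' \<in> S2"
    and eq: "\<And>k. ip1 (x + cscale k y) (x + cscale k y) = ip2 (x' + cscale k y') (x' + cscale k y')"
      "ip1 y y = ip2 y' y'"
  shows "ip1 x y = ip2 x' y'"
proof -
  interpret A: ipspace ip1 S1 by fact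
  interpret B: ipspace ip2 S2 by fact
  have e0: "ip1 x x = ip2 x' x'" using eq(1)[of 0] by simp
  have re: "Re (cnj k * ip1 x y) = Re (cnj k * ip2 x' y')" for k
  proof -
    have "Re (ip1 (x + cscale k y) (x + cscale k y)) = Re (ip1 x x) + (cmod k)\<^sup>2 * Re (ip1 y y) + 2 * Re (cnj k * ip1 x y)"
      using A.nm_add_sq[of x "cscale k y"] x
      by (simp add: A.nm_scale A.scale_closed A.add_closed A.ip_scale_right power_mult_distrib A.nm_sq)
    moreover have "Re (ip2 (x' + cscale k y') (x' + cscale k y')) = Re (ip2 x' x') + (cmod k)\<^sup>2 * Re (ip2 y' y') + 2 * Re (cnj k * ip2 x' y')"
      using B.nm_add_sq[of x' "cscale k y'"] x'
      by (simp add: B.nm_scale B.scale_closed B.add_closed B.ip_scale_right power_mult_distrib B.nm_sq)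
    ultimately show ?thesis using eq(1)[of k] eq(2) e0 by simp
  qed
  show ?thesis using re[of 1] re[of \<i>] by (simp add: complex_eq_iff)
qed

context hyper
begin

subsection \<open>The defect spaces\<close>

lemma closure_range_subspace:
  fixes A :: "'b::chilbert \<Rightarrow> 'a::chilbert"
  assumes add: "\<And>x y. A (x + y) = A x + A y" and sc: "\<And>c x. A (cscale c x) = cscale c (A x)"
  shows "0 \<in> closure (range A)"
    "\<And>x y. x \<in> closure (range A) \<Longrightarrow> y \<in> closure (range A) \<Longrightarrow> x + y \<in> closure (range A)"
    "\<And>c x. x \<in> closure (range A) \<Longrightarrow> cscale c x \<in> closure (range A)"
proof -
  have "A 0 = 0" using sc[of 0 0] by simp
  then show "0 \<in> closure (range A)" using closure_subset[of "range A"] by (metis rangeI subsetD)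
  show "x + y \<in> closure (range A)" if "x \<in> closure (range A)" "y \<in> closure (range A)" for x y
    by (rule closure_add_mem[OF _ _ that]) (auto intro!: continuous_intros simp flip: add)
  show "cscale c x \<in> closure (range A)" if "x \<in> closure (range A)" for c x
  proof (rule closure_image_mem[OF _ _ that])
    show "continuous_on UNIV (\<lambda>x::'a. cscale c x)"
      by (rule linear_continuous_on[OF bounded_linear_cscale_right])
    show "cscale c x \<in> closure (range A)" if "x \<in> range A" for x
      using that closure_subset[of "range A"] by (auto simp flip: sc)
  qed
qed

abbreviation D where "D \<equiv> Dsp T m"
abbreviation DS where "DS \<equiv> DTs_sp T"
abbreviation DV where "DV \<equiv> DT_sp T"

sublocale S: csub D "TYPE('n)"
  using closure_range_subspace[OF C_facts(1,2)] by unfold_locales (auto simp: Dsp_def)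

lemma C_mem: "C x \<in> D"
  using closure_subset[of "range C"] by (auto simp: Dsp_def)

lemma D_scaleR: "x \<in> D \<Longrightarrow> r *\<^sub>R x \<in> D"
  by (simp add: scaleR_cscale S.Dsc)

lemma DS_0: "0 \<in> DS" and DS_add: "x \<in> DS \<Longrightarrow> y \<in> DS \<Longrightarrow> x + y \<in> DS"
  and DS_sc: "x \<in> DS \<Longrightarrow> cscale c x \<in> DS" and DS_closed: "closed DS"
  using closure_range_subspace[OF Ds_add Ds_sc] by (auto simp: DTs_sp_def)

lemma DS_mem: "Ds x \<in> DS"
  using closure_subset[of "range Ds"] by (auto simp: DTs_sp_def)

lemma DV_mem: "DT T x \<in> DV"
  using closure_subset[of "range (DT T)"] by (auto simp: DT_sp_def)

lemma DT_add: "DT T (x + y) = DT T x + DT T y"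
proof -
  have "vec_lambda (x + y) = (vec_lambda x + vec_lambda y :: 'h ^ 'n)" by (simp add: vec_eq_iff)
  then show ?thesis by (simp only: DT_vec Dv_add) (simp add: fun_eq_iff)
qed

lemma DT_sc: "DT T (cscale c x) = cscale c (DT T x)"
proof -
  have "vec_lambda (cscale c x) = (cscale c (vec_lambda x) :: 'h ^ 'n)"
    by (simp add: vec_eq_iff cscale_vec_def cscale_fun_def)
  then show ?thesis by (simp only: DT_vec Dv_sc) (simp add: fun_eq_iff cscale_vec_def cscale_fun_def)
qed

lemma coord_cont: "continuous_on UNIV (\<lambda>x::'n \<Rightarrow> 'h. x i)"
  by (rule continuous_on_product_coordinates)

lemma DV_add: "x \<in> DV \<Longrightarrow> y \<in> DV \<Longrightarrow> x + y \<in> DV"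
  unfolding DT_sp_def
proof (rule closure_add_mem)
  show "continuous_on UNIV (\<lambda>p::('n \<Rightarrow> 'h) \<times> ('n \<Rightarrow> 'h). fst p + snd p)"
  proof (rule continuous_on_coordinatewise_then_product)
    fix i
    have "continuous_on UNIV (\<lambda>p::('n \<Rightarrow> 'h) \<times> ('n \<Rightarrow> 'h). fst p i)"
      by (rule continuous_on_compose2[OF coord_cont]) (auto intro: continuous_intros)
    moreover have "continuous_on UNIV (\<lambda>p::('n \<Rightarrow> 'h) \<times> ('n \<Rightarrow> 'h). snd p i)"
      by (rule continuous_on_compose2[OF coord_cont]) (auto intro: continuous_intros)
    ultimately show "continuous_on UNIV (\<lambda>p::('n \<Rightarrow> 'h) \<times> ('n \<Rightarrow> 'h). (fst p + snd p) i)"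
      by (simp add: continuous_on_add)
  qed
qed (auto simp flip: DT_add)

lemma DV_sc: "x \<in> DV \<Longrightarrow> cscale c x \<in> DV"
  unfolding DT_sp_def
proof (rule closure_image_mem[where f = "cscale c"])
  show "continuous_on UNIV (cscale c :: ('n \<Rightarrow> 'h) \<Rightarrow> _)"
  proof (rule continuous_on_coordinatewise_then_product)
    show "continuous_on UNIV (\<lambda>x::'n \<Rightarrow> 'h. cscale c x i)" for i
      unfolding cscale_fun_def
      by (rule continuous_on_compose2[OF linear_continuous_on[OF bounded_linear_cscale_right] coord_cont]) auto
  qed
  show "cscale c u \<in> closure (range (DT T))" if "u \<in> range (DT T)" for u
    using that closure_subset[of "range (DT T)"] by (auto simp flip: DT_sc)
qed

lemma DV_0: "0 \<in> DV"
  using DV_sc[OF DV_mem, of 0 0] by simp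

lemma Tf_Tv: "(\<Sum>i\<in>UNIV. T i (x i)) = Tv (vec_lambda x)"
  by (simp add: Tv_def)

lemma Tv_mem: "x \<in> DV \<Longrightarrow> Tv (vec_lambda x) \<in> DS"
  unfolding DT_sp_def DTs_sp_def
proof (rule closure_image_mem[where f = "\<lambda>x. Tv (vec_lambda x)"])
  show "continuous_on UNIV (\<lambda>x. Tv (vec_lambda x))"
    unfolding Tf_Tv[symmetric]
    by (intro continuous_on_sum continuous_on_compose2[OF linear_continuous_on[OF T_bl] coord_cont]) auto
  show "Tv (vec_lambda u) \<in> closure (range Ds)" if "u \<in> range (DT T)" for u
    using that DS_mem by (auto simp: DT_vec Tv_Dv DTs_sp_def)
qed

lemma Tvs_mem: "a \<in> DS \<Longrightarrow> vec_nth (Tvs a) \<in> DV"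
  unfolding DT_sp_def DTs_sp_def
proof (rule closure_image_mem[where f = "\<lambda>a. vec_nth (Tvs a)"])
  show "continuous_on UNIV (\<lambda>a. vec_nth (Tvs a))"
    by (rule continuous_on_coordinatewise_then_product) (simp add: Tvs_def linear_continuous_on[OF Ts_bl])
  show "vec_nth (Tvs u) \<in> closure (range (DT T))" if "u \<in> range Ds" for u
    using that DV_mem by (auto simp: Dv_Tvs[symmetric] DT_sp_def) (metis DT_vec vec_nth_inverse)
qed

subsection \<open>The maps U and pi\<close>

definition mp where "mp = m - 1"

abbreviation H1 where "H1 \<equiv> S.HS (mp)"
abbreviation I1 where "I1 \<equiv> S.HI (mp)"

sublocale M1: ipspace I1 H1
  by (rule S.ipspace_HS)

sublocale Mm: ipspace "S.HI m" "S.HS m"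
  by (rule S.ipspace_HS)

lemma Hm1_eq: "Hm1 T m = H1" "hipm1 T m = I1"
  by (simp_all add: Hm1_def hipm1_def mp_def)

lemma U_mem: "y \<in> DS \<Longrightarrow> U y \<in> H1"
  using U by (auto simp: is_U_def linear_on_def Impi_cl_def ncl_def Hm1_eq)

lemma U_add: "x \<in> DS \<Longrightarrow> y \<in> DS \<Longrightarrow> U (x + y) = U x + U y"
  and U_sc: "x \<in> DS \<Longrightarrow> U (cscale c x) = cscale c (U x)"
  and U_self: "x \<in> DS \<Longrightarrow> I1 (U x) (U x) = cinner x x"
  and U_Ds: "U (Ds x) = pimap T m x"
  and U_range: "U ` DS = Impi_cl T m"
  using U by (auto simp: is_U_def linear_on_def Hm1_eq)

lemma U_ip: "x \<in> DS \<Longrightarrow> y \<in> DS \<Longrightarrow> I1 (U x) (U y) = cinner x y"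
  by (rule polarization[OF M1.ipspace_axioms H.ipspace_axioms])
     (auto simp: U_mem U_self DS_add DS_sc simp flip: U_sc U_add)

lemma U_norm: "y \<in> DS \<Longrightarrow> nrm I1 (U y) = norm y"
  by (simp add: nrm_def U_self norm_cinner)

text \<open>\<open>cf x\<close> multiplied by \<open>rho m\<close> and by \<open>rho (m - 1)\<close> gives the coefficients of \<open>j x\<close> and of \<open>\<pi> x\<close>.\<close>

definition cf :: "'h \<Rightarrow> ('n \<Rightarrow> nat) \<Rightarrow> 'h" where "cf x \<alpha> = C (Tsa T \<alpha> x)"

lemma cf_mem: "cf x \<alpha> \<in> D"
  by (simp add: cf_def C_mem)

lemma cf_up: "cf x (up i \<alpha>) = cf (Ts i x) \<alpha>"
  by (simp add: cf_def Tsa_up)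

lemma cf_add: "cf (x + y) \<alpha> = cf x \<alpha> + cf y \<alpha>"
  by (simp add: cf_def Tsa_add C_facts)

lemma cf_sc: "cf (cscale c x) \<alpha> = cscale c (cf x \<alpha>)"
  by (simp add: cf_def Tsa_sc C_facts)

lemma cf_bound: "norm (cf x \<alpha>) \<le> KC * norm x"
  unfolding cf_def using KC(2)[of "Tsa T \<alpha> x"] mult_left_mono[OF Tsa_contr[of \<alpha> x] KC(1)] by linarith

text \<open>That \<open>\<pi> x\<close> lies in H_(m-1) is part of the hypothesis on
  \<open>U\<close>; what remains is to recognise its coefficients, and for this the small ball
  suffices, where the bound on \<open>cf x\<close> gives absolute convergence. For
  \<open>m = 1\<close> only the constant term survives.\<close>

lemma pi_hc: "hc (mp) D (pimap T m x) = (\<lambda>\<alpha>. rr (mp) \<alpha> *\<^sub>R cf x \<alpha>)"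
proof (rule S.hc_eq)
  show "pimap T m x \<in> H1" using U_mem[OF DS_mem, of x] by (simp add: U_Ds)
  fix z :: "'n \<Rightarrow> complex" assume z: "(\<Sum>i\<in>UNIV. cmod (z i)) < 1"
  then have zB: "z \<in> Bn" by (rule l1_ball_Bn)
  show "((\<lambda>\<alpha>. cscale (zpow z \<alpha>) (rr (mp) \<alpha> *\<^sub>R cf x \<alpha>)) has_sum pimap T m x z) UNIV"
  proof (cases "m = 1")
    case True
    have mp0: "mp = 0" unfolding mp_def using True by simp
    have c0: "cf x 0 = C x" unfolding cf_def by (simp only: Tsa_0)
    have "(\<lambda>\<alpha>. cscale (zpow z \<alpha>) (rr (mp) \<alpha> *\<^sub>R cf x \<alpha>)) = (\<lambda>\<alpha>. if \<alpha> = 0 then C x else 0)"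
      using mp0 c0 by (intro ext) (auto simp: rr_def cscale_one)
    moreover have "pimap T m x z = C x" using True zB by (simp add: pimap_def)
    ultimately show ?thesis using S.has_sum_at_0[of "C x"] by (simp only:)
  next
    case False
    then have m2: "mp \<ge> 1" using m1 by (simp add: mp_def)
    have "(\<lambda>\<alpha>. norm (cscale (zpow z \<alpha>) (rr (mp) \<alpha> *\<^sub>R cf x \<alpha>))) summable_on UNIV"
    proof (rule Infinite_Sum.abs_summable_on_comparison_test')
      show "(\<lambda>\<alpha>. rr (mp) \<alpha> * cmod (zpow z \<alpha>) * (KC * norm x)) summable_on UNIV"
        by (intro summable_on_cmult_left rr_zpow_summable z)
      show "norm (cscale (zpow z \<alpha>) (rr (mp) \<alpha> *\<^sub>R cf x \<alpha>)) \<le> rr (mp) \<alpha> * cmod (zpow z \<alpha>) * (KC * norm x)" for \<alpha>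
        using mult_left_mono[OF cf_bound[of x \<alpha>], of "rr (mp) \<alpha> * cmod (zpow z \<alpha>)"]
        by (simp add: mult_ac)
    qed
    moreover have "pimap T m x z = infsum (\<lambda>\<alpha>. cscale (zpow z \<alpha>) (rr (mp) \<alpha> *\<^sub>R cf x \<alpha>)) UNIV"
      using False zB m2 by (simp add: pimap_def mp_def[symmetric, simplified] rr_pos cf_def scaleR_cscale cscale_cscale mult.commute)
    ultimately show ?thesis using abs_summable_summable by fastforce
  qed
qed simp

lemma sq_div_rr: "(norm (rr l \<alpha> *\<^sub>R v))\<^sup>2 / rr l \<alpha> = rr l \<alpha> * (norm v)\<^sup>2"
  by (simp add: power_mult_distrib power2_eq_square)

lemma pi_norm:
  shows "(\<lambda>\<alpha>. rr (mp) \<alpha> * (norm (cf x \<alpha>))\<^sup>2) summable_on UNIV"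
    and "(\<Sum>\<^sub>\<infinity>\<alpha>. rr (mp) \<alpha> * (norm (cf x \<alpha>))\<^sup>2) = (norm x)\<^sup>2 - (\<Sum>i\<in>UNIV. (norm (Ts i x))\<^sup>2)"
proof -
  have mem: "pimap T m x \<in> H1" using U_mem[OF DS_mem, of x] by (simp add: U_Ds)
  show "(\<lambda>\<alpha>. rr (mp) \<alpha> * (norm (cf x \<alpha>))\<^sup>2) summable_on UNIV"
    using S.hc_summable[OF mem] by (simp only: pi_hc sq_div_rr)
  have "of_real (\<Sum>\<^sub>\<infinity>\<alpha>. rr (mp) \<alpha> * (norm (cf x \<alpha>))\<^sup>2) = cinner (Ds x) (Ds x)"
    using S.hip_hc_self[OF mem] U_self[OF DS_mem, of x] by (simp only: pi_hc sq_div_rr U_Ds)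
  then have "(\<Sum>\<^sub>\<infinity>\<alpha>. rr (mp) \<alpha> * (norm (cf x \<alpha>))\<^sup>2) = (norm (Ds x))\<^sup>2"
    unfolding cinner_self of_real_power[symmetric] of_real_eq_iff .
  then show "(\<Sum>\<^sub>\<infinity>\<alpha>. rr (mp) \<alpha> * (norm (cf x \<alpha>))\<^sup>2) = (norm x)\<^sup>2 - (\<Sum>i\<in>UNIV. (norm (Ts i x))\<^sup>2)"
    by (simp add: Ds_norm_sq Tvs_norm_sq)
qed

subsection \<open>The map j is an isometry\<close>

text \<open>Induction on the degree, before convergence is known. In the splitting, the part of
  weight \<open>rr mp\<close> is bounded by the norm of \<open>\<pi> x\<close>, that is, by the
  defect of \<open>x\<close> in the row contraction; the shifted parts are bounded by induction
  through the norms of \<open>T_i^* x\<close>, which make up for this defect.\<close>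

lemma Q_truncated: "(\<Sum>\<alpha> | sum \<alpha> UNIV \<le> N. rho m \<alpha> * (norm (cf x \<alpha>))\<^sup>2) \<le> (norm x)\<^sup>2"
proof (induction N arbitrary: x)
  case (Suc N)
  have eq: "{\<alpha> :: 'n \<Rightarrow> nat. sum \<alpha> UNIV < Suc N} = {\<alpha>. sum \<alpha> UNIV \<le> N}" by auto
  have "(\<Sum>\<alpha> | sum \<alpha> UNIV \<le> Suc N. rr (mp) \<alpha> * (norm (cf x \<alpha>))\<^sup>2) \<le> (norm x)\<^sup>2 - (\<Sum>i\<in>UNIV. (norm (Ts i x))\<^sup>2)"
    unfolding pi_norm(2)[symmetric] by (intro finite_sum_le_infsum pi_norm finite_degree_le) auto
  moreover have "(\<Sum>i\<in>UNIV. \<Sum>\<alpha> | sum \<alpha> UNIV < Suc N. rho m \<alpha> * (norm (cf x (up i \<alpha>)))\<^sup>2) \<le> (\<Sum>i\<in>UNIV. (norm (Ts i x))\<^sup>2)"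
    unfolding eq cf_up by (intro sum_mono Suc.IH)
  ultimately show ?case by (subst rho_split_truncated[OF m1, folded mp_def]) linarith
next
  case 0
  have "(\<Sum>\<alpha> | sum \<alpha> UNIV \<le> 0. rr (mp) \<alpha> * (norm (cf x \<alpha>))\<^sup>2) \<le> (norm x)\<^sup>2 - (\<Sum>i\<in>UNIV. (norm (Ts i x))\<^sup>2)"
    unfolding pi_norm(2)[symmetric] by (intro finite_sum_le_infsum pi_norm finite_degree_le) auto
  moreover have "0 \<le> (\<Sum>i\<in>UNIV. (norm (Ts i x))\<^sup>2)" by (simp add: sum_nonneg)
  ultimately show ?case by (subst rho_split_truncated[OF m1, folded mp_def]) simp
qed

text \<open>In terms of normalised coefficients, \<open>Qs\<close> is the squared norm of H_m and
  \<open>Ps\<close> below is that of H_(m-1).\<close>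

definition Qs :: "(('n \<Rightarrow> nat) \<Rightarrow> 'h) \<Rightarrow> real" where
  "Qs s = (\<Sum>\<^sub>\<infinity>\<alpha>. rho m \<alpha> * (norm (s \<alpha>))\<^sup>2)"

definition Ps :: "(('n \<Rightarrow> nat) \<Rightarrow> 'h) \<Rightarrow> real" where
  "Ps s = (\<Sum>\<^sub>\<infinity>\<alpha>. rr (mp) \<alpha> * (norm (s \<alpha>))\<^sup>2)"

definition ell :: "(('n \<Rightarrow> nat) \<Rightarrow> 'h) \<Rightarrow> bool" where
  "ell s \<longleftrightarrow> (\<forall>\<alpha>. s \<alpha> \<in> D) \<and> (\<lambda>\<alpha>. rho m \<alpha> * (norm (s \<alpha>))\<^sup>2) summable_on UNIV"

definition sh :: "'n \<Rightarrow> (('n \<Rightarrow> nat) \<Rightarrow> 'h) \<Rightarrow> ('n \<Rightarrow> nat) \<Rightarrow> 'h" where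
  "sh i s \<alpha> = s (up i \<alpha>)"

lemma Qs_nonneg [simp]: "0 \<le> Qs s"
  by (simp add: Qs_def infsum_nonneg)

lemma Ps_nonneg [simp]: "0 \<le> Ps s"
  by (simp add: Ps_def infsum_nonneg)

lemma ell_sh: "ell s \<Longrightarrow> ell (sh i s)"
  using rho_split(2)[OF m1, folded mp_def, of "\<lambda>\<alpha>. (norm (s \<alpha>))\<^sup>2" i] by (simp add: ell_def sh_def)

lemma Qs_split: "ell s \<Longrightarrow> Qs s = Ps s + (\<Sum>i\<in>UNIV. Qs (sh i s))"
  using rho_split(3)[OF m1, folded mp_def, of "\<lambda>\<alpha>. (norm (s \<alpha>))\<^sup>2"] by (simp add: ell_def sh_def Qs_def Ps_def)

lemma ell_Ps_summable: "ell s \<Longrightarrow> (\<lambda>\<alpha>. rr (mp) \<alpha> * (norm (s \<alpha>))\<^sup>2) summable_on UNIV"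
  using rho_split(1)[OF m1, folded mp_def, of "\<lambda>\<alpha>. (norm (s \<alpha>))\<^sup>2"] by (simp add: ell_def)

lemma ell_cf: "ell (cf x)"
  unfolding ell_def by (auto simp: cf_mem intro!: summable_by_degree[OF _ Q_truncated])

lemma sh_cf: "sh i (cf x) = cf (Ts i x)"
  by (simp add: sh_def cf_up fun_eq_iff)

lemma Qs_cf_le: "Qs (cf x) \<le> (norm x)\<^sup>2"
  unfolding Qs_def
proof (rule infsum_le_finite_sums)
  show "(\<lambda>\<alpha>. rho m \<alpha> * (norm (cf x \<alpha>))\<^sup>2) summable_on UNIV" using ell_cf by (simp add: ell_def)
  fix F :: "('n \<Rightarrow> nat) set" assume "finite F"
  then obtain N where "F \<subseteq> {\<alpha>. sum \<alpha> UNIV \<le> N}" using finite_subset_degree_le by blast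
  then have "(\<Sum>\<alpha>\<in>F. rho m \<alpha> * (norm (cf x \<alpha>))\<^sup>2) \<le> (\<Sum>\<alpha> | sum \<alpha> UNIV \<le> N. rho m \<alpha> * (norm (cf x \<alpha>))\<^sup>2)"
    by (intro sum_mono2 finite_degree_le) auto
  then show "(\<Sum>\<alpha>\<in>F. rho m \<alpha> * (norm (cf x \<alpha>))\<^sup>2) \<le> (norm x)\<^sup>2" using Q_truncated order_trans by blast
qed

definition Et :: "('h \<Rightarrow> real) \<Rightarrow> 'h \<Rightarrow> real" where
  "Et \<phi> x = (\<Sum>i\<in>UNIV. \<phi> (Ts i x))"

lemma Et_pow_mono: "(\<And>x. \<phi> x \<le> \<psi> x) \<Longrightarrow> (Et ^^ k) \<phi> x \<le> (Et ^^ k) \<psi> x"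
  by (induction k arbitrary: x) (auto simp: Et_def intro!: sum_mono)

text \<open>The iterates form the quadratic form of the powers of \<sigma>_T at the identity, so
  purity says that they tend to 0.\<close>

lemma Et_pow_norm: "(Et ^^ k) (\<lambda>x. (norm x)\<^sup>2) x = Re (cinner (((sigmaT T ^^ k) id) x) x)"
  by (induction k arbitrary: x) (simp_all add: cinner_self sigma_inner Et_def)

text \<open>The defect \<open>\<parallel>x\<parallel>\<^sup>2 - \<parallel>jx\<parallel>\<^sup>2\<close> is invariant under \<open>Et\<close>, so purity makes it vanish.\<close>

lemma Qs_cf: "Qs (cf x) = (norm x)\<^sup>2"
proof -
  define G where "G x = (norm x)\<^sup>2 - Qs (cf x)" for x
  have e: "Qs (cf x) = (norm x)\<^sup>2 - (\<Sum>i\<in>UNIV. (norm (Ts i x))\<^sup>2) + (\<Sum>i\<in>UNIV. Qs (cf (Ts i x)))" for x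
    using Qs_split[OF ell_cf, of x] by (simp add: Ps_def pi_norm sh_cf)
  have "G x = Et G x" for x
    unfolding G_def Et_def using e[of x] by (simp add: sum_subtractf)
  then have "Et G = G" by (simp add: fun_eq_iff)
  then have "(Et ^^ k) G = G" for k by (induction k) simp_all
  \<comment> \<open>Invariance alone gives no information; the bound of \<open>G\<close> by the
    squared norm is what transfers the decay of the iterates to \<open>G\<close>.\<close>
  then have "G x \<le> (Et ^^ k) (\<lambda>x. (norm x)\<^sup>2) x" for k
    using Et_pow_mono[of G "\<lambda>x. (norm x)\<^sup>2" k x] by (simp add: G_def)
  then have le: "G x \<le> Re (cinner (((sigmaT T ^^ k) id) x) x)" for k by (simp only: Et_pow_norm)
  have "(\<lambda>k. Re (cinner (((sigmaT T ^^ k) id) x) x)) \<longlonglongrightarrow> Re (cinner 0 x)"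
    using pu unfolding pure_def
    by (intro tendsto_Re bounded_linear.tendsto[OF bounded_linear_cinner_left]) blast
  then have "G x \<le> Re (cinner 0 x)" by (rule LIMSEQ_le_const) (use le in blast)
  then show ?thesis using Qs_cf_le[of x] by (simp add: G_def cinner_simps)
qed

lemma ell_mkf:
  assumes "ell s"
  shows "mkf (\<lambda>\<alpha>. rho m \<alpha> *\<^sub>R s \<alpha>) \<in> S.HS m"
    and "hc m D (mkf (\<lambda>\<alpha>. rho m \<alpha> *\<^sub>R s \<alpha>)) = (\<lambda>\<alpha>. rho m \<alpha> *\<^sub>R s \<alpha>)"
proof -
  have 1: "rho m \<alpha> *\<^sub>R s \<alpha> \<in> D" for \<alpha> using assms by (simp add: ell_def D_scaleR)
  have 2: "rr m \<alpha> = 0 \<Longrightarrow> rho m \<alpha> *\<^sub>R s \<alpha> = 0" for \<alpha> using m1 by (simp add: rr_pos)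
  have 3: "(\<lambda>\<alpha>. (norm (rho m \<alpha> *\<^sub>R s \<alpha>))\<^sup>2 / rr m \<alpha>) summable_on UNIV"
    using assms m1 by (simp add: ell_def rr_pos power_mult_distrib power2_eq_square mult_ac)
  show "mkf (\<lambda>\<alpha>. rho m \<alpha> *\<^sub>R s \<alpha>) \<in> S.HS m" by (rule S.mkf_hc(1)[OF 1 2 3])
  show "hc m D (mkf (\<lambda>\<alpha>. rho m \<alpha> *\<^sub>R s \<alpha>)) = (\<lambda>\<alpha>. rho m \<alpha> *\<^sub>R s \<alpha>)" by (rule S.mkf_hc(2)[OF 1 2 3])
qed

definition nc :: "(('n \<Rightarrow> complex) \<Rightarrow> 'h) \<Rightarrow> ('n \<Rightarrow> nat) \<Rightarrow> 'h" where
  "nc f \<alpha> = (1 / rho m \<alpha>) *\<^sub>R hc m D f \<alpha>"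

lemma hc_nc: "hc m D f \<alpha> = rho m \<alpha> *\<^sub>R nc f \<alpha>"
  by (simp add: nc_def)

lemma ell_nc: "f \<in> S.HS m \<Longrightarrow> ell (nc f)"
  using S.hc_summable[of f m] S.hc_mem[of f m] m1 D_scaleR
  by (simp add: ell_def nc_def rr_pos power_mult_distrib power2_eq_square)

lemma nc_mkf: "ell s \<Longrightarrow> nc (mkf (\<lambda>\<alpha>. rho m \<alpha> *\<^sub>R s \<alpha>)) = s"
  by (simp add: nc_def ell_mkf fun_eq_iff)

lemma HI_nc: "S.HI m f g = (\<Sum>\<^sub>\<infinity>\<alpha>. of_real (rho m \<alpha>) * cinner (nc f \<alpha>) (nc g \<alpha>))"
  using m1 by (simp add: S.hip_hc hc_nc rr_pos scaleR_cscale cinner_simps)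

lemma HI_self_nc: "f \<in> S.HS m \<Longrightarrow> S.HI m f f = of_real (Qs (nc f))"
  using m1
  by (simp add: S.hip_hc_self hc_nc rr_pos Qs_def power_mult_distrib power2_eq_square mult_ac)

lemma nrm_nc: "f \<in> S.HS m \<Longrightarrow> (nrm (S.HI m) f)\<^sup>2 = Qs (nc f)"
  by (simp add: nrm_def HI_self_nc)

lemma nc_add: "f \<in> S.HS m \<Longrightarrow> g \<in> S.HS m \<Longrightarrow> nc (f + g) \<alpha> = nc f \<alpha> + nc g \<alpha>"
  by (simp add: nc_def S.hc_add scaleR_add_right)

lemma nc_sc: "f \<in> S.HS m \<Longrightarrow> nc (cscale k f) \<alpha> = cscale k (nc f \<alpha>)"
  by (simp add: nc_def S.hc_scale scaleR_cscale_commute)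

lemma nc_eqI: "f \<in> S.HS m \<Longrightarrow> g \<in> S.HS m \<Longrightarrow> nc f = nc g \<Longrightarrow> f = g"
  by (rule S.HS_eq) (auto simp: fun_eq_iff hc_nc)

abbreviation J where "J \<equiv> jmap T m"

lemma J_mkf: "J x = mkf (\<lambda>\<alpha>. rho m \<alpha> *\<^sub>R cf x \<alpha>)"
  by (simp add: jmap_def mkf_def cf_def fun_eq_iff scaleR_cscale cscale_cscale mult.commute)

lemma J_mem: "J x \<in> S.HS m" and nc_J: "nc (J x) = cf x"
  unfolding J_mkf using ell_mkf(1)[OF ell_cf] nc_mkf[OF ell_cf] by auto

lemma J_add: "J (x + y) = J x + J y"
  by (rule nc_eqI) (auto simp: J_mem Mm.add_closed nc_J nc_add cf_add fun_eq_iff)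

lemma J_sc: "J (cscale c x) = cscale c (J x)"
  by (rule nc_eqI) (auto simp: J_mem Mm.scale_closed nc_J nc_sc cf_sc fun_eq_iff)

lemma J_self: "S.HI m (J x) (J x) = cinner x x"
  by (simp add: HI_self_nc J_mem nc_J Qs_cf cinner_self)

lemma J_ip: "S.HI m (J x) (J y) = cinner x y"
  by (rule polarization[OF Mm.ipspace_axioms H.ipspace_axioms])
     (auto simp: J_mem J_self simp flip: J_sc J_add)

lemma J_norm: "nrm (S.HI m) (J x) = norm x"
  by (simp add: nrm_def J_self norm_cinner)

text \<open>\<open>js s\<close> is \<open>j\<^sup>* f\<close> for the \<open>f\<close> with \<open>nc f = s\<close>; on such sequences the adjoint of
  multiplication by \<open>z\<^sub>i\<close> is the shift \<open>sh i\<close>.\<close>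

definition js :: "(('n \<Rightarrow> nat) \<Rightarrow> 'h) \<Rightarrow> 'h" where
  "js s = (SOME y. \<forall>x. S.HI m (J x) (mkf (\<lambda>\<alpha>. rho m \<alpha> *\<^sub>R s \<alpha>)) = cinner x y)"

lemma js_HI:
  assumes s: "ell s"
  shows "S.HI m (J x) (mkf (\<lambda>\<alpha>. rho m \<alpha> *\<^sub>R s \<alpha>)) = cinner x (js s)"
proof -
  define g where "g = mkf (\<lambda>\<alpha>. rho m \<alpha> *\<^sub>R s \<alpha>)"
  have g: "g \<in> S.HS m" unfolding g_def by (rule ell_mkf(1)[OF s])
  have "\<exists>y. \<forall>x. S.HI m (J x) g = cinner x y"
  proof (rule Riesz_representation)
    show "cmod (S.HI m (J x) g) \<le> nrm (S.HI m) g * norm x" for x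
      using Mm.Cauchy_Schwarz[OF J_mem g, of x] by (simp add: J_norm mult.commute)
  qed (simp_all add: J_add J_sc Mm.ip_add_left Mm.ip_scale_left J_mem g)
  then have "\<forall>x. S.HI m (J x) g = cinner x (js s)"
    unfolding js_def g_def by (rule someI_ex)
  then show ?thesis by (simp add: g_def)
qed

lemma js: "ell s \<Longrightarrow> cinner x (js s) = (\<Sum>\<^sub>\<infinity>\<alpha>. of_real (rho m \<alpha>) * cinner (cf x \<alpha>) (s \<alpha>))"
  by (simp add: js_HI[symmetric] HI_nc nc_J nc_mkf)

lemma J_adj: "is_adj cinner UNIV (S.HI m) (S.HS m) J (\<lambda>f. js (nc f))"
  unfolding is_adj_def
proof (intro conjI ballI)
  fix x f assume f: "f \<in> S.HS m"
  have "mkf (\<lambda>\<alpha>. rho m \<alpha> *\<^sub>R nc f \<alpha>) = f"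
    by (rule nc_eqI) (auto simp: ell_mkf ell_nc nc_mkf f)
  then show "S.HI m (J x) f = cinner x (js (nc f))" using js_HI[OF ell_nc[OF f]] by simp
qed auto

lemma adj_J: "f \<in> S.HS m \<Longrightarrow> adj cinner UNIV (S.HI m) (S.HS m) J f = js (nc f)"
  by (rule H.adj_eq[OF J_adj])

text \<open>The adjoint of the isometry \<open>j\<close> is a contraction.\<close>

lemma js_contr: "ell s \<Longrightarrow> (norm (js s))\<^sup>2 \<le> Qs s"
proof -
  assume s: "ell s"
  define g where "g = mkf (\<lambda>\<alpha>. rho m \<alpha> *\<^sub>R s \<alpha>)"
  have g: "g \<in> S.HS m" unfolding g_def by (rule ell_mkf(1)[OF s])
  have ng: "(nrm (S.HI m) g)\<^sup>2 = Qs s" using nrm_nc[OF g] nc_mkf[OF s] by (simp add: g_def)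
  have "(norm (js s))\<^sup>2 = Re (S.HI m (J (js s)) g)" using js_HI[OF s] by (simp add: g_def cinner_self)
  also have "\<dots> \<le> norm (js s) * nrm (S.HI m) g"
    using order_trans[OF complex_Re_le_cmod Mm.Cauchy_Schwarz[OF J_mem g]] by (simp add: J_norm)
  finally have "norm (js s) * norm (js s) \<le> norm (js s) * nrm (S.HI m) g" by (simp add: power2_eq_square)
  then have "norm (js s) \<le> nrm (S.HI m) g" using Mm.nm_nonneg[OF g] by (cases "norm (js s) = 0") auto
  then show ?thesis unfolding ng[symmetric] by (rule power_mono) simp
qed

end

context hyper
begin

subsection \<open>The adjoint of theta on normalised coefficients\<close>

text \<open>The adjoint of the inclusion of \<open>H\<^sub>m\<^sub>-\<^sub>1\<close> into \<open>H\<^sub>m\<close> keeps the normalised coefficients.\<close>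

definition mkp :: "(('n \<Rightarrow> nat) \<Rightarrow> 'h) \<Rightarrow> ('n \<Rightarrow> complex) \<Rightarrow> 'h" where
  "mkp s = mkf (\<lambda>\<alpha>. rr mp \<alpha> *\<^sub>R s \<alpha>)"

lemma mkp_mem: "ell s \<Longrightarrow> mkp s \<in> H1"
  and hc_mkp: "ell s \<Longrightarrow> hc mp D (mkp s) = (\<lambda>\<alpha>. rr mp \<alpha> *\<^sub>R s \<alpha>)"
proof -
  assume s: "ell s"
  have 1: "rr mp \<alpha> *\<^sub>R s \<alpha> \<in> D" for \<alpha> using s by (simp add: ell_def D_scaleR)
  have 2: "rr mp \<alpha> = 0 \<Longrightarrow> rr mp \<alpha> *\<^sub>R s \<alpha> = 0" for \<alpha> by simp
  have 3: "(\<lambda>\<alpha>. (norm (rr mp \<alpha> *\<^sub>R s \<alpha>))\<^sup>2 / rr mp \<alpha>) summable_on UNIV"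
    using ell_Ps_summable[OF s] unfolding sq_div_rr .
  show "mkp s \<in> H1" unfolding mkp_def by (rule S.mkf_hc(1)[OF 1 2 3])
  show "hc mp D (mkp s) = (\<lambda>\<alpha>. rr mp \<alpha> *\<^sub>R s \<alpha>)" unfolding mkp_def by (rule S.mkf_hc(2)[OF 1 2 3])
qed

lemma I1_mkp: "ell s \<Longrightarrow> I1 g (mkp s) = (\<Sum>\<^sub>\<infinity>\<alpha>. cinner (hc mp D g \<alpha>) (s \<alpha>))"
proof -
  assume s: "ell s"
  \<comment> \<open>The weight cancels against the denominator. For \<open>mp = 0\<close> it
    vanishes away from \<alpha> = 0, but there the coefficient of \<open>g\<close> vanishes too, so
    the value 0 of a division by zero is the correct one.\<close>
  have "cinner (hc mp D g \<alpha>) (rr mp \<alpha> *\<^sub>R s \<alpha>) / of_real (rr mp \<alpha>) = cinner (hc mp D g \<alpha>) (s \<alpha>)" for \<alpha>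
    using S.hc_zero[of mp \<alpha> g] by (cases "rr mp \<alpha> = 0") (simp_all add: scaleR_cscale cinner_simps)
  then show ?thesis by (simp add: S.hip_hc hc_mkp[OF s])
qed

lemma I1_mkp_summable:
  assumes g: "g \<in> H1" and s: "ell s"
  shows "(\<lambda>\<alpha>. cinner (hc mp D g \<alpha>) (s \<alpha>)) summable_on UNIV"
proof (rule abs_summable_summable, rule Infinite_Sum.abs_summable_on_comparison_test')
  have 1: "(\<lambda>\<alpha>. (norm (hc mp D g \<alpha>) / sqrt (rr mp \<alpha>))\<^sup>2) summable_on UNIV"
    using S.hc_summable[OF g] by (simp add: power_divide)
  have 2: "(\<lambda>\<alpha>. (sqrt (rr mp \<alpha>) * norm (s \<alpha>))\<^sup>2) summable_on UNIV"
    using ell_Ps_summable[OF s] by (simp add: power_mult_distrib)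
  show "(\<lambda>\<alpha>. \<bar>norm (hc mp D g \<alpha>) / sqrt (rr mp \<alpha>) * (sqrt (rr mp \<alpha>) * norm (s \<alpha>))\<bar>) summable_on UNIV"
    by (rule summable_mult_of_squares[OF 1 2])
  show "norm (cinner (hc mp D g \<alpha>) (s \<alpha>)) \<le> \<bar>norm (hc mp D g \<alpha>) / sqrt (rr mp \<alpha>) * (sqrt (rr mp \<alpha>) * norm (s \<alpha>))\<bar>" for \<alpha>
    using cmod_cinner_le[of "hc mp D g \<alpha>" "s \<alpha>"] S.hc_zero[of mp \<alpha> g]
    by (cases "rr mp \<alpha> = 0") (simp_all add: abs_mult)
qed

lemma mkp_norm: "ell s \<Longrightarrow> (nrm I1 (mkp s))\<^sup>2 = Ps s"
proof -
  assume s: "ell s"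
  have "I1 (mkp s) (mkp s) = of_real (Ps s)"
    unfolding S.hip_hc_self[OF mkp_mem[OF s]] hc_mkp[OF s] sq_div_rr Ps_def ..
  then show ?thesis by (simp add: nrm_def)
qed

text \<open>In the notation of the paper, \<open>V\<^sup>* (mkp s) = (us s, ms s)\<close>.\<close>

definition us :: "(('n \<Rightarrow> nat) \<Rightarrow> 'h) \<Rightarrow> 'h" where
  "us s = (SOME a. a \<in> DS \<and> (\<forall>y\<in>DS. I1 (U y) (mkp s) = cinner y a))"

text \<open>Riesz representation is applied in the closed subspace \<open>DS\<close> of
  \<open>H\<close>. As \<open>U\<close> preserves inner products and maps onto the closure of Im
  \<pi>, the function \<open>U (us s)\<close> is the orthogonal projection of \<open>mkp s\<close>
  to this closure.\<close>

lemma us: 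
  assumes s: "ell s"
  shows "us s \<in> DS" "y \<in> DS \<Longrightarrow> I1 (U y) (mkp s) = cinner y (us s)"
proof -
  have "\<exists>a\<in>DS. \<forall>y\<in>DS. I1 (U y) (mkp s) = cinner y a"
  proof (rule Riesz_closed_subspace[OF DS_closed DS_0 DS_add DS_sc])
    show "cmod (I1 (U y) (mkp s)) \<le> nrm I1 (mkp s) * norm y" if "y \<in> DS" for y
      using M1.Cauchy_Schwarz[OF U_mem[OF that] mkp_mem[OF s]] by (simp add: U_norm that mult.commute)
  qed (simp_all add: U_add U_sc M1.ip_add_left M1.ip_scale_left U_mem mkp_mem s)
  then have "us s \<in> DS \<and> (\<forall>y\<in>DS. I1 (U y) (mkp s) = cinner y (us s))"
    unfolding us_def Bex_def by (rule someI_ex)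
  then show "us s \<in> DS" "y \<in> DS \<Longrightarrow> I1 (U y) (mkp s) = cinner y (us s)" by auto
qed

definition ms :: "(('n \<Rightarrow> nat) \<Rightarrow> 'h) \<Rightarrow> ('n \<Rightarrow> complex) \<Rightarrow> 'h" where
  "ms s = mkp s - U (us s)"

lemma Msp_iff: "g \<in> Msp T m \<longleftrightarrow> g \<in> H1 \<and> (\<forall>y\<in>DS. I1 g (U y) = 0)"
  by (auto simp: Msp_def orth_def Hm1_eq U_range[symmetric])

lemma Msp_H1: "g \<in> Msp T m \<Longrightarrow> g \<in> H1"
  by (simp add: Msp_iff)

lemma Msp_0: "0 \<in> Msp T m" and Msp_add: "g \<in> Msp T m \<Longrightarrow> h \<in> Msp T m \<Longrightarrow> g + h \<in> Msp T m"
  and Msp_sc: "g \<in> Msp T m \<Longrightarrow> cscale c g \<in> Msp T m"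
  by (auto simp: Msp_iff M1.zero_closed M1.add_closed M1.scale_closed M1.ip_add_left M1.ip_scale_left U_mem)

lemma ms_H1: "ell s \<Longrightarrow> ms s \<in> H1"
  unfolding ms_def by (intro M1.diff_closed mkp_mem U_mem us)

lemma ms_mem: "ell s \<Longrightarrow> ms s \<in> Msp T m"
proof -
  assume s: "ell s"
  have "I1 (U y) (ms s) = 0" if "y \<in> DS" for y
    by (simp add: ms_def M1.ip_diff_right U_mem mkp_mem us s that U_ip)
  then have "I1 (ms s) (U y) = 0" if "y \<in> DS" for y
    using M1.ip_commute[OF U_mem[OF that] ms_H1[OF s]] that by simp
  then show ?thesis using ms_H1[OF s] by (simp add: Msp_iff)
qed

text \<open>Pythagoras for the decomposition of \<open>mkp s\<close> along the closure of Im \<pi>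
  and its complement; in other words, \<open>V^*\<close> preserves the norm.\<close>

lemma us_ms_norm: "ell s \<Longrightarrow> (norm (us s))\<^sup>2 + (nrm I1 (ms s))\<^sup>2 = Ps s"
proof -
  assume s: "ell s"
  have "mkp s = ms s + U (us s)" by (simp add: ms_def)
  then have "Ps s = (nrm I1 (ms s + U (us s)))\<^sup>2" using mkp_norm[OF s] by simp
  also have "\<dots> = (nrm I1 (ms s))\<^sup>2 + (norm (us s))\<^sup>2"
    using ms_mem[OF s] us(1)[OF s] by (simp add: M1.nm_add_sq U_mem Msp_iff U_norm)
  finally show ?thesis by simp
qed

definition hv :: "(('n \<Rightarrow> nat) \<Rightarrow> 'h) \<Rightarrow> 'h ^ 'n" where
  "hv s = (\<chi> i. js (sh i s))"

lemma rho_inner_summable: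
  assumes s: "ell s" and t: "ell t"
  shows "(\<lambda>\<alpha>. rho m \<alpha> * norm (cinner (s \<alpha>) (t \<alpha>))) summable_on UNIV"
proof (rule summable_on_comparison_test)
  have 1: "(\<lambda>\<alpha>. (sqrt (rho m \<alpha>) * norm (s \<alpha>))\<^sup>2) summable_on UNIV"
    and 2: "(\<lambda>\<alpha>. (sqrt (rho m \<alpha>) * norm (t \<alpha>))\<^sup>2) summable_on UNIV"
    using s t by (simp_all add: ell_def power_mult_distrib)
  show "(\<lambda>\<alpha>. \<bar>sqrt (rho m \<alpha>) * norm (s \<alpha>) * (sqrt (rho m \<alpha>) * norm (t \<alpha>))\<bar>) summable_on UNIV"
    by (rule summable_mult_of_squares[OF 1 2])
  show "rho m \<alpha> * norm (cinner (s \<alpha>) (t \<alpha>)) \<le> \<bar>sqrt (rho m \<alpha>) * norm (s \<alpha>) * (sqrt (rho m \<alpha>) * norm (t \<alpha>))\<bar>" for \<alpha>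
    using mult_left_mono[OF cmod_cinner_le[of "s \<alpha>" "t \<alpha>"] rho_nonneg[of m \<alpha>]]
    by (simp add: abs_mult mult_ac flip: mult.assoc[of "sqrt _" "sqrt _"])
qed simp

lemma js_eq: 
  assumes s: "ell s"
  shows "js s = Ds (us s) + Tv (hv s)"
proof (rule cinner_ext)
  fix x
  have "cinner x (js s) = (\<Sum>\<^sub>\<infinity>\<alpha>. rho m \<alpha> *\<^sub>R cinner (cf x \<alpha>) (s \<alpha>))"
    by (simp add: js s scaleR_conv_of_real)
  also have "\<dots> = (\<Sum>\<^sub>\<infinity>\<alpha>. rr mp \<alpha> *\<^sub>R cinner (cf x \<alpha>) (s \<alpha>))
      + (\<Sum>i\<in>UNIV. \<Sum>\<^sub>\<infinity>\<alpha>. rho m \<alpha> *\<^sub>R cinner (cf x (up i \<alpha>)) (s (up i \<alpha>)))"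
    by (rule rho_split(3)[OF m1, folded mp_def, OF rho_inner_summable[OF ell_cf s]])
  also have "(\<Sum>\<^sub>\<infinity>\<alpha>. rr mp \<alpha> *\<^sub>R cinner (cf x \<alpha>) (s \<alpha>)) = I1 (pimap T m x) (mkp s)"
    by (simp add: I1_mkp s pi_hc scaleR_cscale cinner_simps scaleR_conv_of_real)
  also have "\<dots> = cinner x (Ds (us s))"
    using us(2)[OF s DS_mem, of x] by (simp add: U_Ds Ds_selfadj)
  also have "(\<Sum>i\<in>UNIV. \<Sum>\<^sub>\<infinity>\<alpha>. rho m \<alpha> *\<^sub>R cinner (cf x (up i \<alpha>)) (s (up i \<alpha>))) = (\<Sum>i\<in>UNIV. cinner (Ts i x) (js (sh i s)))"
    by (simp add: js ell_sh s cf_up sh_def scaleR_conv_of_real)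
  also have "\<dots> = cinner x (Tv (hv s))"
    by (simp add: Tv_def hv_def cinner_sum_right Ts_adj')
  finally show "cinner x (js s) = cinner x (Ds (us s) + Tv (hv s))" by (simp add: cinner_simps)
qed

abbreviation K where "K \<equiv> Ksp T m"
abbreviation IK where "IK \<equiv> ipK T m"

lemma K_iff: "p \<in> K \<longleftrightarrow> fst p \<in> DV \<and> snd p \<in> Msp T m"
  by (cases p) (simp add: Ksp_def)

lemma IK_eq: "IK p q = cinner (vec_lambda (fst p) :: 'h ^ 'n) (vec_lambda (fst q)) + I1 (snd p) (snd q)"
  by (simp add: ipK_def Hm1_eq ipn_vec)

lemma vl_add: "vec_lambda (x + y) = (vec_lambda x + vec_lambda y :: 'h ^ 'n)"
  and vl_sc: "vec_lambda (cscale c x) = (cscale c (vec_lambda x) :: 'h ^ 'n)"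
  by (simp_all add: vec_eq_iff cscale_vec_def cscale_fun_def)

lemma fst_cscale: "fst (cscale c p) = cscale c (fst p)" and snd_cscale: "snd (cscale c p) = cscale c (snd p)"
  by (simp_all add: cscale_prod_def)

sublocale K: ipspace IK K
proof
  fix p q r :: "('n \<Rightarrow> 'h) \<times> (('n \<Rightarrow> complex) \<Rightarrow> 'h)" and c
  show "p \<in> K \<Longrightarrow> q \<in> K \<Longrightarrow> p + q \<in> K" by (simp add: K_iff DV_add Msp_add)
  show "p \<in> K \<Longrightarrow> cscale c p \<in> K" by (simp add: K_iff DV_sc Msp_sc fst_cscale snd_cscale)
  show "0 \<in> K" by (simp add: K_iff DV_0 Msp_0)
  show "p \<in> K \<Longrightarrow> q \<in> K \<Longrightarrow> r \<in> K \<Longrightarrow> IK (p + q) r = IK p r + IK q r"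
    by (simp only: IK_eq K_iff fst_add snd_add vl_add cinner_simps M1.ip_add_left Msp_H1) simp
  show "p \<in> K \<Longrightarrow> q \<in> K \<Longrightarrow> IK (cscale c p) q = c * IK p q"
    by (simp only: IK_eq K_iff fst_cscale snd_cscale vl_sc cinner_simps M1.ip_scale_left Msp_H1) (simp add: algebra_simps)
  show "p \<in> K \<Longrightarrow> q \<in> K \<Longrightarrow> IK q p = cnj (IK p q)"
    by (simp only: IK_eq K_iff complex_cnj_add cinner_commute[symmetric] M1.ip_commute[symmetric] Msp_H1)
  show "p \<in> K \<Longrightarrow> 0 \<le> Re (IK p p)"
    by (simp add: IK_eq K_iff M1.ip_nonneg Msp_H1 cinner_nonneg)
  show "p = 0" if p: "p \<in> K" and 0: "IK p p = 0"
  proof -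
    have mem: "snd p \<in> H1" using p by (simp add: K_iff Msp_H1)
    have "(norm (vec_lambda (fst p) :: 'h ^ 'n))\<^sup>2 + (nrm I1 (snd p))\<^sup>2 = 0"
      using 0 by (simp add: IK_eq M1.nm_sq[OF mem] complex_eq_iff cinner_self)
    then have z: "vec_lambda (fst p) = (0 :: 'h ^ 'n)" "nrm I1 (snd p) = 0" by (simp_all add: add_nonneg_eq_0_iff)
    have "fst p = 0" using z(1) by (simp add: vec_eq_iff fun_eq_iff)
    then show ?thesis using M1.nm_eq_0[OF mem z(2)] by (simp add: prod_eq_iff)
  qed
qed

lemma K_norm: "p \<in> K \<Longrightarrow> (nrm IK p)\<^sup>2 = (norm (vec_lambda (fst p) :: 'h ^ 'n))\<^sup>2 + (nrm I1 (snd p))\<^sup>2"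
  by (simp add: K.nm_sq) (simp add: IK_eq cinner_self M1.nm_sq K_iff Msp_H1)

text \<open>The adjoint of \<open>p \<mapsto> \<theta>\<^sub>T(\<cdot>) p\<close>, as a map from \<open>H\<^sub>m\<close> to \<open>K\<close>.\<close>

definition Ths :: "(('n \<Rightarrow> nat) \<Rightarrow> 'h) \<Rightarrow> ('n \<Rightarrow> 'h) \<times> (('n \<Rightarrow> complex) \<Rightarrow> 'h)" where
  "Ths s = (vec_nth (Dv (hv s) - Tvs (us s)), - ms s)"

lemma Ths_mem: "ell s \<Longrightarrow> Ths s \<in> K"
proof -
  assume s: "ell s"
  have "vec_nth (Dv (hv s)) = DT T (vec_nth (hv s))" by (simp add: DT_vec)
  then have "vec_nth (Dv (hv s)) \<in> DV" using DV_mem by simp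
  moreover have "cscale (- 1) (vec_nth (Tvs (us s))) \<in> DV" by (intro DV_sc Tvs_mem us s)
  moreover have "vec_nth (Dv (hv s) - Tvs (us s)) = vec_nth (Dv (hv s)) + cscale (- 1) (vec_nth (Tvs (us s)))"
    by (simp add: fun_eq_iff cscale_neg_one)
  ultimately have "vec_nth (Dv (hv s) - Tvs (us s)) \<in> DV" using DV_add by simp
  moreover have "- ms s \<in> Msp T m" using Msp_sc[OF ms_mem[OF s], of "- 1"] by (simp add: cscale_neg_one)
  ultimately show ?thesis by (simp add: K_iff Ths_def)
qed

lemma Ths_norm:
  assumes s: "ell s"
  shows "(nrm IK (Ths s))\<^sup>2 = Ps s + (\<Sum>i\<in>UNIV. (norm (js (sh i s)))\<^sup>2) - (norm (js s))\<^sup>2"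
proof -
  define h a where "h = hv s" and "a = us s"
  \<comment> \<open>Up to sign both rows of the matrix produce the same cross term, so it cancels
    when their squared norms are added.\<close>
  have "cinner (Dv h) (Tvs a) = cinner (Tv h) (Ds a)"
    by (simp add: Tv_adj[symmetric] Tv_Dv Ds_selfadj)
  then have 1: "(norm (Dv h - Tvs a))\<^sup>2 = (norm (Dv h))\<^sup>2 + (norm (Tvs a))\<^sup>2 - 2 * Re (cinner (Tv h) (Ds a))"
    using H.nm_diff_sq[of "Dv h" "Tvs a"] by simp
  have 2: "(norm (js s))\<^sup>2 = (norm (Ds a))\<^sup>2 + (norm (Tv h))\<^sup>2 + 2 * Re (cinner (Tv h) (Ds a))"
    using H.nm_add_sq[of "Tv h" "Ds a"] by (simp add: js_eq[OF s] h_def a_def add.commute)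
  have 3: "(norm h)\<^sup>2 = (\<Sum>i\<in>UNIV. (norm (js (sh i s)))\<^sup>2)" by (simp add: h_def hv_def norm_vec_sq)
  have "(nrm IK (Ths s))\<^sup>2 = (norm (Dv h - Tvs a))\<^sup>2 + (nrm I1 (ms s))\<^sup>2"
    by (simp only: K_norm[OF Ths_mem[OF s]]) (simp add: Ths_def h_def a_def M1.nm_minus ms_H1 s)
  then show ?thesis
    using 1 2 3 us_ms_norm[OF s] Ds_norm_sq[of a] Dv_norm_sq[of h] by (simp add: a_def)
qed

section \<open>Iterated adjoint shifts and the norm of the adjoint of the multiplier\<close>

definition shb :: "('n \<Rightarrow> nat) \<Rightarrow> (('n \<Rightarrow> nat) \<Rightarrow> 'h) \<Rightarrow> ('n \<Rightarrow> nat) \<Rightarrow> 'h" where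
  "shb \<beta> s \<alpha> = s (\<alpha> + \<beta>)"

lemma shb_up: "shb (up i \<beta>) s = sh i (shb \<beta> s)"
  by (simp add: shb_def sh_def fun_eq_iff up_add)

lemma shb_0: "shb 0 s = s"
  by (simp add: shb_def fun_eq_iff)

lemma ell_shb: "ell s \<Longrightarrow> ell (shb \<beta> s)"
proof (induction \<beta> rule: up_induct)
  case zero
  then show ?case by (simp only: shb_0)
next
  case (up i \<alpha>)
  then show ?case by (simp only: shb_up ell_sh)
qed

definition qf :: "(('n \<Rightarrow> nat) \<Rightarrow> 'h) \<Rightarrow> ('n \<Rightarrow> nat) \<Rightarrow> real" where
  "qf s \<beta> = Qs (shb \<beta> s)"

lemma qf_pow_le: "ell s \<Longrightarrow> (Eop ^^ k) (qf s) \<beta> \<le> qf s \<beta>"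
proof (induction k arbitrary: \<beta>)
  case (Suc k)
  have "(Eop ^^ Suc k) (qf s) \<beta> = (\<Sum>i\<in>UNIV. (Eop ^^ k) (qf s) (up i \<beta>))" by (simp add: Eop_def)
  also have "\<dots> \<le> (\<Sum>i\<in>UNIV. qf s (up i \<beta>))" using Suc by (intro sum_mono)
  also have "\<dots> \<le> qf s \<beta>"
    using Qs_split[OF ell_shb[OF Suc.prems], of \<beta>] by (simp add: qf_def shb_up)
  finally show ?case .
qed simp

text \<open>The adjoint shifts satisfy the same kind of decay as a pure tuple: \<open>s\<close> is
  split into a part of degree at most \<open>N\<close>, which more than \<open>N\<close> shifts
  annihilate, and a tail of small norm, which the iterates do not enlarge.\<close>

lemma qf_lim:
  assumes s: "ell s"
  shows "(\<lambda>k. (Eop ^^ k) (qf s) 0) \<longlonglongrightarrow> 0"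
proof (rule LIMSEQ_I)
  fix e :: real assume e: "e > 0"
  have sm: "(\<lambda>\<alpha>. rho m \<alpha> * (norm (s \<alpha>))\<^sup>2) summable_on UNIV" using s by (simp add: ell_def)
  obtain F where F: "finite F" "dist (\<Sum>\<alpha>\<in>F. rho m \<alpha> * (norm (s \<alpha>))\<^sup>2) (Qs s) \<le> e / 2"
    using infsum_finite_approximation[OF sm, of "e / 2"] e unfolding Qs_def by auto
  obtain N where N: "F \<subseteq> {\<alpha>. sum \<alpha> UNIV \<le> N}" using finite_subset_degree_le[OF F(1)] .
  define t r where "t \<alpha> = (if sum \<alpha> UNIV \<le> N then s \<alpha> else 0)" and "r \<alpha> = (if sum \<alpha> UNIV \<le> N then 0 else s \<alpha>)"
    for \<alpha> :: "'n \<Rightarrow> nat"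
  have et: "ell t" and er: "ell r"
    using s S.D0 by (auto simp: ell_def t_def r_def intro!: summable_on_comparison_test[OF sm])
  \<comment> \<open>The two parts have disjoint supports, hence so do their shifts, and the squared
    norms add without cross terms.\<close>
  have split: "qf s = (\<lambda>\<beta>. 1 * qf t \<beta> + 1 * qf r \<beta>)"
  proof
    fix \<beta>
    have "(\<lambda>\<alpha>. rho m \<alpha> * (norm (shb \<beta> s \<alpha>))\<^sup>2) = (\<lambda>\<alpha>. rho m \<alpha> * (norm (shb \<beta> t \<alpha>))\<^sup>2 + rho m \<alpha> * (norm (shb \<beta> r \<alpha>))\<^sup>2)"
      by (auto simp: shb_def t_def r_def)
    then show "qf s \<beta> = 1 * qf t \<beta> + 1 * qf r \<beta>"
      using ell_shb[OF et, of \<beta>] ell_shb[OF er, of \<beta>]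
      by (simp add: qf_def Qs_def ell_def infsum_add)
  qed
  have Qr: "Qs r \<le> e / 2"
  proof -
    have "(\<Sum>\<alpha>\<in>F. rho m \<alpha> * (norm (s \<alpha>))\<^sup>2) = (\<Sum>\<alpha>\<in>F. rho m \<alpha> * (norm (t \<alpha>))\<^sup>2)"
      using N by (intro sum.cong) (auto simp: t_def)
    also have "\<dots> \<le> Qs t" unfolding Qs_def
      by (rule finite_sum_le_infsum) (use et F in \<open>auto simp: ell_def\<close>)
    finally have "Qs s - Qs t \<le> e / 2" using F(2) unfolding dist_real_def by linarith
    moreover have "Qs s = Qs t + Qs r"
      using fun_cong[OF split, of 0] by (simp only: qf_def shb_0)
    ultimately show ?thesis by simp
  qed
  have t0: "(Eop ^^ k) (qf t) 0 = 0" if "k > N" for k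
  proof -
    have "qf t \<alpha> = 0" if "sum \<alpha> UNIV = k" for \<alpha>
    proof -
      have "t (\<beta> + \<alpha>) = 0" for \<beta> using that \<open>k > N\<close> by (simp add: t_def sum.distrib)
      then show ?thesis by (simp add: qf_def Qs_def shb_def)
    qed
    then show ?thesis by (simp add: Eop_pow_at_0)
  qed
  have "norm ((Eop ^^ k) (qf s) 0 - 0) < e" if k: "k \<ge> Suc N" for k
  proof -
    have "(Eop ^^ k) (qf s) 0 = (Eop ^^ k) (qf t) 0 + (Eop ^^ k) (qf r) 0"
      unfolding split by (subst Eop_pow_linear) simp
    also have "\<dots> = (Eop ^^ k) (qf r) 0" using t0[of k] k by simp
    also have "\<dots> \<le> Qs r" using qf_pow_le[OF er, of k 0] by (simp only: qf_def shb_0)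
    finally have "(Eop ^^ k) (qf s) 0 \<le> e / 2" using Qr by simp
    moreover have "0 \<le> (Eop ^^ k) (qf s) 0"
      using Eop_pow_mono[of "\<lambda>_. 0" "qf s" k 0] by (simp add: Eop_pow_0 qf_def)
    ultimately show ?thesis using e by simp
  qed
  then show "\<exists>no. \<forall>k\<ge>no. norm ((Eop ^^ k) (qf s) 0 - 0) < e" by blast
qed

text \<open>This computes the squared norm of the future adjoint of M_\<theta>. The telescoping
  function \<open>G\<close> is nonnegative because \<open>js\<close> is a contraction, and
  \<open>G \<le> qf s\<close> yields the decay of its iterates. The factor
  \<open>rho 1 \<beta>\<close> is exactly the weight that the space H_1 requires.\<close>

lemma Ths_has_sum:
  assumes s: "ell s"
  shows "((\<lambda>\<beta>. rho 1 \<beta> * (nrm IK (Ths (shb \<beta> s)))\<^sup>2) has_sum (Qs s - (norm (js s))\<^sup>2)) UNIV"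
proof -
  define G where "G \<beta> = Qs (shb \<beta> s) - (norm (js (shb \<beta> s)))\<^sup>2" for \<beta>
  have G0: "0 \<le> G \<beta>" for \<beta> using js_contr[OF ell_shb[OF s]] by (simp add: G_def)
  have Gq: "G \<beta> \<le> qf s \<beta>" for \<beta> by (simp add: G_def qf_def)
  have lim: "(\<lambda>k. (Eop ^^ k) G 0) \<longlonglongrightarrow> 0"
  proof (rule tendsto_sandwich[OF _ _ tendsto_const qf_lim[OF s]])
    show "\<forall>\<^sub>F k in sequentially. 0 \<le> (Eop ^^ k) G 0"
      using Eop_pow_mono[of "\<lambda>_. 0" G] G0 by (simp add: Eop_pow_0)
    show "\<forall>\<^sub>F k in sequentially. (Eop ^^ k) G 0 \<le> (Eop ^^ k) (qf s) 0"
      using Eop_pow_mono[of G "qf s"] Gq by simp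
  qed
  have "((\<lambda>\<beta>. rho 1 \<beta> * (nrm IK (Ths (shb \<beta> s)))\<^sup>2) has_sum G 0) UNIV"
  proof (rule telescope_has_sum[OF _ _ lim])
    fix \<beta>
    show "(nrm IK (Ths (shb \<beta> s)))\<^sup>2 = G \<beta> - Eop G \<beta>"
      using Ths_norm[OF ell_shb[OF s], of \<beta>] Qs_split[OF ell_shb[OF s], of \<beta>]
      by (simp add: G_def Eop_def shb_up sum_subtractf)
  qed simp
  then show ?thesis by (simp only: G_def shb_0)
qed

lemma Ths_contr: "ell s \<Longrightarrow> nrm IK (Ths s) \<le> sqrt (Qs s)"
proof -
  assume s: "ell s"
  have "(\<Sum>i\<in>UNIV. (norm (js (sh i s)))\<^sup>2) \<le> (\<Sum>i\<in>UNIV. Qs (sh i s))"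
    by (intro sum_mono js_contr ell_sh s)
  then have "(nrm IK (Ths s))\<^sup>2 \<le> Qs s"
    unfolding Ths_norm[OF s] Qs_split[OF s] using zero_le_power2[of "norm (js s)"] by linarith
  then show ?thesis by (rule real_le_rsqrt)
qed

end

section \<open>Transport of unconditional sums\<close>

lemma has_sum_up:
  fixes f :: "('n \<Rightarrow> nat) \<Rightarrow> 'b::{comm_monoid_add,topological_space}"
  assumes "(f has_sum a) UNIV"
  shows "((\<lambda>\<alpha>. if 0 < \<alpha> i then f (dn i \<alpha>) else 0) has_sum a) UNIV"
proof -
  have "((\<lambda>\<alpha>. (\<lambda>\<beta>. f (dn i \<beta>)) (up i \<alpha>)) has_sum a) UNIV" using assms by simp
  then have "((\<lambda>\<alpha>. f (dn i \<alpha>)) has_sum a) {\<alpha>. 0 < \<alpha> i}"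
    by (subst (asm) has_sum_reindex_bij_betw[OF bij_up])
  then show ?thesis by (subst has_sum_cong_neutral[where T = "{\<alpha>. 0 < \<alpha> i}" and g = "\<lambda>\<alpha>. f (dn i \<alpha>)"]) auto
qed

lemma rr_mono: "l \<le> k \<Longrightarrow> rr l \<alpha> \<le> rr k \<alpha>"
proof (induction k rule: dec_induct)
  case (step k)
  then show ?case using rr_le_rho[of "Suc k" \<alpha>] by (simp add: rr_pos)
qed simp

lemma has_sum_proj:
  fixes \<phi> :: "'a::{ab_group_add,topological_space} \<Rightarrow> 'b::{ab_group_add,topological_space}"
  assumes "continuous_on UNIV \<phi>" "\<And>x y. \<phi> (x + y) = \<phi> x + \<phi> y" "(f has_sum s) A"
  shows "((\<lambda>x. \<phi> (f x)) has_sum \<phi> s) A"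
  using has_sum_comm_additive[of \<phi> s f A] assms
  by (auto simp: Modules.additive_def continuous_on_def o_def)

lemma has_sum_vec:
  assumes "\<And>i. ((\<lambda>x. f x i) has_sum s i) A"
  shows "((\<lambda>x. vec_lambda (f x) :: 'h::real_normed_vector ^ 'n) has_sum vec_lambda s) A"
  unfolding has_sum_def
proof (rule vec_tendstoI)
  show "((\<lambda>F. (\<Sum>x\<in>F. vec_lambda (f x) :: 'h ^ 'n) $ i) \<longlongrightarrow> vec_lambda s $ i) (finite_subsets_at_top A)" for i
    using assms[of i] by (simp add: has_sum_def)
qed

context hyper
begin

subsection \<open>The coefficients of theta\<close>

text \<open>The power series coefficients of \<open>\<theta>_T(z) p\<close>. The last sum belongs to
  the resolvent term, rewritten as the sum of the functions z_i j((D_T x)_i) with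
  \<open>x = fst p\<close>: multiplication by z_i shifts the coefficients of j.\<close>

definition th :: "('n \<Rightarrow> 'h) \<times> (('n \<Rightarrow> complex) \<Rightarrow> 'h) \<Rightarrow> ('n \<Rightarrow> nat) \<Rightarrow> 'h" where
  "th p \<alpha> = - (hc mp D (U (Tv (vec_lambda (fst p)))) \<alpha> + hc mp D (snd p) \<alpha>)
     + (\<Sum>i\<in>UNIV. if 0 < \<alpha> i then rho m (dn i \<alpha>) *\<^sub>R cf (DT T (fst p) i) (dn i \<alpha>) else 0)"

lemma UT_mem: "p \<in> K \<Longrightarrow> U (Tv (vec_lambda (fst p))) \<in> H1"
  by (simp add: K_iff U_mem Tv_mem)

lemma snd_mem: "p \<in> K \<Longrightarrow> snd p \<in> H1"
  by (simp add: K_iff Msp_H1)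

lemma th_mem: "p \<in> K \<Longrightarrow> th p \<alpha> \<in> D"
  unfolding th_def
  by (intro S.Dadd S.P.uminus_closed S.P.sum_closed S.hc_mem UT_mem snd_mem)
     (simp_all add: cf_mem D_scaleR S.D0)

text \<open>The adjoint relation between \<open>p \<mapsto> \<theta>_T p\<close> and
  \<open>Ths\<close>, stated for bare coefficients because square summability of \<open>th p\<close>
  is a consequence of it. Pairing with normalised coefficients removes all weights.\<close>

lemma th_adj:
  assumes p: "p \<in> K" and s: "ell s"
  shows "((\<lambda>\<alpha>. cinner (th p \<alpha>) (s \<alpha>)) has_sum IK p (Ths s)) UNIV"
proof -
  define x where "x = (vec_lambda (fst p) :: 'h ^ 'n)"
  have 1: "((\<lambda>\<alpha>. cinner (hc mp D g \<alpha>) (s \<alpha>)) has_sum I1 g (mkp s)) UNIV" if "g \<in> H1" for g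
    unfolding I1_mkp[OF s] by (rule has_sum_infsum[OF I1_mkp_summable[OF that s]])
  have 2: "((\<lambda>\<alpha>. cinner (if 0 < \<alpha> i then rho m (dn i \<alpha>) *\<^sub>R cf y (dn i \<alpha>) else 0) (s \<alpha>)) has_sum
      cinner y (js (sh i s))) UNIV" for i y
  proof -
    have "((\<lambda>\<alpha>. rho m \<alpha> *\<^sub>R cinner (cf y \<alpha>) (sh i s \<alpha>)) has_sum cinner y (js (sh i s))) UNIV"
      unfolding js[OF ell_sh[OF s]] scaleR_conv_of_real[symmetric]
      by (rule has_sum_infsum, rule abs_summable_summable)
         (use rho_inner_summable[OF ell_cf ell_sh[OF s]] in simp)
    from has_sum_up[OF this, of i] show ?thesis
      by (rule has_sum_cong[THEN iffD1, rotated])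
         (auto simp: sh_def up_dn scaleR_cscale cinner_simps scaleR_conv_of_real)
  qed
  have "((\<lambda>\<alpha>. - (cinner (hc mp D (U (Tv x)) \<alpha>) (s \<alpha>) + cinner (hc mp D (snd p) \<alpha>) (s \<alpha>))
      + (\<Sum>i\<in>UNIV. cinner (if 0 < \<alpha> i then rho m (dn i \<alpha>) *\<^sub>R cf (DT T (fst p) i) (dn i \<alpha>) else 0) (s \<alpha>)))
     has_sum (- (I1 (U (Tv x)) (mkp s) + I1 (snd p) (mkp s)) + (\<Sum>i\<in>UNIV. cinner (DT T (fst p) i) (js (sh i s))))) UNIV"
    using has_sum_diff[OF has_sum_0_simp has_sum_add[OF 1 1]]
    by (intro has_sum_add has_sum_sum 2) (use UT_mem[OF p] snd_mem[OF p] in \<open>simp add: x_def\<close>)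
  moreover have "- (cinner (hc mp D (U (Tv x)) \<alpha>) (s \<alpha>) + cinner (hc mp D (snd p) \<alpha>) (s \<alpha>))
      + (\<Sum>i\<in>UNIV. cinner (if 0 < \<alpha> i then rho m (dn i \<alpha>) *\<^sub>R cf (DT T (fst p) i) (dn i \<alpha>) else 0) (s \<alpha>))
     = cinner (th p \<alpha>) (s \<alpha>)" for \<alpha>
    by (simp add: th_def x_def cinner_simps cinner_sum_left)
  moreover have "- (I1 (U (Tv x)) (mkp s) + I1 (snd p) (mkp s)) + (\<Sum>i\<in>UNIV. cinner (DT T (fst p) i) (js (sh i s)))
     = IK p (Ths s)"
  proof -
    have Tx: "Tv x \<in> DS" using p by (simp add: x_def K_iff Tv_mem)
    \<comment> \<open>The component of \<open>p\<close> in \<M> is orthogonal to the range of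
      \<open>U\<close>, so it sees only \<open>ms s\<close>.\<close>
    have "mkp s = ms s + U (us s)" by (simp add: ms_def)
    then have "I1 (snd p) (mkp s) = I1 (snd p) (ms s)"
      using p us(1)[OF s] by (simp add: M1.ip_add_right snd_mem ms_H1 s U_mem) (simp add: K_iff Msp_iff)
    moreover have "I1 (U (Tv x)) (mkp s) = cinner x (Tvs (us s))"
      by (simp add: us(2)[OF s Tx] Tv_adj)
    moreover have "(\<Sum>i\<in>UNIV. cinner (DT T (fst p) i) (js (sh i s))) = cinner x (Dv (hv s))"
      by (simp add: DT_vec x_def[symmetric] Dv_selfadj[symmetric]) (simp add: cinner_vec_def hv_def)
    ultimately show ?thesis
      by (simp only: IK_eq Ths_def fst_conv snd_conv vec_nth_inverse x_def[symmetric]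
          M1.ip_minus_right[OF snd_mem[OF p] ms_H1[OF s]] cinner_simps) simp
  qed
  ultimately show ?thesis by (simp only:)
qed

text \<open>Square summability is tested against the finitely supported sequences \<open>cut F c\<close>.\<close>

definition cut :: "('n \<Rightarrow> nat) set \<Rightarrow> (('n \<Rightarrow> nat) \<Rightarrow> 'h) \<Rightarrow> ('n \<Rightarrow> nat) \<Rightarrow> 'h" where
  "cut F c \<alpha> = (if \<alpha> \<in> F then (1 / rho m \<alpha>) *\<^sub>R c \<alpha> else 0)"

lemma ell_cut: "(\<And>\<alpha>. c \<alpha> \<in> D) \<Longrightarrow> finite F \<Longrightarrow> ell (cut F c)"
  unfolding ell_def
  by (auto simp: cut_def D_scaleR S.D0 intro: finite_nonzero_values_imp_summable_on
      finite_subset[of _ F] split: if_splits)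

lemma Qs_cut: "finite F \<Longrightarrow> Qs (cut F c) = (\<Sum>\<alpha>\<in>F. (norm (c \<alpha>))\<^sup>2 / rho m \<alpha>)"
  unfolding Qs_def
  by (rule infsumI, rule has_sum_finite_neutralI[where B = F])
     (auto simp: cut_def power_mult_distrib power_divide power2_eq_square intro!: sum.cong)

text \<open>The converse of Cauchy-Schwarz: for a truncation the sum \<open>S\<close> over
  \<open>F\<close> equals \<open>Qs (cut F c)\<close>, so the assumption reads
  \<open>S \<le> A sqrt S\<close> and bounds all finite sums by \<open>A^2\<close>.\<close>

lemma coef_bound:
  assumes A: "A \<ge> 0"
    and b: "\<And>F. finite F \<Longrightarrow> (\<Sum>\<alpha>\<in>F. (norm (c \<alpha>))\<^sup>2 / rho m \<alpha>) \<le> A * sqrt (Qs (cut F c))"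
  shows "(\<lambda>\<alpha>. (norm (c \<alpha>))\<^sup>2 / rho m \<alpha>) summable_on UNIV"
    and "(\<Sum>\<^sub>\<infinity>\<alpha>. (norm (c \<alpha>))\<^sup>2 / rho m \<alpha>) \<le> A\<^sup>2"
proof -
  have le: "(\<Sum>\<alpha>\<in>F. (norm (c \<alpha>))\<^sup>2 / rho m \<alpha>) \<le> A\<^sup>2" if F: "finite F" for F
  proof -
    define S where "S = (\<Sum>\<alpha>\<in>F. (norm (c \<alpha>))\<^sup>2 / rho m \<alpha>)"
    have S0: "S \<ge> 0" by (simp add: S_def sum_nonneg)
    have "sqrt S * sqrt S \<le> A * sqrt S" using b[OF F] S0 by (simp add: Qs_cut[OF F] S_def[symmetric])
    then have "sqrt S \<le> A"
      using A S0 mult_right_le_imp_le[of "sqrt S" "sqrt S" A] by (cases "S = 0") simp_all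
    then show ?thesis unfolding S_def[symmetric] using S0 real_le_lsqrt sqrt_le_D by blast
  qed
  show sm: "(\<lambda>\<alpha>. (norm (c \<alpha>))\<^sup>2 / rho m \<alpha>) summable_on UNIV"
    by (rule nonneg_bdd_above_summable_on) (auto intro!: bdd_aboveI2[of _ _ "A\<^sup>2"] le)
  show "(\<Sum>\<^sub>\<infinity>\<alpha>. (norm (c \<alpha>))\<^sup>2 / rho m \<alpha>) \<le> A\<^sup>2"
    by (rule infsum_le_finite_sums[OF sm]) (rule le)
qed

lemma cut_inner: "cinner (c \<alpha>) (cut F c \<alpha>) = (if \<alpha> \<in> F then of_real ((norm (c \<alpha>))\<^sup>2 / rho m \<alpha>) else 0)"
  by (simp add: cut_def scaleR_cscale cinner_simps cinner_self)

text \<open>Contractivity of \<open>Ths\<close> dualises: together with the adjoint relation it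
  places \<open>\<theta>_T p\<close> in H_m with norm at most that of \<open>p\<close>.\<close>

lemma th_bound:
  assumes p: "p \<in> K"
  shows "(\<lambda>\<alpha>. (norm (th p \<alpha>))\<^sup>2 / rho m \<alpha>) summable_on UNIV"
    and "(\<Sum>\<^sub>\<infinity>\<alpha>. (norm (th p \<alpha>))\<^sup>2 / rho m \<alpha>) \<le> (nrm IK p)\<^sup>2"
proof -
  have b: "(\<Sum>\<alpha>\<in>F. (norm (th p \<alpha>))\<^sup>2 / rho m \<alpha>) \<le> nrm IK p * sqrt (Qs (cut F (th p)))" if F: "finite F" for F
  proof -
    have e: "ell (cut F (th p))" by (rule ell_cut[OF th_mem[OF p] F])
    have "((\<lambda>\<alpha>. cinner (th p \<alpha>) (cut F (th p) \<alpha>)) has_sum of_real (\<Sum>\<alpha>\<in>F. (norm (th p \<alpha>))\<^sup>2 / rho m \<alpha>)) UNIV"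
      by (rule has_sum_finite_neutralI[OF F]) (auto simp: cut_inner)
    then have "of_real (\<Sum>\<alpha>\<in>F. (norm (th p \<alpha>))\<^sup>2 / rho m \<alpha>) = IK p (Ths (cut F (th p)))"
      using th_adj[OF p e] has_sum_unique by blast
    then have "(\<Sum>\<alpha>\<in>F. (norm (th p \<alpha>))\<^sup>2 / rho m \<alpha>) = Re (IK p (Ths (cut F (th p))))"
      by (metis Re_complex_of_real)
    also have "\<dots> \<le> nrm IK p * nrm IK (Ths (cut F (th p)))"
      by (rule order_trans[OF complex_Re_le_cmod K.Cauchy_Schwarz[OF p Ths_mem[OF e]]])
    also have "\<dots> \<le> nrm IK p * sqrt (Qs (cut F (th p)))"
      by (intro mult_left_mono Ths_contr e K.nm_nonneg p)
    finally show ?thesis .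
  qed
  show "(\<lambda>\<alpha>. (norm (th p \<alpha>))\<^sup>2 / rho m \<alpha>) summable_on UNIV"
    by (rule coef_bound(1)[OF K.nm_nonneg[OF p] b])
  show "(\<Sum>\<^sub>\<infinity>\<alpha>. (norm (th p \<alpha>))\<^sup>2 / rho m \<alpha>) \<le> (nrm IK p)\<^sup>2"
    by (rule coef_bound(2)[OF K.nm_nonneg[OF p] b])
qed

lemma coef_mkf:
  assumes "\<And>\<alpha>. c \<alpha> \<in> D" "(\<lambda>\<alpha>. (norm (c \<alpha>))\<^sup>2 / rho m \<alpha>) summable_on UNIV"
  shows "mkf c \<in> S.HS m" "hc m D (mkf c) = c"
proof -
  have 2: "rr m \<alpha> = 0 \<Longrightarrow> c \<alpha> = 0" for \<alpha> using m1 by (simp add: rr_pos)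
  have 3: "(\<lambda>\<alpha>. (norm (c \<alpha>))\<^sup>2 / rr m \<alpha>) summable_on UNIV"
    using assms(2) m1 by (simp add: rr_pos)
  show "mkf c \<in> S.HS m" by (rule S.mkf_hc(1)[OF assms(1) 2 3])
  show "hc m D (mkf c) = c" by (rule S.mkf_hc(2)[OF assms(1) 2 3])
qed

lemma th_abs:
  assumes p: "p \<in> K" and z: "z \<in> Bn"
  shows "(\<lambda>\<alpha>. cmod (zpow z \<alpha>) * norm (th p \<alpha>)) summable_on UNIV"
    and "(\<Sum>\<^sub>\<infinity>\<alpha>. cmod (zpow z \<alpha>) * norm (th p \<alpha>)) \<le> kap m z * nrm IK p"
proof -
  note f = coef_mkf[of "th p", OF th_mem[OF p] th_bound(1)[OF p]]
  show "(\<lambda>\<alpha>. cmod (zpow z \<alpha>) * norm (th p \<alpha>)) summable_on UNIV"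
    using S.hc_abs(1)[OF f(1) z] by (simp only: f(2))
  have "S.HI m (mkf (th p)) (mkf (th p)) = of_real (\<Sum>\<^sub>\<infinity>\<alpha>. (norm (th p \<alpha>))\<^sup>2 / rho m \<alpha>)"
    using S.hip_hc_self[OF f(1)] m1 by (simp add: f(2) rr_pos)
  then have "(nrm (S.HI m) (mkf (th p)))\<^sup>2 \<le> (nrm IK p)\<^sup>2"
    using th_bound(2)[OF p] by (simp add: Mm.nm_sq[OF f(1)])
  then have "nrm (S.HI m) (mkf (th p)) \<le> nrm IK p"
    using K.nm_nonneg[OF p] power2_le_imp_le by blast
  then have "kap m z * nrm (S.HI m) (mkf (th p)) \<le> kap m z * nrm IK p"
    by (rule mult_left_mono) simp
  then show "(\<Sum>\<^sub>\<infinity>\<alpha>. cmod (zpow z \<alpha>) * norm (th p \<alpha>)) \<le> kap m z * nrm IK p"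
    using S.hc_abs(2)[OF f(1) z] by (simp only: f(2))
qed

subsection \<open>Inverting 1 - Z T*\<close>

lemma ZTs_add: "ZTs T z (x + y) = ZTs T z x + ZTs T z y"
  by (simp add: ZTs_def Ts_add cscale_add_right sum.distrib)

lemma ZTs_norm: "norm (ZTs T z x) \<le> sqrt (\<Sum>i\<in>UNIV. (cmod (z i))\<^sup>2) * norm x"
proof -
  have "norm (ZTs T z x) \<le> (\<Sum>i\<in>UNIV. \<bar>cmod (z i)\<bar> * \<bar>norm (Ts i x)\<bar>)"
    unfolding ZTs_def by (rule order_trans[OF norm_sum]) simp
  also have "\<dots> \<le> L2_set (\<lambda>i. cmod (z i)) UNIV * L2_set (\<lambda>i. norm (Ts i x)) UNIV"
    by (rule L2_set_mult_ineq)
  also have "\<dots> \<le> sqrt (\<Sum>i\<in>UNIV. (cmod (z i))\<^sup>2) * norm x"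
    unfolding L2_set_def using row_contraction[of x]
    by (intro mult_left_mono real_le_lsqrt) (auto simp: sum_nonneg)
  finally show ?thesis .
qed

definition Az :: "('n \<Rightarrow> complex) \<Rightarrow> 'h \<Rightarrow> 'h" where "Az z y = y - ZTs T z y"

text \<open>Solving \<open>w = y - Z T^* y\<close> amounts to finding the fixed point of
  \<open>y \<mapsto> w + Z T^* y\<close>, a contraction whose constant is the norm of
  \<open>z\<close>, because the column of the \<open>T_i^*\<close> is a contraction.\<close>

lemma Az_bij:
  assumes z: "z \<in> Bn"
  shows "bij (Az z)"
proof -
  define r where "r = sqrt (\<Sum>i\<in>UNIV. (cmod (z i))\<^sup>2)"
  have r: "0 \<le> r" "r < 1" using z by (auto simp: r_def Bn_def sum_nonneg)
  have d: "ZTs T z x - ZTs T z y = ZTs T z (x - y)" for x y using ZTs_add[of z "x - y" y] by simp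
  have "\<exists>!y. y = w + ZTs T z y" for w
  proof -
    have "\<exists>!y. w + ZTs T z y = y"
    proof (rule banach_fix_type[OF r])
      show "\<forall>x y. dist (w + ZTs T z x) (w + ZTs T z y) \<le> r * dist x y"
        using ZTs_norm[of z] by (simp add: dist_norm d r_def)
    qed
    then show ?thesis by metis
  qed
  then have "\<exists>!y. w = Az z y" for w unfolding Az_def by (simp add: eq_diff_eq) metis
  then show ?thesis by (metis bij_iff)
qed

definition Jl :: "('n \<Rightarrow> complex) \<Rightarrow> nat \<Rightarrow> 'h \<Rightarrow> 'h" where
  "Jl z l x = (\<Sum>\<^sub>\<infinity>\<alpha>. rr l \<alpha> *\<^sub>R cscale (zpow z \<alpha>) (cf x \<alpha>))"

lemma Jl_summable:
  assumes z: "z \<in> Bn" and l: "l \<le> m"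
  shows "(\<lambda>\<alpha>. rr l \<alpha> * norm (cscale (zpow z \<alpha>) (cf x \<alpha>))) summable_on UNIV"
proof (rule summable_on_comparison_test)
  show "(\<lambda>\<alpha>. cmod (zpow z \<alpha>) * norm (hc m D (J x) \<alpha>)) summable_on UNIV"
    by (rule S.hc_abs(1)[OF J_mem z])
  show "rr l \<alpha> * norm (cscale (zpow z \<alpha>) (cf x \<alpha>)) \<le> cmod (zpow z \<alpha>) * norm (hc m D (J x) \<alpha>)" for \<alpha>
    using mult_right_mono[OF rr_mono[OF l, of \<alpha>], of "cmod (zpow z \<alpha>) * norm (cf x \<alpha>)"] m1
    by (simp add: hc_nc nc_J rr_pos mult_ac)
qed simp

lemma Jl_has_sum:
  assumes "z \<in> Bn" "l \<le> m"
  shows "((\<lambda>\<alpha>. rr l \<alpha> *\<^sub>R cscale (zpow z \<alpha>) (cf x \<alpha>)) has_sum Jl z l x) UNIV"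
  unfolding Jl_def
  by (rule has_sum_infsum, rule abs_summable_summable) (use Jl_summable[OF assms] in simp)

lemma Jl_add:
  assumes "z \<in> Bn" "l \<le> m"
  shows "Jl z l (x + y) = Jl z l x + Jl z l y"
  using has_sum_add[OF Jl_has_sum[OF assms, of x] Jl_has_sum[OF assms, of y]] Jl_has_sum[OF assms, of "x + y"]
  by (simp add: cf_add cscale_add_right scaleR_add_right has_sum_unique)

lemma Jl_sc:
  assumes "z \<in> Bn" "l \<le> m"
  shows "Jl z l (cscale c x) = cscale c (Jl z l x)"
proof -
  have "((\<lambda>\<alpha>. cscale c (rr l \<alpha> *\<^sub>R cscale (zpow z \<alpha>) (cf x \<alpha>))) has_sum cscale c (Jl z l x)) UNIV"
    by (rule has_sum_bounded_linear[OF bounded_linear_cscale_right Jl_has_sum[OF assms]])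
  moreover have "cscale c (rr l \<alpha> *\<^sub>R cscale (zpow z \<alpha>) (cf x \<alpha>)) = rr l \<alpha> *\<^sub>R cscale (zpow z \<alpha>) (cf (cscale c x) \<alpha>)" for \<alpha>
    by (simp add: scaleR_cscale_commute cf_sc cscale_cscale mult.commute)
  ultimately show ?thesis using Jl_has_sum[OF assms, of "cscale c x"] by (simp add: has_sum_unique)
qed

lemma Jl_m: "z \<in> Bn \<Longrightarrow> Jl z m x = J x z"
  using S.hc_has_sum[OF J_mem, of z x] Jl_has_sum[of z m x] m1
  by (simp add: hc_nc nc_J rr_pos scaleR_cscale_commute has_sum_unique)

lemma Jl_0: "Jl z 0 x = C x"
proof -
  have "(\<lambda>\<alpha>. rr 0 \<alpha> *\<^sub>R cscale (zpow z \<alpha>) (cf x \<alpha>)) = (\<lambda>\<alpha>. if \<alpha> = 0 then C x else 0)"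
    by (intro ext) (simp add: rr_def cscale_one cf_def)
  then show ?thesis unfolding Jl_def using infsumI[OF S.has_sum_at_0, of "C x"] by (simp only:)
qed

lemma Jl_Az:
  assumes z: "z \<in> Bn" and l: "Suc l \<le> m"
  shows "Jl z (Suc l) (Az z x) = Jl z l x"
proof -
  have s: "(\<lambda>\<alpha>. rho (Suc l) \<alpha> * norm (cscale (zpow z \<alpha>) (cf x \<alpha>))) summable_on UNIV"
    using Jl_summable[OF z l, of x] by (simp add: rr_pos)
  have "Jl z (Suc l) x = Jl z l x + (\<Sum>i\<in>UNIV. \<Sum>\<^sub>\<infinity>\<alpha>. rho (Suc l) \<alpha> *\<^sub>R cscale (zpow z (up i \<alpha>)) (cf x (up i \<alpha>)))"
    using rho_split(3)[OF _ s] by (simp add: Jl_def rr_pos)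
  moreover have "(\<Sum>\<^sub>\<infinity>\<alpha>. rho (Suc l) \<alpha> *\<^sub>R cscale (zpow z (up i \<alpha>)) (cf x (up i \<alpha>))) = cscale (z i) (Jl z (Suc l) (Ts i x))" for i
  proof (rule infsumI)
    have "((\<lambda>\<alpha>. cscale (z i) (rr (Suc l) \<alpha> *\<^sub>R cscale (zpow z \<alpha>) (cf (Ts i x) \<alpha>))) has_sum cscale (z i) (Jl z (Suc l) (Ts i x))) UNIV"
      by (rule has_sum_bounded_linear[OF bounded_linear_cscale_right Jl_has_sum[OF z l]])
    then show "((\<lambda>\<alpha>. rho (Suc l) \<alpha> *\<^sub>R cscale (zpow z (up i \<alpha>)) (cf x (up i \<alpha>))) has_sum cscale (z i) (Jl z (Suc l) (Ts i x))) UNIV"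
      by (simp add: rr_pos zpow_up cf_up scaleR_cscale_commute cscale_cscale)
  qed
  moreover have "Jl z (Suc l) (ZTs T z x) = (\<Sum>i\<in>UNIV. cscale (z i) (Jl z (Suc l) (Ts i x)))"
  proof -
    have "Jl z (Suc l) (sum f F) = (\<Sum>i\<in>F. Jl z (Suc l) (f i))" if "finite F" for f :: "'n \<Rightarrow> 'h" and F
      using that Jl_sc[OF z l, of 0 0] by (induction F) (simp_all add: Jl_add[OF z l])
    then show ?thesis unfolding ZTs_def by (simp add: Jl_sc[OF z l])
  qed
  moreover have "Jl z (Suc l) (Az z x) + Jl z (Suc l) (ZTs T z x) = Jl z (Suc l) x"
    by (simp add: Az_def flip: Jl_add[OF z l])
  ultimately show ?thesis by simp
qed

lemma Jl_Az_pow: "z \<in> Bn \<Longrightarrow> l \<le> m \<Longrightarrow> Jl z l ((Az z ^^ l) x) = C x"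
  by (induction l) (simp_all add: Jl_0 Jl_Az)

text \<open>Bijectivity makes \<open>opinv\<close> a true inverse; then \<open>w\<close> is replaced
  by the m-th power of \<open>1 - Z T^*\<close> at its preimage, and each factor lowers the weight
  by one until \<open>C\<close> remains.\<close>

lemma C_opinv:
  assumes z: "z \<in> Bn"
  shows "C (opinv ((\<lambda>y. y - ZTs T z y) ^^ m) w) = J w z"
proof -
  have "bij (Az z ^^ m)" using Az_bij[OF z] by (rule bij_fn)
  then have "\<exists>B. \<forall>x. (Az z ^^ m) (B x) = x \<and> B ((Az z ^^ m) x) = x"
    by (intro exI[of _ "inv (Az z ^^ m)"]) (simp add: bij_is_inj bij_is_surj surj_f_inv_f)
  then have "\<forall>x. (Az z ^^ m) (opinv (Az z ^^ m) x) = x \<and> opinv (Az z ^^ m) ((Az z ^^ m) x) = x"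
    unfolding opinv_def by (rule someI_ex)
  then have "w = (Az z ^^ m) (opinv (Az z ^^ m) w)" by simp
  then have "J w z = C (opinv (Az z ^^ m) w)"
    using Jl_Az_pow[OF z order_refl, of "opinv (Az z ^^ m) w"] Jl_m[OF z, of w] by simp
  moreover have "Az z = (\<lambda>y. y - ZTs T z y)" by (simp add: Az_def fun_eq_iff)
  ultimately show ?thesis by simp
qed

lemma pi_at_0: "pimap T m y 0 = C y"
proof -
  have mem: "pimap T m y \<in> H1" using U_mem[OF DS_mem, of y] by (simp add: U_Ds)
  have 0: "zpow (0 :: 'n \<Rightarrow> complex) \<alpha> = (if \<alpha> = 0 then 1 else 0)" for \<alpha> :: "'n \<Rightarrow> nat"
  proof (cases "\<alpha> = 0")
    case False
    then obtain i where "\<alpha> i \<noteq> 0" by (auto simp: fun_eq_iff)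
    then have "(0 :: 'n \<Rightarrow> complex) i ^ \<alpha> i = 0" by simp
    then show ?thesis using False unfolding zpow_def by (metis (no_types, lifting) UNIV_I finite prod_zero)
  next
    case True
    show ?thesis unfolding if_P[OF True] unfolding True by (rule zpow_0)
  qed
  have "(\<lambda>\<alpha>. cscale (zpow (0 :: 'n \<Rightarrow> complex) \<alpha>) (hc mp D (pimap T m y) \<alpha>)) = (\<lambda>\<alpha>. if \<alpha> = 0 then C y else 0)"
    unfolding pi_hc 0 by (intro ext) (simp add: cscale_one cf_def)
  then have "((\<lambda>\<alpha>. if \<alpha> = 0 then C y else 0) has_sum pimap T m y 0) (UNIV :: ('n \<Rightarrow> nat) set)"
    using S.hc_has_sum[OF mem zero_Bn] by (simp only:)
  then show ?thesis using S.has_sum_at_0[of "C y"] has_sum_unique by blast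
qed

lemma theta_eq:
  assumes z: "z \<in> Bn"
  shows "theta T m U z p = - (U (Tv (vec_lambda (fst p))) z + snd p z) + J (Zop z (DT T (fst p))) z"
  by (simp only: theta_def U_Ds pi_at_0 C_opinv[OF z] Tf_Tv)

lemma J_eval_bl:
  assumes z: "z \<in> Bn"
  shows "bounded_linear (\<lambda>w. J w z)"
proof (rule bounded_linear_cscaleI)
  show "norm (J w z) \<le> kap m z * norm w" for w
    using S.HS_eval_bound[OF J_mem z] by (simp add: J_norm)
qed (simp_all add: J_add J_sc cscale_fun_def)

lemma theta_th:
  assumes p: "p \<in> K" and z: "z \<in> Bn"
  shows "((\<lambda>\<alpha>. cscale (zpow z \<alpha>) (th p \<alpha>)) has_sum theta T m U z p) UNIV"
proof -
  have J1: "((\<lambda>\<alpha>. cscale (zpow z \<alpha>) (if 0 < \<alpha> i then rho m (dn i \<alpha>) *\<^sub>R cf y (dn i \<alpha>) else 0)) has_sum J (cscale (z i) y) z) UNIV" for i y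
  proof -
    have "((\<lambda>\<alpha>. cscale (z i) (rr m \<alpha> *\<^sub>R cscale (zpow z \<alpha>) (cf y \<alpha>))) has_sum cscale (z i) (J y z)) UNIV"
      unfolding Jl_m[OF z, symmetric]
      by (rule has_sum_bounded_linear[OF bounded_linear_cscale_right Jl_has_sum[OF z order_refl]])
    from has_sum_up[OF this, of i] have "((\<lambda>\<alpha>. cscale (zpow z \<alpha>) (if 0 < \<alpha> i then rho m (dn i \<alpha>) *\<^sub>R cf y (dn i \<alpha>) else 0)) has_sum cscale (z i) (J y z)) UNIV"
    proof (rule has_sum_cong[THEN iffD1, rotated])
      fix \<alpha> :: "'n \<Rightarrow> nat"
      show "(if 0 < \<alpha> i then cscale (z i) (rr m (dn i \<alpha>) *\<^sub>R cscale (zpow z (dn i \<alpha>)) (cf y (dn i \<alpha>))) else 0) =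
        cscale (zpow z \<alpha>) (if 0 < \<alpha> i then rho m (dn i \<alpha>) *\<^sub>R cf y (dn i \<alpha>) else 0)"
        using zpow_up[of z i "dn i \<alpha>"] m1
        by (auto simp: up_dn rr_pos scaleR_cscale_commute cscale_cscale)
    qed
    then show ?thesis by (simp add: J_sc cscale_fun_def)
  qed
  have "J (Zop z (DT T (fst p))) z = (\<Sum>i\<in>UNIV. J (cscale (z i) (DT T (fst p) i)) z)"
    unfolding Zop_def by (rule bounded_linear.linear[OF J_eval_bl[OF z], THEN linear_sum])
  moreover have "((\<lambda>\<alpha>. (0 - (cscale (zpow z \<alpha>) (hc mp D (U (Tv (vec_lambda (fst p)))) \<alpha>) + cscale (zpow z \<alpha>) (hc mp D (snd p) \<alpha>)))
      + (\<Sum>i\<in>UNIV. cscale (zpow z \<alpha>) (if 0 < \<alpha> i then rho m (dn i \<alpha>) *\<^sub>R cf (DT T (fst p) i) (dn i \<alpha>) else 0)))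
     has_sum ((0 - (U (Tv (vec_lambda (fst p))) z + snd p z)) + (\<Sum>i\<in>UNIV. J (cscale (z i) (DT T (fst p) i)) z))) UNIV"
    by (intro has_sum_add has_sum_diff has_sum_sum has_sum_0_simp J1 S.hc_has_sum UT_mem[OF p] snd_mem[OF p] z)
  ultimately show ?thesis
    unfolding theta_eq[OF z] th_def
    by (simp add: cscale_add_right cscale_minus_right cscale_diff_right cscale_sum_right)
qed

lemma U_has_sum:
  assumes f: "\<And>\<beta>. f \<beta> \<in> DS" and s: "(f has_sum y) A" and z: "z \<in> Bn"
  shows "((\<lambda>\<beta>. U (f \<beta>) z) has_sum U y z) A"
proof -
  have fin: "sum f F \<in> DS \<and> U (sum f F) z = (\<Sum>\<beta>\<in>F. U (f \<beta>) z)" for F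
    using U_sc[OF DS_0, of 0]
    by (induction F rule: infinite_finite_induct) (simp_all add: DS_0 DS_add f U_add)
  have y: "y \<in> DS"
    by (rule Lim_in_closed_set[OF DS_closed _ _ s[unfolded has_sum_def]]) (simp_all add: fin)
  show ?thesis
    unfolding has_sum_def
  proof (rule Lim_null[THEN iffD2], rule Lim_null_comparison)
    have "norm (U (sum f F) z - U y z) \<le> kap mp z * norm (sum f F - y)" for F
    proof -
      have d: "sum f F - y \<in> DS" using DS_add[OF conjunct1[OF fin] DS_sc[OF y, of "- 1"], of F] by (simp add: cscale_neg_one)
      have "U (sum f F) = U (sum f F - y) + U y" using U_add[OF d y] by simp
      then have "U (sum f F) z - U y z = U (sum f F - y) z" by simp
      then show ?thesis using S.HS_eval_bound[OF U_mem[OF d] z] by (simp add: U_norm d)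
    qed
    then show "\<forall>\<^sub>F F in finite_subsets_at_top A. norm ((\<Sum>\<beta>\<in>F. U (f \<beta>) z) - U y z) \<le> kap mp z * norm (sum f F - y)"
      by (simp add: conjunct2[OF fin, symmetric])
    show "((\<lambda>F. kap mp z * norm (sum f F - y)) \<longlongrightarrow> 0) (finite_subsets_at_top A)"
      using s unfolding has_sum_def
      by (auto intro!: tendsto_mult_right_zero tendsto_norm_zero simp: Lim_null[symmetric])
  qed
qed

text \<open>Sums in \<open>K\<close> converge only coordinatewise in H^n and pointwise in \<M>. This
  is enough: on the finite power coordinatewise convergence is norm convergence, where T and D_T are
  continuous, and the component in \<M> enters \<open>theta\<close> only through its value at
  \<open>z\<close>.\<close>

lemma theta_cont:
  assumes k: "\<And>\<beta>. k \<beta> \<in> K" and s: "(k has_sum q) A" and z: "z \<in> Bn"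
  shows "((\<lambda>\<beta>. theta T m U z (k \<beta>)) has_sum theta T m U z q) A"
proof -
  have f: "((\<lambda>\<beta>. fst (k \<beta>) i) has_sum fst q i) A" for i
  proof (rule has_sum_proj[OF _ _ s])
    show "continuous_on UNIV (\<lambda>p::('n \<Rightarrow> 'h) \<times> (('n \<Rightarrow> complex) \<Rightarrow> 'h). fst p i)"
      by (rule continuous_on_compose2[OF coord_cont continuous_on_fst[OF continuous_on_id]]) simp
  qed simp
  have g: "((\<lambda>\<beta>. snd (k \<beta>) z) has_sum snd q z) A"
  proof (rule has_sum_proj[OF _ _ s])
    show "continuous_on UNIV (\<lambda>p::('n \<Rightarrow> 'h) \<times> (('n \<Rightarrow> complex) \<Rightarrow> 'h). snd p z)"
      by (rule continuous_on_compose2[OF continuous_on_product_coordinates continuous_on_snd[OF continuous_on_id]]) simp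
  qed simp
  have v: "((\<lambda>\<beta>. vec_lambda (fst (k \<beta>)) :: 'h ^ 'n) has_sum vec_lambda (fst q)) A"
    by (rule has_sum_vec[OF f])
  have Zop: "Zop z (DT T x) = (\<Sum>i\<in>UNIV. cscale (z i) (Dv (vec_lambda x) $ i))" for x
    by (simp add: Zop_def DT_vec)
  have bl: "bounded_linear (\<lambda>v. J (\<Sum>i\<in>UNIV. cscale (z i) (Dv v $ i)) z)"
    by (intro bounded_linear_compose[OF J_eval_bl[OF z]] bounded_linear_sum
        bounded_linear_compose[OF bounded_linear_cscale_right] bounded_linear_compose[OF bounded_linear_vec_nth Dv_bl])
  have "((\<lambda>\<beta>. (0 - (U (Tv (vec_lambda (fst (k \<beta>)))) z + snd (k \<beta>) z)) + J (Zop z (DT T (fst (k \<beta>)))) z) has_sum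
     ((0 - (U (Tv (vec_lambda (fst q))) z + snd q z)) + J (Zop z (DT T (fst q))) z)) A"
    unfolding Zop
    by (intro has_sum_add has_sum_diff has_sum_0_simp g has_sum_bounded_linear[OF bl v] U_has_sum z
        has_sum_bounded_linear[OF Tv_bl v]) (use k in \<open>auto simp: K_iff Tv_mem\<close>)
  then show ?thesis unfolding theta_eq[OF z] by simp
qed

lemma theta_sc: "p \<in> K \<Longrightarrow> z \<in> Bn \<Longrightarrow> theta T m U z (cscale c p) = cscale c (theta T m U z p)"
proof -
  assume p: "p \<in> K" and z: "z \<in> Bn"
  have "Zop z (DT T (cscale c (fst p))) = cscale c (Zop z (DT T (fst p)))"
    by (simp only: DT_sc) (simp add: Zop_def cscale_fun_def cscale_sum_right cscale_cscale mult.commute)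
  moreover have "U (Tv (cscale c (vec_lambda (fst p)))) z = cscale c (U (Tv (vec_lambda (fst p))) z)"
    using p by (simp add: Tv_sc U_sc Tv_mem K_iff cscale_fun_def)
  ultimately show ?thesis
    unfolding theta_eq[OF z] fst_cscale snd_cscale vl_sc
    by (simp add: J_sc cscale_fun_def cscale_add_right cscale_minus_right cscale_diff_right)
qed

end

section \<open>Unconditional sums under pointwise convergence\<close>

lemma tendsto_fun_componentwise:
  fixes f :: "'a \<Rightarrow> 'b \<Rightarrow> 'c::topological_space"
  assumes "\<And>x. ((\<lambda>a. f a x) \<longlongrightarrow> l x) F"
  shows "(f \<longlongrightarrow> l) F"
proof -
  have "limitin (product_topology (\<lambda>_. euclidean) UNIV) f l F"
    using assms by (simp add: limitin_componentwise)
  then show ?thesis by (simp add: euclidean_product_topology)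
qed

lemma has_sum_fun_pair:
  fixes c :: "'x \<Rightarrow> ('i \<Rightarrow> 'a::{comm_monoid_add,topological_space}) \<times> ('w \<Rightarrow> 'b::{comm_monoid_add,topological_space})"
  assumes "\<And>i. ((\<lambda>x. fst (c x) i) has_sum fst s i) A" "\<And>w. ((\<lambda>x. snd (c x) w) has_sum snd s w) A"
  shows "(c has_sum s) A"
proof -
  have 1: "fst (sum c F) i = (\<Sum>x\<in>F. fst (c x) i)" and 2: "snd (sum c F) w = (\<Sum>x\<in>F. snd (c x) w)" for F i w
    by (induction F rule: infinite_finite_induct) simp_all
  have "((\<lambda>F. fst (sum c F)) \<longlongrightarrow> fst s) (finite_subsets_at_top A)"
    using assms(1) by (intro tendsto_fun_componentwise) (simp add: 1 has_sum_def)
  moreover have "((\<lambda>F. snd (sum c F)) \<longlongrightarrow> snd s) (finite_subsets_at_top A)"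
    using assms(2) by (intro tendsto_fun_componentwise) (simp add: 2 has_sum_def)
  ultimately have "((\<lambda>F. (fst (sum c F), snd (sum c F))) \<longlongrightarrow> (fst s, snd s)) (finite_subsets_at_top A)"
    by (rule tendsto_Pair)
  then show ?thesis by (simp add: has_sum_def)
qed

lemma has_sum_fst_coord:
  fixes c :: "'x \<Rightarrow> ('i \<Rightarrow> 'a::{ab_group_add,topological_space}) \<times> ('w \<Rightarrow> 'b::{ab_group_add,topological_space})"
  assumes "(c has_sum s) A"
  shows "((\<lambda>x. fst (c x) i) has_sum fst s i) A"
proof (rule has_sum_proj[OF _ _ assms])
  show "continuous_on UNIV (\<lambda>p::('i \<Rightarrow> 'a) \<times> ('w \<Rightarrow> 'b). fst p i)"
    by (rule continuous_on_compose2[OF continuous_on_product_coordinates continuous_on_fst[OF continuous_on_id]]) simp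
qed simp

lemma has_sum_snd_coord:
  fixes c :: "'x \<Rightarrow> ('i \<Rightarrow> 'a::{ab_group_add,topological_space}) \<times> ('w \<Rightarrow> 'b::{ab_group_add,topological_space})"
  assumes "(c has_sum s) A"
  shows "((\<lambda>x. snd (c x) w) has_sum snd s w) A"
proof (rule has_sum_proj[OF _ _ assms])
  show "continuous_on UNIV (\<lambda>p::('i \<Rightarrow> 'a) \<times> ('w \<Rightarrow> 'b). snd p w)"
    by (rule continuous_on_compose2[OF continuous_on_product_coordinates continuous_on_snd[OF continuous_on_id]]) simp
qed simp

text \<open>Polarization with the factors 1 and \<open>\<i>\<close>: over the complex numbers the
  quadratic form determines the operator. This turns the norm identity for the adjoints into the
  operator identity of the theorem.\<close>

lemma (in ipspace) quadratic_form_eq_0: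
  assumes mem: "\<And>x. x \<in> S \<Longrightarrow> B x \<in> S" and add: "\<And>x y. x \<in> S \<Longrightarrow> y \<in> S \<Longrightarrow> B (x + y) = B x + B y"
    and sc: "\<And>c x. x \<in> S \<Longrightarrow> B (cscale c x) = cscale c (B x)"
    and 0: "\<And>x. x \<in> S \<Longrightarrow> ip (B x) x = 0" and x: "x \<in> S"
  shows "B x = 0"
proof -
  have e: "cnj k * ip (B x) y + k * ip (B y) x = 0" if y: "y \<in> S" for k y
    using 0[OF add_closed[OF x scale_closed[OF y, of k]]] 0[OF x] 0[OF y]
    by (simp add: add sc x y mem ip_add_left ip_add_right ip_scale_left ip_scale_right scale_closed add_closed add.commute)
  have "ip (B x) y = 0" if y: "y \<in> S" for y
  proof -
    have "ip (B y) x = - ip (B x) y" using e[OF y, of 1] by (simp add: eq_neg_iff_add_eq_0 add.commute)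
    then have "- \<i> * ip (B x) y - \<i> * ip (B x) y = 0" using e[OF y, of \<i>] by simp
    then show ?thesis by simp
  qed
  then show ?thesis using ip_definite[OF mem[OF x]] mem[OF x] by simp
qed

lemma (in ipspace) ip_ext_left:
  assumes "x \<in> S" "y \<in> S" "\<And>z. z \<in> S \<Longrightarrow> ip x z = ip y z"
  shows "x = y"
proof (rule ip_ext[OF assms(1,2)])
  fix z assume z: "z \<in> S"
  show "ip z x = ip z y"
    using ip_commute[OF assms(1) z] ip_commute[OF assms(2) z] assms(3)[OF z] by simp
qed

context hyper
begin

subsection \<open>The space H_1(K)\<close>

text \<open>Otherwise the simplifier turns \<open>H\<^sub>1\<close> into \<open>hsp (Suc 0)\<close> and no rule about it applies.\<close>

declare One_nat_def [simp del]

lemma K_norm_fst: "p \<in> K \<Longrightarrow> norm (fst p i) \<le> nrm IK p"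
proof -
  assume p: "p \<in> K"
  have "norm ((vec_lambda (fst p) :: 'h ^ 'n) $ i) \<le> norm (vec_lambda (fst p) :: 'h ^ 'n)"
    by (rule Finite_Cartesian_Product.norm_nth_le)
  moreover have "norm (vec_lambda (fst p) :: 'h ^ 'n) \<le> nrm IK p"
    by (rule power2_le_imp_le) (use K_norm[OF p] K.nm_nonneg[OF p] in simp_all)
  ultimately show ?thesis by simp
qed

lemma K_norm_snd: "p \<in> K \<Longrightarrow> nrm I1 (snd p) \<le> nrm IK p"
  by (rule power2_le_imp_le) (simp_all add: K_norm)

text \<open>Elements of \<open>K\<close> are pairs of functions. The norm of \<open>K\<close>
  dominates every coordinate of the first component and, through \<open>kap\<close>, every value of
  the second inside the ball, so summable norms give coordinatewise convergence; uniqueness of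
  coefficients is likewise checked coordinate by coordinate.\<close>

sublocale KP: pspace IK K "TYPE('n)"
proof (intro pspace.intro K.ipspace_axioms pspace_axioms.intro)
  fix c d :: "('n \<Rightarrow> nat) \<Rightarrow> ('n \<Rightarrow> 'h) \<times> (('n \<Rightarrow> complex) \<Rightarrow> 'h)" and s t k
  {
    assume c: "(c has_sum s) UNIV" and d: "(d has_sum t) UNIV"
    show "((\<lambda>\<alpha>. c \<alpha> + d \<alpha>) has_sum s + t) UNIV"
      by (rule has_sum_fun_pair)
         (simp_all add: has_sum_add has_sum_fst_coord[OF c] has_sum_fst_coord[OF d] has_sum_snd_coord[OF c] has_sum_snd_coord[OF d])
  next
    assume c: "(c has_sum s) UNIV"
    show "((\<lambda>\<alpha>. cscale k (c \<alpha>)) has_sum cscale k s) UNIV"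
      by (rule has_sum_fun_pair)
         (simp_all add: cscale_prod_def cscale_fun_def has_sum_fst_coord[OF c] has_sum_snd_coord[OF c]
           has_sum_bounded_linear[OF bounded_linear_cscale_right])
  next
    assume z: "((\<lambda>_::'n \<Rightarrow> nat. 0 :: ('n \<Rightarrow> 'h) \<times> (('n \<Rightarrow> complex) \<Rightarrow> 'h)) has_sum s) UNIV"
    have "((\<lambda>_::'n \<Rightarrow> nat. 0) has_sum fst s i) UNIV" for i using has_sum_fst_coord[OF z, of i] by simp
    then have "fst s i = 0" for i by (rule has_sum_unique[OF _ has_sum_0_simp])
    moreover have "((\<lambda>_::'n \<Rightarrow> nat. 0) has_sum snd s w) UNIV" for w using has_sum_snd_coord[OF z, of w] by simp
    then have "snd s w = 0" for w by (rule has_sum_unique[OF _ has_sum_0_simp])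
    ultimately show "s = 0" by (simp add: prod_eq_iff fun_eq_iff)
  next
    assume ex: "\<And>z::'n \<Rightarrow> complex. z \<in> Bn \<Longrightarrow> \<exists>s. ((\<lambda>\<alpha>. cscale (zpow z \<alpha>) (c \<alpha>)) has_sum s) UNIV
            \<and> ((\<lambda>\<alpha>. cscale (zpow z \<alpha>) (d \<alpha>)) has_sum s) UNIV"
    have f: "(\<lambda>\<alpha>. fst (c \<alpha>) i) = (\<lambda>\<alpha>. fst (d \<alpha>) i)" for i
    proof (rule multi_powser_unique)
      fix z :: "'n \<Rightarrow> complex" assume "(\<Sum>i\<in>UNIV. cmod (z i)) < 1"
      then obtain s where s: "((\<lambda>\<alpha>. cscale (zpow z \<alpha>) (c \<alpha>)) has_sum s) UNIV"
          "((\<lambda>\<alpha>. cscale (zpow z \<alpha>) (d \<alpha>)) has_sum s) UNIV" using ex l1_ball_Bn by blast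
      show "\<exists>s. ((\<lambda>\<alpha>. cscale (zpow z \<alpha>) (fst (c \<alpha>) i)) has_sum s) UNIV \<and> ((\<lambda>\<alpha>. cscale (zpow z \<alpha>) (fst (d \<alpha>) i)) has_sum s) UNIV"
        using has_sum_fst_coord[OF s(1), of i] has_sum_fst_coord[OF s(2), of i]
        by (auto simp: cscale_prod_def cscale_fun_def)
    qed
    have g: "(\<lambda>\<alpha>. snd (c \<alpha>) w) = (\<lambda>\<alpha>. snd (d \<alpha>) w)" for w
    proof (rule multi_powser_unique)
      fix z :: "'n \<Rightarrow> complex" assume "(\<Sum>i\<in>UNIV. cmod (z i)) < 1"
      then obtain s where s: "((\<lambda>\<alpha>. cscale (zpow z \<alpha>) (c \<alpha>)) has_sum s) UNIV"
          "((\<lambda>\<alpha>. cscale (zpow z \<alpha>) (d \<alpha>)) has_sum s) UNIV" using ex l1_ball_Bn by blast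
      show "\<exists>s. ((\<lambda>\<alpha>. cscale (zpow z \<alpha>) (snd (c \<alpha>) w)) has_sum s) UNIV \<and> ((\<lambda>\<alpha>. cscale (zpow z \<alpha>) (snd (d \<alpha>) w)) has_sum s) UNIV"
        using has_sum_snd_coord[OF s(1), of w] has_sum_snd_coord[OF s(2), of w]
        by (auto simp: cscale_prod_def cscale_fun_def)
    qed
    show "c = d"
    proof
      fix \<alpha>
      have "fst (c \<alpha>) i = fst (d \<alpha>) i" for i using fun_cong[OF f[of i], of \<alpha>] .
      moreover have "snd (c \<alpha>) w = snd (d \<alpha>) w" for w using fun_cong[OF g[of w], of \<alpha>] .
      ultimately show "c \<alpha> = d \<alpha>" by (simp add: prod_eq_iff fun_eq_iff)
    qed
  next
    fix z :: "'n \<Rightarrow> complex"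
    assume c: "\<And>\<alpha>. c \<alpha> \<in> K" and sm: "(\<lambda>\<alpha>. cmod (zpow z \<alpha>) * nrm IK (c \<alpha>)) summable_on UNIV"
    define a where "a i = (\<Sum>\<^sub>\<infinity>\<alpha>. cscale (zpow z \<alpha>) (fst (c \<alpha>) i))" for i
    define b where "b w = (\<Sum>\<^sub>\<infinity>\<alpha>. cscale (zpow z \<alpha>) (snd (c \<alpha>) w))" for w
    have ha: "((\<lambda>\<alpha>. cscale (zpow z \<alpha>) (fst (c \<alpha>) i)) has_sum a i) UNIV" for i
      unfolding a_def
    proof (rule has_sum_infsum, rule abs_summable_summable, rule Infinite_Sum.abs_summable_on_comparison_test'[OF sm])
      show "norm (cscale (zpow z \<alpha>) (fst (c \<alpha>) i)) \<le> cmod (zpow z \<alpha>) * nrm IK (c \<alpha>)" for \<alpha>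
        using K_norm_fst[OF c, of \<alpha> i] by (simp add: mult_left_mono)
    qed
    have hb: "((\<lambda>\<alpha>. cscale (zpow z \<alpha>) (snd (c \<alpha>) w)) has_sum b w) UNIV" for w
    proof (cases "w \<in> Bn")
      case True
      show ?thesis unfolding b_def
      proof (rule has_sum_infsum, rule abs_summable_summable, rule Infinite_Sum.abs_summable_on_comparison_test')
        show "(\<lambda>\<alpha>. kap mp w * (cmod (zpow z \<alpha>) * nrm IK (c \<alpha>))) summable_on UNIV"
          by (rule summable_on_cmult_right[OF sm])
        fix \<alpha>
        have "norm (snd (c \<alpha>) w) \<le> kap mp w * nrm I1 (snd (c \<alpha>))" by (rule S.HS_eval_bound[OF snd_mem[OF c] True])
        also have "\<dots> \<le> kap mp w * nrm IK (c \<alpha>)" by (intro mult_left_mono K_norm_snd c) simp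
        finally show "norm (cscale (zpow z \<alpha>) (snd (c \<alpha>) w)) \<le> kap mp w * (cmod (zpow z \<alpha>) * nrm IK (c \<alpha>))"
          using mult_left_mono[of _ _ "cmod (zpow z \<alpha>)"] by (fastforce simp: mult_ac)
      qed
    next
      case False
      have "snd (c \<alpha>) w = 0" for \<alpha> by (rule S.HS_outside[OF snd_mem[OF c] False])
      then show ?thesis by (simp add: b_def)
    qed
    have "((\<lambda>\<alpha>. cscale (zpow z \<alpha>) (c \<alpha>)) has_sum (a, b)) UNIV"
      by (rule has_sum_fun_pair) (simp_all add: cscale_prod_def cscale_fun_def ha hb)
    then show "\<exists>s. ((\<lambda>\<alpha>. cscale (zpow z \<alpha>) (c \<alpha>)) has_sum s) UNIV" by blast
  }
qed

abbreviation LS :: "(('n \<Rightarrow> complex) \<Rightarrow> ('n \<Rightarrow> 'h) \<times> (('n \<Rightarrow> complex) \<Rightarrow> 'h)) set"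
  where "LS \<equiv> hsp 1 IK K"
abbreviation LI :: "(('n \<Rightarrow> complex) \<Rightarrow> ('n \<Rightarrow> 'h) \<times> (('n \<Rightarrow> complex) \<Rightarrow> 'h)) \<Rightarrow> _"
  where "LI \<equiv> hip 1 IK K"

sublocale L: ipspace LI LS
  by (rule KP.ipspace_hsp) simp

subsection \<open>The adjoint of the multiplier\<close>

text \<open>The ingredients \<open>us\<close> and \<open>js\<close> are chosen vectors; linearity is
  recovered from the adjoint relation, in which \<open>s\<close> enters conjugate linearly.\<close>

lemma Ths_diff:
  assumes s: "ell s" and t: "ell t" and st: "ell (\<lambda>\<alpha>. s \<alpha> - t \<alpha>)"
  shows "Ths (\<lambda>\<alpha>. s \<alpha> - t \<alpha>) = Ths s - Ths t"
proof (rule K.ip_ext)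
  fix p assume p: "p \<in> K"
  have "((\<lambda>\<alpha>. cinner (th p \<alpha>) (s \<alpha> - t \<alpha>)) has_sum IK p (Ths s) - IK p (Ths t)) UNIV"
    using has_sum_diff[OF th_adj[OF p s] th_adj[OF p t]] by (simp add: cinner_simps)
  then show "IK p (Ths (\<lambda>\<alpha>. s \<alpha> - t \<alpha>)) = IK p (Ths s - Ths t)"
    using th_adj[OF p st] by (simp add: K.ip_diff_right p Ths_mem s t has_sum_unique)
qed (simp_all add: Ths_mem s t st K.diff_closed)

text \<open>The coefficients of \<open>M\<^sub>\<theta>\<^sup>* f\<close> for \<open>nc f = s\<close>.\<close>

definition nb :: "(('n \<Rightarrow> nat) \<Rightarrow> 'h) \<Rightarrow> ('n \<Rightarrow> nat) \<Rightarrow> ('n \<Rightarrow> 'h) \<times> (('n \<Rightarrow> complex) \<Rightarrow> 'h)" where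
  "nb s \<beta> = cscale (of_real (rho 1 \<beta>)) (Ths (shb \<beta> s))"

lemma nb_mem: "ell s \<Longrightarrow> nb s \<beta> \<in> K"
  by (simp add: nb_def K.scale_closed Ths_mem ell_shb)

lemma nb_norm: "ell s \<Longrightarrow> (nrm IK (nb s \<beta>))\<^sup>2 / rho 1 \<beta> = rho 1 \<beta> * (nrm IK (Ths (shb \<beta> s)))\<^sup>2"
  by (simp add: nb_def K.nm_scale Ths_mem ell_shb power_mult_distrib power2_eq_square)

lemma nb_sqs: "ell s \<Longrightarrow> KP.sqs 1 (nb s)"
  unfolding KP.sqs_def using has_sum_imp_summable[OF Ths_has_sum] by (simp only: nb_norm nb_mem) simp

definition NN :: "(('n \<Rightarrow> nat) \<Rightarrow> 'h) \<Rightarrow> ('n \<Rightarrow> complex) \<Rightarrow> ('n \<Rightarrow> 'h) \<times> (('n \<Rightarrow> complex) \<Rightarrow> 'h)" where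
  "NN s = (SOME f. f \<in> LS \<and> is_coef 1 IK K (nb s) f)"

lemma NN: "ell s \<Longrightarrow> NN s \<in> LS" "ell s \<Longrightarrow> is_coef 1 IK K (nb s) (NN s)"
proof -
  have "NN s \<in> LS \<and> is_coef 1 IK K (nb s) (NN s)" if s: "ell s"
  proof -
    have "\<exists>f. f \<in> LS \<and> is_coef 1 IK K (nb s) f"
      using KP.coef_ex[OF nb_sqs[OF s] order_refl] by metis
    then show ?thesis unfolding NN_def by (rule someI_ex)
  qed
  then show "ell s \<Longrightarrow> NN s \<in> LS" "ell s \<Longrightarrow> is_coef 1 IK K (nb s) (NN s)" by auto
qed

lemma NN_norm: "ell s \<Longrightarrow> LI (NN s) (NN s) = of_real (Qs s - (norm (js s))\<^sup>2)"
  using infsumI[OF Ths_has_sum[of s]] KP.hip_self[OF order_refl NN(2)[of s]] by (simp only: nb_norm)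

lemma NN_nrm_le: "ell s \<Longrightarrow> nrm LI (NN s) \<le> sqrt (Qs s)"
  by (simp add: nrm_def NN_norm)

lemma NN_inner:
  assumes k: "is_coef 1 IK K k f" and s: "ell s"
  shows "((\<lambda>\<beta>. IK (k \<beta>) (Ths (shb \<beta> s))) has_sum LI f (NN s)) UNIV"
proof -
  have km: "k \<beta> \<in> K" for \<beta> using k by (simp add: is_coef_def)
  have ks: "KP.sqs 1 k" using k by (simp add: KP.is_coef_iff)
  have e: "IK (k \<beta>) (nb s \<beta>) / of_real (rho 1 \<beta>) = IK (k \<beta>) (Ths (shb \<beta> s))" for \<beta>
    by (simp add: nb_def K.ip_scale_right km Ths_mem ell_shb s)
  have "((\<lambda>\<beta>. IK (k \<beta>) (nb s \<beta>) / of_real (rho 1 \<beta>)) has_sum LI f (NN s)) UNIV"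
    unfolding KP.hip_eq[OF order_refl k NN(2)[OF s]]
    by (rule has_sum_infsum[OF abs_summable_summable[OF KP.ip_summable[OF ks nb_sqs[OF s]]]])
  then show ?thesis by (simp only: e)
qed

section \<open>The Cauchy product of theta with a function\<close>

definition below :: "('n \<Rightarrow> nat) \<Rightarrow> ('n \<Rightarrow> nat) set" where
  "below \<gamma> = {\<beta>. \<forall>i. \<beta> i \<le> \<gamma> i}"

definition sub :: "('n \<Rightarrow> nat) \<Rightarrow> ('n \<Rightarrow> nat) \<Rightarrow> 'n \<Rightarrow> nat" where
  "sub \<gamma> \<beta> i = \<gamma> i - \<beta> i"

lemma finite_below: "finite (below \<gamma>)"
  by (rule finite_subset[OF _ finite_degree_le[of "sum \<gamma> UNIV"]]) (auto simp: below_def intro!: sum_mono)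

lemma sub_add: "\<beta> \<in> below \<gamma> \<Longrightarrow> sub \<gamma> \<beta> + \<beta> = \<gamma>" "sub (\<alpha> + \<beta>) \<beta> = \<alpha>" "\<beta> \<in> below (\<alpha> + \<beta>)"
  by (auto simp: sub_def below_def fun_eq_iff)

definition cM :: "(('n \<Rightarrow> nat) \<Rightarrow> ('n \<Rightarrow> 'h) \<times> (('n \<Rightarrow> complex) \<Rightarrow> 'h)) \<Rightarrow> ('n \<Rightarrow> nat) \<Rightarrow> 'h" where
  "cM k \<gamma> = (\<Sum>\<beta>\<in>below \<gamma>. th (k \<beta>) (sub \<gamma> \<beta>))"

lemma cM_mem: "(\<And>\<beta>. k \<beta> \<in> K) \<Longrightarrow> cM k \<gamma> \<in> D"
  unfolding cM_def by (intro S.P.sum_closed th_mem)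

text \<open>Finite support makes all sums finite, so the order of summation over \<beta> and
  \<gamma> can be exchanged.\<close>

lemma cM_inner_finite:
  assumes k: "is_coef 1 IK K k f" and s: "ell s" and F: "finite F" and s0: "\<And>\<gamma>. \<gamma> \<notin> F \<Longrightarrow> s \<gamma> = 0"
  shows "LI f (NN s) = (\<Sum>\<gamma>\<in>F. cinner (cM k \<gamma>) (s \<gamma>))"
proof -
  have km: "k \<beta> \<in> K" for \<beta> using k by (simp add: is_coef_def)
  have 1: "IK (k \<beta>) (Ths (shb \<beta> s)) = (\<Sum>\<gamma>\<in>F. if \<beta> \<in> below \<gamma> then cinner (th (k \<beta>) (sub \<gamma> \<beta>)) (s \<gamma>) else 0)" for \<beta>
  proof -
    have "((\<lambda>\<alpha>. cinner (th (k \<beta>) \<alpha>) (shb \<beta> s \<alpha>)) has_sum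
        (\<Sum>\<alpha>\<in>(\<lambda>\<gamma>. sub \<gamma> \<beta>) ` {\<gamma>\<in>F. \<beta> \<in> below \<gamma>}. cinner (th (k \<beta>) \<alpha>) (shb \<beta> s \<alpha>))) UNIV"
    proof (rule has_sum_finite_neutralI)
      fix \<alpha> assume a: "\<alpha> \<in> UNIV - (\<lambda>\<gamma>. sub \<gamma> \<beta>) ` {\<gamma>\<in>F. \<beta> \<in> below \<gamma>}"
      have "\<alpha> + \<beta> \<notin> F"
      proof
        assume "\<alpha> + \<beta> \<in> F"
        then have "sub (\<alpha> + \<beta>) \<beta> \<in> (\<lambda>\<gamma>. sub \<gamma> \<beta>) ` {\<gamma>\<in>F. \<beta> \<in> below \<gamma>}" using sub_add(3) by blast
        then show False using a by (simp add: sub_add)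
      qed
      then show "cinner (th (k \<beta>) \<alpha>) (shb \<beta> s \<alpha>) = 0" by (simp add: shb_def s0 cinner_simps)
    qed (use F in auto)
    also have "(\<Sum>\<alpha>\<in>(\<lambda>\<gamma>. sub \<gamma> \<beta>) ` {\<gamma>\<in>F. \<beta> \<in> below \<gamma>}. cinner (th (k \<beta>) \<alpha>) (shb \<beta> s \<alpha>))
      = (\<Sum>\<gamma>\<in>{\<gamma>\<in>F. \<beta> \<in> below \<gamma>}. cinner (th (k \<beta>) (sub \<gamma> \<beta>)) (shb \<beta> s (sub \<gamma> \<beta>)))"
      by (rule sum.reindex[unfolded o_def], rule inj_on_inverseI[where g = "\<lambda>\<alpha>. \<alpha> + \<beta>"]) (simp add: sub_add)
    also have "\<dots> = (\<Sum>\<gamma>\<in>{\<gamma>\<in>F. \<beta> \<in> below \<gamma>}. cinner (th (k \<beta>) (sub \<gamma> \<beta>)) (s \<gamma>))"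
      by (intro sum.cong refl) (simp add: shb_def sub_add)
    also have "\<dots> = (\<Sum>\<gamma>\<in>F. if \<beta> \<in> below \<gamma> then cinner (th (k \<beta>) (sub \<gamma> \<beta>)) (s \<gamma>) else 0)"
      by (rule sum.inter_filter[OF F])
    finally show ?thesis using th_adj[OF km ell_shb[OF s]] has_sum_unique by blast
  qed
  \<comment> \<open>Outside \<open>G\<close> no index of the support dominates \<beta>, so the shift
    of \<open>s\<close> by \<beta> is zero.\<close>
  define G where "G = (\<Union>\<gamma>\<in>F. below \<gamma>)"
  have G: "finite G" using F by (simp add: G_def finite_below)
  have "((\<lambda>\<beta>. IK (k \<beta>) (Ths (shb \<beta> s))) has_sum (\<Sum>\<beta>\<in>G. IK (k \<beta>) (Ths (shb \<beta> s)))) UNIV"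
  proof (rule has_sum_finite_neutralI[OF G])
    fix \<beta> assume "\<beta> \<in> UNIV - G"
    then have "\<beta> \<notin> below \<gamma>" if "\<gamma> \<in> F" for \<gamma> using that by (auto simp: G_def)
    then show "IK (k \<beta>) (Ths (shb \<beta> s)) = 0" unfolding 1 by (intro sum.neutral) auto
  qed auto
  then have "LI f (NN s) = (\<Sum>\<beta>\<in>G. IK (k \<beta>) (Ths (shb \<beta> s)))"
    using NN_inner[OF k s] has_sum_unique by blast
  also have "\<dots> = (\<Sum>\<gamma>\<in>F. \<Sum>\<beta>\<in>G. if \<beta> \<in> below \<gamma> then cinner (th (k \<beta>) (sub \<gamma> \<beta>)) (s \<gamma>) else 0)"
    unfolding 1 by (rule sum.swap)
  also have "\<dots> = (\<Sum>\<gamma>\<in>F. cinner (cM k \<gamma>) (s \<gamma>))"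
  proof (rule sum.cong[OF refl])
    fix \<gamma> assume "\<gamma> \<in> F"
    then have "{\<beta>\<in>G. \<beta> \<in> below \<gamma>} = below \<gamma>" by (auto simp: G_def)
    then show "(\<Sum>\<beta>\<in>G. if \<beta> \<in> below \<gamma> then cinner (th (k \<beta>) (sub \<gamma> \<beta>)) (s \<gamma>) else 0) = cinner (cM k \<gamma>) (s \<gamma>)"
      using sum.inter_filter[OF G, of "\<lambda>\<beta>. cinner (th (k \<beta>) (sub \<gamma> \<beta>)) (s \<gamma>)" "\<lambda>\<beta>. \<beta> \<in> below \<gamma>"]
      by (simp add: cM_def cinner_sum_left)
  qed
  finally show ?thesis .
qed

text \<open>Truncating \<open>s\<close> turns the pairing into the unconditional sum over its coefficients.\<close>

lemma cM_inner:
  assumes f: "f \<in> LS" and k: "is_coef 1 IK K k f" and s: "ell s"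
  shows "((\<lambda>\<gamma>. cinner (cM k \<gamma>) (s \<gamma>)) has_sum LI f (NN s)) UNIV"
proof -
  define r where "r F \<gamma> = (if \<gamma> \<in> F then 0 else s \<gamma>)" for F \<gamma>
  define t where "t F \<gamma> = (if \<gamma> \<in> F then s \<gamma> else 0)" for F \<gamma>
  have sm: "(\<lambda>\<alpha>. rho m \<alpha> * (norm (s \<alpha>))\<^sup>2) summable_on UNIV" using s by (simp add: ell_def)
  have er: "ell (r F)" and et: "ell (t F)" for F
    using s S.D0 by (auto simp: ell_def r_def t_def intro!: summable_on_comparison_test[OF sm])
  have rst: "r F = (\<lambda>\<gamma>. s \<gamma> - t F \<gamma>)" for F by (auto simp: r_def t_def)
  have Qr: "Qs (r F) = Qs s - (\<Sum>\<alpha>\<in>F. rho m \<alpha> * (norm (s \<alpha>))\<^sup>2)" if F: "finite F" for F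
  proof -
    have "((\<lambda>\<alpha>. rho m \<alpha> * (norm (t F \<alpha>))\<^sup>2) has_sum (\<Sum>\<alpha>\<in>F. rho m \<alpha> * (norm (s \<alpha>))\<^sup>2)) UNIV"
      by (rule has_sum_finite_neutralI[OF F]) (auto simp: t_def)
    from has_sum_diff[OF has_sum_infsum[OF sm] this]
    have "((\<lambda>\<alpha>. rho m \<alpha> * (norm (r F \<alpha>))\<^sup>2) has_sum (Qs s - (\<Sum>\<alpha>\<in>F. rho m \<alpha> * (norm (s \<alpha>))\<^sup>2))) UNIV"
      unfolding Qs_def by (rule has_sum_cong[THEN iffD1, rotated]) (auto simp: r_def t_def)
    then show ?thesis by (simp add: Qs_def infsumI)
  qed
  have d: "LI f (NN s) - (\<Sum>\<gamma>\<in>F. cinner (cM k \<gamma>) (s \<gamma>)) = LI f (NN (r F))" if F: "finite F" for F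
  proof -
    have 1: "(\<Sum>\<gamma>\<in>F. cinner (cM k \<gamma>) (s \<gamma>)) = LI f (NN (t F))"
      by (subst cM_inner_finite[OF k et F]) (auto simp: t_def)
    \<comment> \<open>The functions \<open>NN\<close> are chosen, so the difference is formed term
      by term inside the sum over \<beta>, where \<open>Ths_diff\<close> applies.\<close>
    have 2: "((\<lambda>\<beta>. IK (k \<beta>) (Ths (shb \<beta> (r F)))) has_sum LI f (NN s) - LI f (NN (t F))) UNIV"
    proof -
      have "IK (k \<beta>) (Ths (shb \<beta> s)) - IK (k \<beta>) (Ths (shb \<beta> (t F))) = IK (k \<beta>) (Ths (shb \<beta> (r F)))" for \<beta>
      proof -
        have e: "shb \<beta> (r F) = (\<lambda>\<alpha>. shb \<beta> s \<alpha> - shb \<beta> (t F) \<alpha>)" by (simp add: rst shb_def fun_eq_iff)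
        have "ell (\<lambda>\<alpha>. shb \<beta> s \<alpha> - shb \<beta> (t F) \<alpha>)" using ell_shb[OF er, of \<beta> F] unfolding e .
        from Ths_diff[OF ell_shb[OF s] ell_shb[OF et] this] show ?thesis
          using k by (simp add: e K.ip_diff_right is_coef_def Ths_mem ell_shb s et)
      qed
      then show ?thesis using has_sum_diff[OF NN_inner[OF k s] NN_inner[OF k et[of F]]] by (simp only:)
    qed
    show ?thesis using has_sum_unique[OF 2 NN_inner[OF k er]] by (simp only: 1)
  qed
  have bound: "norm ((\<Sum>\<gamma>\<in>F. cinner (cM k \<gamma>) (s \<gamma>)) - LI f (NN s))
      \<le> nrm LI f * sqrt (Qs s - (\<Sum>\<alpha>\<in>F. rho m \<alpha> * (norm (s \<alpha>))\<^sup>2))" if F: "finite F" for F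
  proof -
    have "norm ((\<Sum>\<gamma>\<in>F. cinner (cM k \<gamma>) (s \<gamma>)) - LI f (NN s)) = cmod (LI f (NN (r F)))"
      using d[OF F] by (metis norm_minus_commute)
    also have "\<dots> \<le> nrm LI f * nrm LI (NN (r F))" by (rule L.Cauchy_Schwarz[OF f NN(1)[OF er]])
    also have "\<dots> \<le> nrm LI f * sqrt (Qs (r F))" by (intro mult_left_mono NN_nrm_le er L.nm_nonneg f)
    finally show ?thesis by (simp only: Qr[OF F])
  qed
  show ?thesis
    unfolding has_sum_def
  proof (rule Lim_null[THEN iffD2], rule Lim_null_comparison)
    show "\<forall>\<^sub>F F in finite_subsets_at_top UNIV. norm ((\<Sum>\<gamma>\<in>F. cinner (cM k \<gamma>) (s \<gamma>)) - LI f (NN s))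
      \<le> nrm LI f * sqrt (Qs s - (\<Sum>\<alpha>\<in>F. rho m \<alpha> * (norm (s \<alpha>))\<^sup>2))"
      by (rule eventually_finite_subsets_at_top_weakI) (rule bound)
    have "((\<lambda>F. \<Sum>\<alpha>\<in>F. rho m \<alpha> * (norm (s \<alpha>))\<^sup>2) \<longlongrightarrow> Qs s) (finite_subsets_at_top UNIV)"
      unfolding Qs_def by (rule infsum_tendsto[OF sm])
    then have "((\<lambda>F. nrm LI f * sqrt (Qs s - (\<Sum>\<alpha>\<in>F. rho m \<alpha> * (norm (s \<alpha>))\<^sup>2))) \<longlongrightarrow> nrm LI f * sqrt (Qs s - Qs s)) (finite_subsets_at_top UNIV)"
      by (intro tendsto_intros)
    then show "((\<lambda>F. nrm LI f * sqrt (Qs s - (\<Sum>\<alpha>\<in>F. rho m \<alpha> * (norm (s \<alpha>))\<^sup>2))) \<longlongrightarrow> 0) (finite_subsets_at_top UNIV)"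
      by simp
  qed
qed

subsection \<open>The multiplier\<close>

text \<open>Here boundedness of the multiplier is obtained: the coefficients of
  \<open>\<theta>_T f\<close> are paired with their own truncations, and \<open>NN\<close> is a
  contraction.\<close>

lemma cM_summable:
  assumes f: "f \<in> LS" and k: "is_coef 1 IK K k f"
  shows "(\<lambda>\<gamma>. (norm (cM k \<gamma>))\<^sup>2 / rho m \<gamma>) summable_on UNIV"
proof (rule coef_bound(1))
  have km: "k \<beta> \<in> K" for \<beta> using k by (simp add: is_coef_def)
  show "0 \<le> nrm LI f" using f by simp
  fix F :: "('n \<Rightarrow> nat) set" assume F: "finite F"
  have e: "ell (cut F (cM k))" by (rule ell_cut[OF cM_mem[OF km] F])
  have "((\<lambda>\<alpha>. cinner (cM k \<alpha>) (cut F (cM k) \<alpha>)) has_sum of_real (\<Sum>\<alpha>\<in>F. (norm (cM k \<alpha>))\<^sup>2 / rho m \<alpha>)) UNIV"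
    by (rule has_sum_finite_neutralI[OF F]) (auto simp: cut_inner)
  then have "of_real (\<Sum>\<alpha>\<in>F. (norm (cM k \<alpha>))\<^sup>2 / rho m \<alpha>) = LI f (NN (cut F (cM k)))"
    using cM_inner[OF f k e] has_sum_unique by blast
  then have "(\<Sum>\<alpha>\<in>F. (norm (cM k \<alpha>))\<^sup>2 / rho m \<alpha>) = Re (LI f (NN (cut F (cM k))))"
    by (metis Re_complex_of_real)
  also have "\<dots> \<le> nrm LI f * nrm LI (NN (cut F (cM k)))"
    by (rule order_trans[OF complex_Re_le_cmod L.Cauchy_Schwarz[OF f NN(1)[OF e]]])
  also have "\<dots> \<le> nrm LI f * sqrt (Qs (cut F (cM k)))"
    by (intro mult_left_mono NN_nrm_le e L.nm_nonneg f)
  finally show "(\<Sum>\<alpha>\<in>F. (norm (cM k \<alpha>))\<^sup>2 / rho m \<alpha>) \<le> nrm LI f * sqrt (Qs (cut F (cM k)))" .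
qed

text \<open>The double family of terms is absolutely summable, as \<open>theta\<close> is bounded at
  \<open>z\<close> and the series of \<open>f\<close> converges absolutely in norm. Summation over
  \<alpha> first gives \<open>\<theta>_T(z) f(z)\<close>; summation over pairs with \<alpha> +
  \<beta> = \<gamma> gives the Cauchy product.\<close>

lemma theta_cM:
  assumes k: "is_coef 1 IK K k f" and z: "z \<in> Bn"
  shows "((\<lambda>\<gamma>. cscale (zpow z \<gamma>) (cM k \<gamma>)) has_sum theta T m U z (f z)) UNIV"
proof -
  have km: "k \<beta> \<in> K" for \<beta> using k by (simp add: is_coef_def)
  have ks: "KP.sqs 1 k" using k by (simp add: KP.is_coef_iff)
  define F where "F = (\<lambda>(\<beta>, \<alpha>). cscale (zpow z \<beta> * zpow z \<alpha>) (th (k \<beta>) \<alpha>))"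
  have nF: "norm (F (\<beta>, \<alpha>)) = cmod (zpow z \<beta>) * (cmod (zpow z \<alpha>) * norm (th (k \<beta>) \<alpha>))" for \<beta> \<alpha>
    by (simp add: F_def norm_mult mult.assoc)
  have "(\<lambda>x. norm (F x)) summable_on UNIV \<times> UNIV"
    unfolding Infinite_Sum.abs_summable_on_Sigma_iff
  proof (intro conjI ballI)
    show "(\<lambda>\<alpha>. norm (F (\<beta>, \<alpha>))) summable_on UNIV" for \<beta>
      unfolding nF by (rule summable_on_cmult_right[OF th_abs(1)[OF km z]])
    show "(\<lambda>\<beta>. norm (\<Sum>\<^sub>\<infinity>\<alpha>. norm (F (\<beta>, \<alpha>)))) summable_on UNIV"
    proof (rule Infinite_Sum.abs_summable_on_comparison_test')
      show "(\<lambda>\<beta>. kap m z * (cmod (zpow z \<beta>) * nrm IK (k \<beta>))) summable_on UNIV"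
        by (rule summable_on_cmult_right[OF KP.abs_conv(1)[OF ks z order_refl]])
      fix \<beta>
      have "(\<Sum>\<^sub>\<infinity>\<alpha>. norm (F (\<beta>, \<alpha>))) = cmod (zpow z \<beta>) * (\<Sum>\<^sub>\<infinity>\<alpha>. cmod (zpow z \<alpha>) * norm (th (k \<beta>) \<alpha>))"
        unfolding nF by (rule infsum_cmult_right')
      also have "\<dots> \<le> cmod (zpow z \<beta>) * (kap m z * nrm IK (k \<beta>))"
        by (rule mult_left_mono[OF th_abs(2)[OF km z]]) simp
      finally show "norm (\<Sum>\<^sub>\<infinity>\<alpha>. norm (F (\<beta>, \<alpha>))) \<le> kap m z * (cmod (zpow z \<beta>) * nrm IK (k \<beta>))"
        by (simp add: infsum_nonneg mult_ac)
    qed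
  qed
  then have "F summable_on UNIV \<times> UNIV" by (rule abs_summable_summable)
  then obtain s where s: "(F has_sum s) (UNIV \<times> UNIV)" by (auto simp: summable_on_def)
  have "((\<lambda>\<beta>. cscale (zpow z \<beta>) (theta T m U z (k \<beta>))) has_sum s) UNIV"
  proof (rule has_sum_SigmaD[OF s])
    fix \<beta>
    have "((\<lambda>\<alpha>. cscale (zpow z \<beta>) (cscale (zpow z \<alpha>) (th (k \<beta>) \<alpha>))) has_sum cscale (zpow z \<beta>) (theta T m U z (k \<beta>))) UNIV"
      by (rule has_sum_bounded_linear[OF bounded_linear_cscale_right theta_th[OF km z]])
    then show "((\<lambda>\<alpha>. F (\<beta>, \<alpha>)) has_sum cscale (zpow z \<beta>) (theta T m U z (k \<beta>))) UNIV"
      by (simp add: F_def cscale_cscale)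
  qed
  moreover have "((\<lambda>\<beta>. cscale (zpow z \<beta>) (theta T m U z (k \<beta>))) has_sum theta T m U z (f z)) UNIV"
  proof -
    have "((\<lambda>\<beta>. cscale (zpow z \<beta>) (k \<beta>)) has_sum f z) UNIV" using k z by (simp add: is_coef_def)
    from theta_cont[OF K.scale_closed[OF km] this z] show ?thesis by (simp add: theta_sc km z)
  qed
  ultimately have st: "s = theta T m U z (f z)" by (rule has_sum_unique)
  have "((\<lambda>(\<gamma>, \<beta>). F (\<beta>, sub \<gamma> \<beta>)) has_sum s) (SIGMA \<gamma>:UNIV. below \<gamma>)"
    by (subst has_sum_reindex_bij_witness[where j = "\<lambda>(\<gamma>, \<beta>). (\<beta>, sub \<gamma> \<beta>)" and i = "\<lambda>(\<beta>, \<alpha>). (\<alpha> + \<beta>, \<beta>)"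
          and T = "UNIV \<times> UNIV" and h = F and s' = s]) (use s in \<open>auto simp: sub_add\<close>)
  then have "((\<lambda>\<gamma>. cscale (zpow z \<gamma>) (cM k \<gamma>)) has_sum s) UNIV"
  proof (rule has_sum_SigmaD)
    fix \<gamma>
    have "zpow z \<beta> * zpow z (sub \<gamma> \<beta>) = zpow z \<gamma>" if "\<beta> \<in> below \<gamma>" for \<beta>
      using sub_add(1)[OF that] by (metis mult.commute zpow_add)
    then have "(\<Sum>\<beta>\<in>below \<gamma>. F (\<beta>, sub \<gamma> \<beta>)) = cscale (zpow z \<gamma>) (cM k \<gamma>)"
      by (simp add: F_def cM_def cscale_sum_right)
    then show "((\<lambda>\<beta>. case (\<gamma>, \<beta>) of (\<gamma>, \<beta>) \<Rightarrow> F (\<beta>, sub \<gamma> \<beta>)) has_sum cscale (zpow z \<gamma>) (cM k \<gamma>)) (below \<gamma>)"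
      by (intro has_sum_finiteI finite_below) simp
  qed
  then show ?thesis by (simp only: st)
qed

abbreviation M where "M \<equiv> Mtheta T m U"
definition N where "N g = NN (nc g)"

lemma M_mkf:
  assumes k: "is_coef 1 IK K k f"
  shows "M f = mkf (cM k)"
proof
  fix z show "M f z = mkf (cM k) z"
    using theta_cM[OF k, of z] by (auto simp: Mtheta_def mkf_def infsumI)
qed

lemma M_mem: "f \<in> LS \<Longrightarrow> M f \<in> S.HS m"
proof -
  assume f: "f \<in> LS"
  have k: "is_coef 1 IK K (hcoef 1 IK K f) f" by (rule KP.is_coef_hcoef[OF order_refl f])
  then have km: "hcoef 1 IK K f \<beta> \<in> K" for \<beta> by (simp add: is_coef_def)
  show ?thesis unfolding M_mkf[OF k] by (rule coef_mkf(1)[OF cM_mem[OF km] cM_summable[OF f k]])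
qed

lemma N_mem: "g \<in> S.HS m \<Longrightarrow> N g \<in> LS"
  unfolding N_def by (rule NN(1)[OF ell_nc])

lemma M_adj:
  assumes f: "f \<in> LS" and g: "g \<in> S.HS m"
  shows "S.HI m (M f) g = LI f (N g)"
proof -
  define k where "k = hcoef 1 IK K f"
  have k: "is_coef 1 IK K k f" unfolding k_def by (rule KP.is_coef_hcoef[OF order_refl f])
  then have km: "k \<beta> \<in> K" for \<beta> by (simp add: is_coef_def)
  have hcM: "hc m D (mkf (cM k)) = cM k" by (rule coef_mkf(2)[OF cM_mem[OF km] cM_summable[OF f k]])
  have "S.HI m (M f) g = (\<Sum>\<^sub>\<infinity>\<gamma>. cinner (cM k \<gamma>) (nc g \<gamma>))"
    using m1 by (simp add: M_mkf[OF k] S.hip_hc hcM hc_nc rr_pos scaleR_cscale cinner_simps)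
  also have "\<dots> = LI f (N g)" unfolding N_def by (rule infsumI[OF cM_inner[OF f k ell_nc[OF g]]])
  finally show ?thesis .
qed

text \<open>Linearity of \<open>M\<close>, and below of \<open>N\<close>, follows from the adjoint
  relation, since each of the two maps is determined by its inner products.\<close>

lemma M_add: "f \<in> LS \<Longrightarrow> g \<in> LS \<Longrightarrow> M (f + g) = M f + M g"
  by (rule Mm.ip_ext_left) (simp_all add: M_mem L.add_closed Mm.add_closed M_adj Mm.ip_add_left L.ip_add_left N_mem)

lemma M_sc: "f \<in> LS \<Longrightarrow> M (cscale c f) = cscale c (M f)"
  by (rule Mm.ip_ext_left) (simp_all add: M_mem L.scale_closed Mm.scale_closed M_adj Mm.ip_scale_left L.ip_scale_left N_mem)

lemma N_add: "f \<in> S.HS m \<Longrightarrow> g \<in> S.HS m \<Longrightarrow> N (f + g) = N f + N g"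
  by (rule L.ip_ext) (simp_all add: N_mem L.add_closed Mm.add_closed flip: M_adj, simp add: L.ip_add_right N_mem Mm.ip_add_right M_mem flip: M_adj)

lemma N_sc: "f \<in> S.HS m \<Longrightarrow> N (cscale c f) = cscale c (N f)"
  by (rule L.ip_ext) (simp_all add: N_mem L.scale_closed Mm.scale_closed flip: M_adj, simp add: L.ip_scale_right N_mem Mm.ip_scale_right M_mem flip: M_adj)

section \<open>The identity for the two projections and the partial isometry\<close>

definition j_adj where "j_adj g = js (nc g)"

lemma j_adj: "g \<in> S.HS m \<Longrightarrow> S.HI m (J x) g = cinner x (j_adj g)"
  using J_adj by (simp add: is_adj_def j_adj_def)

lemma j_adj_add: "f \<in> S.HS m \<Longrightarrow> g \<in> S.HS m \<Longrightarrow> j_adj (f + g) = j_adj f + j_adj g"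
  by (rule cinner_ext) (simp add: cinner_simps Mm.ip_add_right J_mem Mm.add_closed flip: j_adj)

lemma j_adj_sc: "f \<in> S.HS m \<Longrightarrow> j_adj (cscale c f) = cscale c (j_adj f)"
  by (rule cinner_ext) (simp add: cinner_simps Mm.ip_scale_right J_mem Mm.scale_closed flip: j_adj)

text \<open>By \<open>NN_norm\<close> the quadratic form of \<open>M N + j j^* - 1\<close> vanishes
  identically.\<close>

lemma MN_JJ:
  assumes g: "g \<in> S.HS m"
  shows "M (N g) + J (j_adj g) = g"
proof -
  define B where "B g = M (N g) + J (j_adj g) - g" for g
  have "B g = 0"
  proof (rule Mm.quadratic_form_eq_0[OF _ _ _ _ g])
    fix x y c assume x: "x \<in> S.HS m"
    show "B x \<in> S.HS m" unfolding B_def by (intro Mm.diff_closed Mm.add_closed M_mem N_mem J_mem x)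
    show "B (cscale c x) = cscale c (B x)"
      by (simp add: B_def N_sc M_sc N_mem j_adj_sc J_sc x cscale_diff_right cscale_add_right)
    have "S.HI m (B x) x = LI (N x) (N x) + cinner (j_adj x) (j_adj x) - S.HI m x x"
      by (simp add: B_def Mm.ip_diff_left Mm.ip_add_left Mm.add_closed M_mem N_mem J_mem x M_adj j_adj)
    also have "\<dots> = 0"
      by (simp add: N_def NN_norm[OF ell_nc[OF x]] j_adj_def cinner_self HI_self_nc[OF x])
    finally show "S.HI m (B x) x = 0" .
    assume y: "y \<in> S.HS m"
    show "B (x + y) = B x + B y"
      by (simp add: B_def N_add M_add N_mem j_adj_add J_add x y)
  qed
  then show ?thesis by (simp add: B_def)
qed

lemma j_adj_J: "j_adj (J x) = x"
  by (rule cinner_ext) (simp add: J_ip J_mem flip: j_adj)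

text \<open>The squared norm of \<open>N (J x)\<close> is that of \<open>J x\<close> minus that of
  \<open>j^* j x = x\<close>, which is 0 because j is an isometry.\<close>

lemma N_J: "N (J x) = 0"
proof (rule L.ip_definite[OF N_mem[OF J_mem]])
  have "js (cf x) = x" using j_adj_J[of x] by (simp add: j_adj_def nc_J)
  then show "LI (N (J x)) (N (J x)) = 0"
    by (simp add: N_def nc_J NN_norm ell_cf Qs_cf)
qed

text \<open>The ranges of \<open>M\<close> and of j are orthogonal because \<open>N\<close>
  annihilates the range of j. Applied to \<open>M f\<close>, the identity
  \<open>M N + j j^* = 1\<close> therefore loses its second term.\<close>

lemma MNM:
  assumes f: "f \<in> LS"
  shows "M (N (M f)) = M f"
proof -
  have "S.HI m (J x) (M f) = 0" for x
  proof -
    have "S.HI m (M f) (J x) = 0" by (simp add: M_adj f J_mem N_J)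
    then show ?thesis using Mm.ip_commute[OF M_mem[OF f] J_mem, of x] by simp
  qed
  then have "j_adj (M f) = 0"
    by (intro cinner_ext) (simp add: M_mem f cinner_simps flip: j_adj)
  moreover have "J 0 = 0" using J_sc[of 0 0] by simp
  ultimately show ?thesis using MN_JJ[OF M_mem[OF f]] by simp
qed

lemma M_is_adj: "is_adj LI LS (S.HI m) (S.HS m) M N"
  by (auto simp: is_adj_def N_mem M_adj)

lemma M_bound: "f \<in> LS \<Longrightarrow> nrm (S.HI m) (M f) \<le> 1 * nrm LI f"
proof -
  assume f: "f \<in> LS"
  define a where "a = nrm (S.HI m) (M f)"
  have a0: "0 \<le> a" using M_mem[OF f] by (simp add: a_def)
  have "a\<^sup>2 = Re (LI f (N (M f)))" by (simp add: a_def Mm.nm_sq M_mem f M_adj)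
  also have "\<dots> \<le> nrm LI f * nrm LI (N (M f))"
    by (rule order_trans[OF complex_Re_le_cmod L.Cauchy_Schwarz[OF f N_mem[OF M_mem[OF f]]]])
  also have "\<dots> \<le> nrm LI f * sqrt (Qs (nc (M f)))"
    unfolding N_def by (intro mult_left_mono NN_nrm_le ell_nc M_mem f L.nm_nonneg)
  also have "sqrt (Qs (nc (M f))) = a"
    using a0 by (simp add: a_def flip: nrm_nc[OF M_mem[OF f]])
  finally have "a * a \<le> nrm LI f * a" by (simp add: power2_eq_square)
  then have "a \<le> nrm LI f" using a0 mult_right_le_imp_le[of a a "nrm LI f"] f by (cases "a = 0") simp_all
  then show ?thesis by (simp add: a_def)
qed

text \<open>By \<open>M N M = M\<close>, the vector \<open>y = x - N (M x)\<close> lies in the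
  kernel of \<open>M\<close>. It is orthogonal to \<open>N (M x)\<close> by adjointness, and to
  \<open>x\<close> when \<open>x\<close> is orthogonal to the kernel; so \<open>y = 0\<close>, and
  the inner product of \<open>x\<close> with \<open>x = N (M x)\<close> is the squared norm of
  \<open>M x\<close>.\<close>

lemma M_pisom: "pisom LI LS (S.HI m) (S.HS m) M"
  unfolding pisom_def
proof (intro conjI ballI impI)
  show "linear_on LS (S.HS m) M"
    by (auto simp: linear_on_def M_mem M_add M_sc)
  show "bnd_on LI LS (S.HI m) M"
    unfolding bnd_on_def using M_bound by blast
  fix x assume x: "x \<in> LS" and orth: "\<forall>y\<in>LS. M y = 0 \<longrightarrow> LI x y = 0"
  define w where "w = N (M x)"
  define y where "y = x - w"
  have w: "w \<in> LS" unfolding w_def by (intro N_mem M_mem x)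
  have y: "y \<in> LS" unfolding y_def by (intro L.diff_closed x w)
  have "M y + M w = M x" using M_add[OF y w] by (simp add: y_def)
  then have My: "M y = 0" by (simp add: w_def MNM x)
  have "LI y w = 0" unfolding w_def M_adj[OF y M_mem[OF x], symmetric] by (simp add: My M_mem x)
  then have "LI w y = 0" using L.ip_commute[OF y w] by simp
  moreover have "LI x y = 0" using orth y My by blast
  ultimately have "LI y y = 0" unfolding y_def by (metis L.ip_diff_left diff_zero w x y y_def)
  then have "y = 0" using L.ip_definite[OF y] by simp
  then have "x = N (M x)" by (simp add: y_def w_def)
  then have "S.HI m (M x) (M x) = LI x x" using M_adj[OF x M_mem[OF x]] by simp
  then show "nrm (S.HI m) (M x) = nrm LI x" by (simp add: nrm_def)
qed

lemma multiplier_partial_isometry: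
  "M ` LS \<subseteq> S.HS m \<and> pisom LI LS (S.HI m) (S.HS m) M \<and>
   (\<forall>f\<in>S.HS m. M (adj LI LS (S.HI m) (S.HS m) M f) + J (adj cinner UNIV (S.HI m) (S.HS m) J f) = f)"
proof (intro conjI ballI)
  show "M ` LS \<subseteq> S.HS m" using M_mem by blast
  fix f assume f: "f \<in> S.HS m"
  show "M (adj LI LS (S.HI m) (S.HS m) M f) + J (adj cinner UNIV (S.HI m) (S.HS m) J f) = f"
    using MN_JJ[OF f] by (simp only: L.adj_eq[OF M_is_adj f] adj_J[OF f] j_adj_def)
qed (rule M_pisom)

end

theorem theorem13:
  fixes T :: "'n::finite \<Rightarrow> 'h::chilbert \<Rightarrow> 'h"
    and m :: nat
    and U :: "'h \<Rightarrow> ('n \<Rightarrow> complex) \<Rightarrow> 'h"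
  assumes bl: "\<And>i. cblin (T i)"
    and comm: "\<And>i k. T i \<circ> T k = T k \<circ> T i"
    and hc: "hypercontraction T m"
    and pu: "pure T"
    and U: "is_U T m U"
  shows "Mtheta T m U ` hsp 1 (ipK T m) (Ksp T m) \<subseteq> hsp m cinner (Dsp T m)
    \<and> pisom (hip 1 (ipK T m) (Ksp T m)) (hsp 1 (ipK T m) (Ksp T m))
            (hip m cinner (Dsp T m)) (hsp m cinner (Dsp T m)) (Mtheta T m U)
    \<and> (\<forall>f \<in> hsp m cinner (Dsp T m).
          Mtheta T m U (adj (hip 1 (ipK T m) (Ksp T m)) (hsp 1 (ipK T m) (Ksp T m))
                            (hip m cinner (Dsp T m)) (hsp m cinner (Dsp T m)) (Mtheta T m U) f)
        + jmap T m (adj cinner UNIV (hip m cinner (Dsp T m)) (hsp m cinner (Dsp T m)) (jmap T m) f)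
        = f)"
proof -
  interpret hyper T m U by unfold_locales (fact assms)+
  show ?thesis by (rule multiplier_partial_isometry)
qed

end
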